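(* Let $\{e^{t\mathcal A}\}_{t\ge0}$ be the semigroup generated by $\mathcal A=(A^0)^{-1}\big(-A^1\partial_x+B\partial_x^2+C\partial_x^3\big)$ (see the context). For any $f\in\big(H^{s+1}(\mathbb R)\times H^s(\mathbb R)\times H^s(\mathbb R)\big)\cap\big(L^1(\mathbb R)\big)^3$, $s\ge3$, and $0\le\ell\le s$, $t\ge0$, the estimate $$\Big(\|\partial_x^\ell(e^{t\mathcal A}f)_1\|_1^2+\|\partial_x^\ell(e^{t\mathcal A}f)_2\|_0^2+\|\partial_x^\ell(e^{t\mathcal A}f)_3\|_0^2\Big)^{1/2}\le Ce^{-c_1t}\Big(\|\partial_x^\ell f_1\|_1^2+\|\partial_x^\ell f_2\|_0^2+\|\partial_x^\ell f_3\|_0^2\Big)^{1/2}+C(1+t)^{-(\ell/2+1/4)}\|f\|_{L^1}$$ holds for some uniform constants $C,c_1>0$.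
   Context: $\|\cdot\|_s$ is the norm of $H^s(\mathbb R)$, $\|\cdot\|_0$ that of $L^2(\mathbb R)$; $\ell$ is an integer (order of differentiation). $\overline\rho,\overline\theta,\overline p_\rho,\overline p_\theta,\overline e_\theta,\overline\mu,\overline\alpha,\overline k>0$ and $\overline u\in\mathbb R$ are constants (a constant state $(\overline\rho,\overline u,\overline\theta)$ and the values at it of derivatives of the pressure $p$ and internal energy $e$, the viscosity, heat conductivity and capillarity), and $$A^0=\frac1{\overline\theta}\begin{pmatrix}\overline p_\rho/\overline\rho&0&0\\0&\overline\rho&0\\0&0&\overline e_\theta\overline\rho/\overline\theta\end{pmatrix},\quad A^1=\frac1{\overline\theta}\begin{pmatrix}\overline p_\rho\overline u/\overline\rho&\overline p_\rho&0\\\overline p_\rho&\overline\rho\,\overline u&\overline p_\theta\\0&\overline p_\theta&\overline\rho\,\overline u\,\overline e_\theta/\overline\theta\end{pmatrix},$$ $$B=\frac1{\overline\theta}\begin{pmatrix}0&0&0\\0&\overline\mu&0\\0&0&\overline\alpha/\overline\theta\end{pmatrix},\quad C=\frac1{\overline\theta}\begin{pmatrix}0&0&0\\\overline k\,\overline\rho&0&0\\0&0&0\end{pmatrix}.$$ (The matrix $C$ in $\mathcal A$ is not to be confused with the scalar constant $C$ in the estimate.) The semigroup is given by $$(e^{t\mathcal A}f)(x)=\frac1{\sqrt{2\pi}}\int_{\mathbb R}e^{i\xi x}e^{-tM(i\xi)}\widehat f(\xi)\,d\xi,\qquad M(i\xi)=(A^0)^{-1}\big(i\xi(A^1+\xi^2C)+\xi^2B\big),$$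 i.e. $W=e^{t\mathcal A}f$ solves $W_t=\mathcal AW$, $W(0)=f$. *)

theory Defs
  imports "HOL-Analysis.Analysis"
begin

section \<open>Fourier transform, weak derivatives and Sobolev spaces on the real line\<close>

text \<open>Functions are complex-valued; elements of \<open>L\<^sup>2\<close> are represented by Borel functions and
  are not identified when they agree almost everywhere. Transforms and derivatives of
  \<open>L\<^sup>2\<close> functions are therefore only determined almost everywhere.\<close>

definition fourier :: "(real \<Rightarrow> complex) \<Rightarrow> real \<Rightarrow> complex" where
  "fourier f \<xi> = complex_of_real (1 / sqrt (2 * pi)) *
     (LINT x|lborel. exp (- (\<i> * complex_of_real (\<xi> * x))) * f x)"

definition inv_fourier :: "(real \<Rightarrow> complex) \<Rightarrow> real \<Rightarrow> complex" where
  "inv_fourier g x = complex_of_real (1 / sqrt (2 * pi)) *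
     (LINT \<xi>|lborel. exp (\<i> * complex_of_real (\<xi> * x)) * g \<xi>)"

definition L2 :: "(real \<Rightarrow> complex) set" where
  "L2 = {f. f \<in> borel_measurable lborel \<and> integrable lborel (\<lambda>x. (cmod (f x))\<^sup>2)}"

definition L2_norm :: "(real \<Rightarrow> complex) \<Rightarrow> real" where
  "L2_norm f = sqrt (LINT x|lborel. (cmod (f x))\<^sup>2)"

definition vderiv :: "nat \<Rightarrow> (real \<Rightarrow> complex) \<Rightarrow> real \<Rightarrow> complex" where
  "vderiv n \<phi> = ((\<lambda>g x. vector_derivative g (at x)) ^^ n) \<phi>"

definition schwartz :: "(real \<Rightarrow> complex) set" where
  "schwartz = {\<phi>. \<forall>j n. (\<forall>x. vderiv n \<phi> differentiable (at x)) \<and>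
                        bounded (range (\<lambda>x. x ^ j *\<^sub>R vderiv n \<phi> x))}"

text \<open>For \<open>u\<close>, \<open>v\<close> in \<open>L\<^sup>2\<close>, testing against Schwartz functions is equivalent to testing against
  smooth functions of compact support.\<close>

definition is_weak_deriv :: "nat \<Rightarrow> (real \<Rightarrow> complex) \<Rightarrow> (real \<Rightarrow> complex) \<Rightarrow> bool" where
  "is_weak_deriv n u v \<longleftrightarrow> u \<in> L2 \<and> v \<in> L2 \<and>
     (\<forall>\<phi>\<in>schwartz. (LINT x|lborel. v x * \<phi> x) = (- 1) ^ n * (LINT x|lborel. u x * vderiv n \<phi> x))"

definition weak_deriv :: "nat \<Rightarrow> (real \<Rightarrow> complex) \<Rightarrow> real \<Rightarrow> complex" where
  "weak_deriv n u = (SOME v. is_weak_deriv n u v)"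

text \<open>The Fourier transform on \<open>L\<^sup>2\<close>, characterised by duality as for tempered distributions,
  since the integral in \<^const>\<open>fourier\<close> need not converge absolutely.\<close>

definition is_fourier_L2 :: "(real \<Rightarrow> complex) \<Rightarrow> (real \<Rightarrow> complex) \<Rightarrow> bool" where
  "is_fourier_L2 u v \<longleftrightarrow> u \<in> L2 \<and> v \<in> L2 \<and>
     (\<forall>\<phi>\<in>schwartz. (LINT \<xi>|lborel. v \<xi> * \<phi> \<xi>) = (LINT x|lborel. u x * fourier \<phi> x))"

definition fourier_L2 :: "(real \<Rightarrow> complex) \<Rightarrow> real \<Rightarrow> complex" where
  "fourier_L2 u = (SOME v. is_fourier_L2 u v)"

definition sobolev :: "real \<Rightarrow> (real \<Rightarrow> complex) set" where
  "sobolev s = {u \<in> L2. (\<lambda>\<xi>. complex_of_real ((1 + \<xi>\<^sup>2) powr (s / 2)) * fourier_L2 u \<xi>) \<in> L2}"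

definition sobolev_norm :: "real \<Rightarrow> (real \<Rightarrow> complex) \<Rightarrow> real" where
  "sobolev_norm s u =
     L2_norm (\<lambda>\<xi>. complex_of_real ((1 + \<xi>\<^sup>2) powr (s / 2)) * fourier_L2 u \<xi>)"


section \<open>The linearised system\<close>

definition state_space :: "real \<Rightarrow> (real \<Rightarrow> complex^3) set" where
  "state_space s = {f. (\<lambda>x. f x $ 1) \<in> sobolev (s + 1) \<and>
                       (\<lambda>x. f x $ 2) \<in> sobolev s \<and> (\<lambda>x. f x $ 3) \<in> sobolev s}"

definition deriv_norm :: "nat \<Rightarrow> (real \<Rightarrow> complex^3) \<Rightarrow> real" where
  "deriv_norm l f = sqrt ((sobolev_norm 1 (weak_deriv l (\<lambda>x. f x $ 1)))\<^sup>2 +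
                          (L2_norm (weak_deriv l (\<lambda>x. f x $ 2)))\<^sup>2 +
                          (L2_norm (weak_deriv l (\<lambda>x. f x $ 3)))\<^sup>2)"

definition A0_mat :: "real \<Rightarrow> real \<Rightarrow> real \<Rightarrow> real \<Rightarrow> real^3^3" where
  "A0_mat \<rho> \<theta> p\<^sub>\<rho> e\<^sub>\<theta> = (1 / \<theta>) *\<^sub>R vector
     [vector [p\<^sub>\<rho> / \<rho>, 0, 0],
      vector [0, \<rho>, 0],
      vector [0, 0, e\<^sub>\<theta> * \<rho> / \<theta>]]"

definition A1_mat :: "real \<Rightarrow> real \<Rightarrow> real \<Rightarrow> real \<Rightarrow> real \<Rightarrow> real \<Rightarrow> real^3^3" where
  "A1_mat \<rho> u \<theta> p\<^sub>\<rho> p\<^sub>\<theta> e\<^sub>\<theta> = (1 / \<theta>) *\<^sub>R vector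
     [vector [p\<^sub>\<rho> * u / \<rho>, p\<^sub>\<rho>, 0],
      vector [p\<^sub>\<rho>, \<rho> * u, p\<^sub>\<theta>],
      vector [0, p\<^sub>\<theta>, \<rho> * u * e\<^sub>\<theta> / \<theta>]]"

definition B_mat :: "real \<Rightarrow> real \<Rightarrow> real \<Rightarrow> real^3^3" where
  "B_mat \<theta> \<mu> \<alpha> = (1 / \<theta>) *\<^sub>R vector
     [vector [0, 0, 0],
      vector [0, \<mu>, 0],
      vector [0, 0, \<alpha> / \<theta>]]"

definition C_mat :: "real \<Rightarrow> real \<Rightarrow> real \<Rightarrow> real^3^3" where
  "C_mat \<rho> \<theta> k = (1 / \<theta>) *\<^sub>R vector
     [vector [0, 0, 0],
      vector [k * \<rho>, 0, 0],
      vector [0, 0, 0]]"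

definition cmat :: "real^3^3 \<Rightarrow> complex^3^3" where
  "cmat A = (\<chi> i j. complex_of_real (A $ i $ j))"

text \<open>\<^const>\<open>exp\<close> is not available here: the product \<open>*\<close> on vectors is componentwise.\<close>

definition mat_exp :: "complex^3^3 \<Rightarrow> complex^3^3" where
  "mat_exp A = (\<Sum>n. ((\<lambda>X. A ** X) ^^ n) (mat 1) /\<^sub>R fact n)"

definition M_symbol :: "real^3^3 \<Rightarrow> real^3^3 \<Rightarrow> real^3^3 \<Rightarrow> real^3^3 \<Rightarrow> real \<Rightarrow> complex^3^3" where
  "M_symbol A0 A1 B C \<xi> = cmat (matrix_inv A0) **
     (\<chi> i j. \<i> * complex_of_real (\<xi> * (A1 $ i $ j + \<xi>\<^sup>2 * C $ i $ j)) +
             complex_of_real (\<xi>\<^sup>2 * B $ i $ j))"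

text \<open>The semigroup \<open>e\<^sup>t\<^sup>\<A> f\<close> for integrable \<open>f\<close>, where the transform of \<open>f\<close> is the classical
  integral.\<close>

definition semigroup_op ::
  "real^3^3 \<Rightarrow> real^3^3 \<Rightarrow> real^3^3 \<Rightarrow> real^3^3 \<Rightarrow> real \<Rightarrow> (real \<Rightarrow> complex^3) \<Rightarrow> real \<Rightarrow> complex^3"
  where
  "semigroup_op A0 A1 B C t f x =
     (\<chi> i. inv_fourier
        (\<lambda>\<xi>. (mat_exp (- (t *\<^sub>R M_symbol A0 A1 B C \<xi>)) *v (\<chi> j. fourier (\<lambda>y. f y $ j) \<xi>)) $ i) x)"

end

theory Submission
  imports Defs "HOL-Probability.Probability"
begin

text \<open>For each frequency \<open>\<xi>\<close> the transform \<open>w\<close> of the solution obeys a linear ODE. The energy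
  \<open>(p\<^sub>\<rho> / \<rho> + k \<xi>\<^sup>2) |w\<^sub>1|\<^sup>2 / \<rho> + |w\<^sub>2|\<^sup>2 + const |w\<^sub>3|\<^sup>2\<close> (capillarity symmetrises the third order term) is
  dissipated by viscosity and heat conduction in the last two components only; adding a small multiple of
  \<open>\<xi> / (1 + \<xi>\<^sup>2) Im (cnj w\<^sub>1 w\<^sub>2)\<close> gives an equivalent Lyapunov function decaying at the rate
  \<open>c \<xi>\<^sup>2 / (1 + \<xi>\<^sup>2)\<close>. By Plancherel the estimate follows from \<open>|\<xi>| \<ge> 1\<close>, where the rate is bounded
  below, and \<open>|\<xi>| \<le> 1\<close>, where the transform of \<open>f\<close> is bounded by the \<open>L\<^sup>1\<close> norm and a Gaussian moment
  produces the factor \<open>(1 + t)\<close> to the power \<open>- (l + 1/2)\<close>.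

  Plancherel's theorem is obtained by regularising with Gaussians and Schur's bound; uniqueness of
  functions tested against Schwartz functions is reduced to Levy's uniqueness theorem by testing with
  modulated Gaussians.\<close>

section \<open>Fourier transform of integrable functions\<close>

lemma fourier_measurable [measurable]:
  assumes [measurable]: "f \<in> borel_measurable borel"
  shows "fourier f \<in> borel_measurable borel"
  unfolding fourier_def by measurable

lemma inv_fourier_eq: "inv_fourier g x = fourier g (- x)"
proof -
  have "exp (\<i> * complex_of_real (\<xi> * x)) = exp (- (\<i> * complex_of_real ((- x) * \<xi>)))" for \<xi>
    by (simp add: mult.commute)
  then show ?thesis unfolding fourier_def inv_fourier_def by simp
qed

lemma fourier_uminus: "fourier (\<lambda>x. f (- x)) \<xi> = fourier f (- \<xi>)"
  unfolding fourier_def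
  by (subst lborel_integral_real_affine[of "-1" _ 0]) auto

lemma fourier_cnj: "fourier (\<lambda>x. cnj (f x)) \<xi> = cnj (fourier f (- \<xi>))"
proof -
  have "cnj (exp (- (\<i> * complex_of_real (- \<xi> * x))) * f x) = exp (- (\<i> * complex_of_real (\<xi> * x))) * cnj (f x)" for x
    by (simp add: exp_cnj)
  then have "(LINT x|lborel. exp (- (\<i> * complex_of_real (\<xi> * x))) * cnj (f x))
      = (LINT x|lborel. cnj (exp (- (\<i> * complex_of_real (- \<xi> * x))) * f x))"
    by (metis (lifting))
  also have "\<dots> = cnj (LINT x|lborel. exp (- (\<i> * complex_of_real (- \<xi> * x))) * f x)"
    by (rule Bochner_Integration.integral_cnj)
  finally show ?thesis unfolding fourier_def by simp
qed

lemma cmod_exp_ii [simp]: "cmod (exp (\<i> * complex_of_real a)) = 1" 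
  "cmod (exp (- (\<i> * complex_of_real a))) = 1"
  by simp_all

lemma integrable_exp_mult:
  assumes "integrable lborel (f :: real \<Rightarrow> complex)"
  shows "integrable lborel (\<lambda>x. exp (- (\<i> * complex_of_real (\<xi> * x))) * f x)"
  by (rule Bochner_Integration.integrable_bound[OF assms]) (use assms in \<open>auto simp: norm_mult\<close>)

lemma norm_fourier_le:
  assumes "integrable lborel f"
  shows "cmod (fourier f \<xi>) \<le> 1 / sqrt (2 * pi) * (LINT x|lborel. cmod (f x))"
proof -
  have "cmod (LINT x|lborel. exp (- (\<i> * complex_of_real (\<xi> * x))) * f x) \<le> (LINT x|lborel. cmod (f x))"
    using integral_norm_bound[of lborel "\<lambda>x. exp (- (\<i> * complex_of_real (\<xi> * x))) * f x"]
    by (simp add: norm_mult)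
  then show ?thesis
    by (simp add: fourier_def norm_mult norm_divide divide_right_mono del: of_real_mult)
qed

lemma integrable_fourier_mult:
  assumes f: "integrable lborel f" and g: "integrable lborel g"
  shows "integrable lborel (\<lambda>\<xi>. fourier f \<xi> * g \<xi>)"
proof (rule Bochner_Integration.integrable_bound[of _ "\<lambda>\<xi>. 1 / sqrt (2 * pi) * (LINT x|lborel. cmod (f x)) * cmod (g \<xi>)"])
  show "AE x in lborel. norm (fourier f x * g x) \<le> norm (1 / sqrt (2 * pi) * (LINT x|lborel. cmod (f x)) * cmod (g x))"
    using norm_fourier_le[OF f] integral_nonneg_AE[of "\<lambda>x. cmod (f x)" lborel]
    by (auto simp del: times_divide_eq_left simp: norm_mult intro!: mult_right_mono)
qed (use f g in auto)

lemma integrable_pair_mult: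
  assumes f: "integrable lborel (f :: real \<Rightarrow> complex)" and g: "integrable lborel (g :: real \<Rightarrow> complex)"
  shows "integrable (lborel \<Otimes>\<^sub>M lborel) (\<lambda>(x, y). f x * g y)"
proof (rule lborel_pair.Fubini_integrable)
  show "integrable lborel (\<lambda>x. LINT y|lborel. norm (case (x, y) of (x, y) \<Rightarrow> f x * g y))"
    using f by (simp add: norm_mult)
qed (use f g in auto)

lemma fourier_mult_formula:
  assumes f: "integrable lborel f" and g: "integrable lborel g"
  shows "(LINT \<xi>|lborel. fourier f \<xi> * g \<xi>) = (LINT x|lborel. f x * fourier g x)"
proof -
  let ?h = "\<lambda>x y. exp (- (\<i> * complex_of_real (y * x))) * (f x * g y)"
  have [measurable]: "f \<in> borel_measurable borel" "g \<in> borel_measurable borel" using f g by auto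
  have int: "integrable (lborel \<Otimes>\<^sub>M lborel) (case_prod ?h)"
    by (rule Bochner_Integration.integrable_bound[OF integrable_pair_mult[OF f g]])
      (auto simp: norm_mult)
  have "(LINT \<xi>|lborel. fourier f \<xi> * g \<xi>) = 
    complex_of_real (1 / sqrt (2 * pi)) * (LINT y|lborel. LINT x|lborel. ?h x y)"
  proof -
    have "fourier f y * g y = complex_of_real (1 / sqrt (2 * pi)) * (LINT x|lborel. ?h x y)" for y
      unfolding fourier_def
      apply (subst mult.assoc)
      apply (subst integral_mult_left_zero[symmetric])
      by (simp add: ac_simps)
    then show ?thesis by simp
  qed
  also have "\<dots> = complex_of_real (1 / sqrt (2 * pi)) * (LINT x|lborel. LINT y|lborel. ?h x y)"
    by (subst lborel_pair.Fubini_integral[OF int]) simp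
  also have "\<dots> = (LINT x|lborel. f x * fourier g x)"
  proof -
    have "f x * fourier g x = complex_of_real (1 / sqrt (2 * pi)) * (LINT y|lborel. ?h x y)" for x
      unfolding fourier_def
      apply (subst mult.left_commute)
      apply (subst integral_mult_right_zero[symmetric])
      by (simp add: ac_simps)
    then show ?thesis by simp
  qed
  finally show ?thesis .
qed

lemma integral_exp_normal_density:
  "(LINT x|lborel. exp (\<i> * complex_of_real (t * x)) * complex_of_real (std_normal_density x)) = 
    complex_of_real (exp (- t\<^sup>2 / 2))"
proof -
  have "(LINT x|lborel. exp (\<i> * complex_of_real (t * x)) * complex_of_real (std_normal_density x)) 
    = char std_normal_distribution t"
    unfolding char_def
    by (subst integral_density) (auto simp: scaleR_conv_of_real mult.commute)
  then show ?thesis by (simp add: char_std_normal_distribution)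
qed

definition gauss :: "real \<Rightarrow> real \<Rightarrow> real" where "gauss e \<xi> = exp (- (e * \<xi>)\<^sup>2 / 2)"

lemma gauss_measurable [measurable]: "gauss e \<in> borel_measurable borel"
  unfolding gauss_def by measurable

lemma gauss_density: "e > 0 \<Longrightarrow> gauss e \<xi> = sqrt (2 * pi) / e * normal_density 0 (1 / e) \<xi>"
  by (simp add: gauss_def normal_density_def real_sqrt_mult real_sqrt_divide power_mult_distrib power_divide field_simps)

lemma integrable_gauss: "e > 0 \<Longrightarrow> integrable lborel (gauss e)"
  using gauss_density[of e] by (simp cong: integrable_cong add: ext[of "gauss e" "\<lambda>\<xi>. sqrt (2 * pi) * normal_density 0 (1 / e) \<xi> / e"])

lemma fourier_gauss:
  assumes "e > 0"
  shows "fourier (\<lambda>\<xi>. complex_of_real (gauss e \<xi>)) x = complex_of_real (sqrt (2 * pi) * normal_density 0 e x)"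
proof -
  have "(LINT \<xi>|lborel. exp (- (\<i> * complex_of_real (x * \<xi>))) * complex_of_real (gauss e \<xi>)) =
    complex_of_real (1 / e) * (LINT y|lborel. exp (- (\<i> * complex_of_real (x * (y / e)))) * complex_of_real (gauss e (y / e)))"
    using assms by (subst lborel_integral_real_affine[of "1/e" _ 0]) (auto simp: scaleR_conv_of_real)
  also have "(LINT y|lborel. exp (- (\<i> * complex_of_real (x * (y / e)))) * complex_of_real (gauss e (y / e))) = 
      (LINT y|lborel. complex_of_real (sqrt (2 * pi)) * (exp (\<i> * complex_of_real (- x / e * y)) * complex_of_real (std_normal_density y)))"
    using assms by (intro Bochner_Integration.integral_cong) (auto simp: gauss_def std_normal_density_def field_simps)
  also have "\<dots> = complex_of_real (sqrt (2 * pi)) * complex_of_real (exp (- (- x / e)\<^sup>2 / 2))"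
    by (subst integral_mult_right_zero) (simp only: integral_exp_normal_density)
  finally have "fourier (\<lambda>\<xi>. complex_of_real (gauss e \<xi>)) x = complex_of_real (1 / e * exp (- (- x / e)\<^sup>2 / 2))"
    by (simp add: fourier_def)
  also have "1 / e * exp (- (- x / e)\<^sup>2 / 2) = sqrt (2 * pi) * normal_density 0 e x"
    using assms by (simp add: normal_density_def power_divide real_sqrt_mult field_simps)
  finally show ?thesis .
qed

lemma fourier_modulate:
  "fourier (\<lambda>\<xi>. exp (\<i> * complex_of_real (y * \<xi>)) * f \<xi>) x = fourier f (x - y)"
  unfolding fourier_def 
  by (simp add: left_diff_distrib exp_diff exp_minus field_simps)

lemma fourier_fourier_gauss:
  assumes e: "e > 0" and f: "integrable lborel f"
  shows "fourier (\<lambda>\<xi>. fourier f \<xi> * complex_of_real (gauss e \<xi>)) x =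
     (LINT y|lborel. f y * complex_of_real (normal_density 0 e (x + y)))"
proof -
  have ig: "integrable lborel (\<lambda>\<xi>. complex_of_real (gauss e \<xi>))"
    using integrable_gauss[OF e] by simp
  have "(LINT \<xi>|lborel. exp (- (\<i> * complex_of_real (x * \<xi>))) * (fourier f \<xi> * complex_of_real (gauss e \<xi>)))
    = (LINT \<xi>|lborel. fourier f \<xi> * (exp (\<i> * complex_of_real ((- x) * \<xi>)) * complex_of_real (gauss e \<xi>)))"
    by (simp add: ac_simps)
  also have "\<dots> = (LINT y|lborel. f y * fourier (\<lambda>\<xi>. exp (\<i> * complex_of_real ((- x) * \<xi>)) * complex_of_real (gauss e \<xi>)) y)"
    using integrable_exp_mult[OF ig, of x] by (intro fourier_mult_formula f) simp
  also have "\<dots> = (LINT y|lborel. complex_of_real (sqrt (2 * pi)) * (f y * complex_of_real (normal_density 0 e (x + y))))"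
    by (simp only: fourier_modulate fourier_gauss[OF e]) (simp add: ac_simps)
  also have "\<dots> = complex_of_real (sqrt (2 * pi)) * (LINT y|lborel. f y * complex_of_real (normal_density 0 e (x + y)))"
    by (rule integral_mult_right_zero)
  finally show ?thesis by (simp add: fourier_def)
qed

lemma fourier_inversion:
  assumes f: "integrable lborel f" and ff: "integrable lborel (fourier f)"
    and cont: "continuous_on UNIV f" and bdd: "\<And>x. cmod (f x) \<le> B"
  shows "fourier (fourier f) x = f (- x)"
proof -
  have [measurable]: "f \<in> borel_measurable borel" using f by auto
  define e where "e n = 1 / real (Suc n)" for n
  have e0: "e n > 0" for n by (simp add: e_def)
  have e_lim: "e \<longlonglongrightarrow> 0" unfolding e_def by (rule LIMSEQ_Suc[OF lim_1_over_n])
  have 1: "(\<lambda>n. fourier (\<lambda>\<xi>. fourier f \<xi> * complex_of_real (gauss (e n) \<xi>)) x) \<longlonglongrightarrow> fourier (fourier f) x"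
    unfolding fourier_def[of "\<lambda>\<xi>. fourier f \<xi> * _ \<xi>"] fourier_def[of "fourier f"]
  proof (intro tendsto_mult tendsto_const integral_dominated_convergence[where w="\<lambda>\<xi>. cmod (fourier f \<xi>)"])
    show "AE \<xi> in lborel. (\<lambda>n. exp (- (\<i> * complex_of_real (x * \<xi>))) * (fourier f \<xi> * complex_of_real (gauss (e n) \<xi>)))
         \<longlonglongrightarrow> exp (- (\<i> * complex_of_real (x * \<xi>))) * fourier f \<xi>"
    proof (rule AE_I2)
      fix \<xi>
      have "(\<lambda>n. gauss (e n) \<xi>) \<longlonglongrightarrow> gauss 0 \<xi>"
        unfolding gauss_def by (intro tendsto_intros e_lim) auto
      then have "(\<lambda>n. complex_of_real (gauss (e n) \<xi>)) \<longlonglongrightarrow> 1"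
        using tendsto_of_real[of "\<lambda>n. gauss (e n) \<xi>" 1] by (simp add: gauss_def)
      from tendsto_mult[OF tendsto_const[of "exp (- (\<i> * complex_of_real (x * \<xi>))) * fourier f \<xi>"] this]
      show "(\<lambda>n. exp (- (\<i> * complex_of_real (x * \<xi>))) * (fourier f \<xi> * complex_of_real (gauss (e n) \<xi>)))
         \<longlonglongrightarrow> exp (- (\<i> * complex_of_real (x * \<xi>))) * fourier f \<xi>" by (simp add: mult.assoc)
    qed
    show "AE \<xi> in lborel. norm (exp (- (\<i> * complex_of_real (x * \<xi>))) * (fourier f \<xi> * complex_of_real (gauss (e n) \<xi>))) \<le> cmod (fourier f \<xi>)" for n
      by (auto simp: norm_mult gauss_def intro!: mult_left_le)
  qed (use ff in auto)
  have 2: "fourier (\<lambda>\<xi>. fourier f \<xi> * complex_of_real (gauss (e n) \<xi>)) x = 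
     (LINT z|lborel. f (- x + e n * z) * complex_of_real (std_normal_density z))" for n
  proof -
    have "fourier (\<lambda>\<xi>. fourier f \<xi> * complex_of_real (gauss (e n) \<xi>)) x = 
       e n *\<^sub>R (LINT z|lborel. f (- x + e n * z) * complex_of_real (normal_density 0 (e n) (e n * z)))"
      unfolding fourier_fourier_gauss[OF e0 f]
      using e0[of n] by (subst lborel_integral_real_affine[of "e n" _ "-x"]) auto
    also have "\<dots> = (LINT z|lborel. e n *\<^sub>R (f (- x + e n * z) * complex_of_real (normal_density 0 (e n) (e n * z))))"
      by (rule integral_scaleR_right[symmetric])
    also have "\<dots> = (LINT z|lborel. f (- x + e n * z) * complex_of_real (std_normal_density z))"
    proof (rule Bochner_Integration.integral_cong[OF refl])
      fix z
      have "e n * normal_density 0 (e n) (e n * z) = std_normal_density z"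
        using e0[of n] by (simp add: normal_density_def real_sqrt_mult power_mult_distrib)
      then show "e n *\<^sub>R (f (- x + e n * z) * complex_of_real (normal_density 0 (e n) (e n * z))) = f (- x + e n * z) * complex_of_real (std_normal_density z)"
        by (metis mult.left_commute of_real_mult scaleR_conv_of_real)
    qed
    finally show ?thesis .
  qed
  have 3: "(\<lambda>n. (LINT z|lborel. f (- x + e n * z) * complex_of_real (std_normal_density z))) \<longlonglongrightarrow>
     (LINT z|lborel. f (- x) * complex_of_real (std_normal_density z))"
  proof (rule integral_dominated_convergence[where w="\<lambda>z. B * std_normal_density z"])
    show "AE z in lborel. (\<lambda>n. f (- x + e n * z) * complex_of_real (std_normal_density z)) \<longlonglongrightarrow> f (- x) * complex_of_real (std_normal_density z)"
    proof (rule AE_I2)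
      fix z
      have "(\<lambda>n. - x + e n * z) \<longlonglongrightarrow> - x + 0 * z" by (intro tendsto_intros e_lim)
      then have "(\<lambda>n. f (- x + e n * z)) \<longlonglongrightarrow> f (- x)"
        using continuous_on_tendsto_compose[OF cont] by simp
      then show "(\<lambda>n. f (- x + e n * z) * complex_of_real (std_normal_density z)) \<longlonglongrightarrow> f (- x) * complex_of_real (std_normal_density z)"
        by (intro tendsto_intros)
    qed
    show "AE z in lborel. norm (f (- x + e n * z) * complex_of_real (std_normal_density z)) \<le> B * std_normal_density z" for n
      using bdd by (auto simp: norm_mult intro!: mult_right_mono)
  qed auto
  have "(LINT z|lborel. f (- x) * complex_of_real (std_normal_density z)) = f (- x)"
    by (simp only: integral_mult_right_zero integral_complex_of_real) simp
  with 1 2 3 show ?thesis by (auto intro: LIMSEQ_unique)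
qed

section \<open>Plancherel bound and extension to square integrable functions\<close>

lemma nn_integral_fatou_real:
  fixes f :: "nat \<Rightarrow> 'a \<Rightarrow> real"
  assumes [measurable]: "\<And>n. f n \<in> borel_measurable M" "g \<in> borel_measurable M"
    and lim: "AE x in M. (\<lambda>n. f n x) \<longlonglongrightarrow> g x"
    and le: "\<And>n. n \<ge> n0 \<Longrightarrow> (\<integral>\<^sup>+x. ennreal (f n x) \<partial>M) \<le> B"
  shows "(\<integral>\<^sup>+x. ennreal (g x) \<partial>M) \<le> B"
proof -
  have "(\<integral>\<^sup>+x. ennreal (g x) \<partial>M) = (\<integral>\<^sup>+x. liminf (\<lambda>n. ennreal (f n x)) \<partial>M)"
  proof (rule nn_integral_cong_AE)
    show "AE x in M. ennreal (g x) = liminf (\<lambda>n. ennreal (f n x))"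
      using lim by eventually_elim (auto intro!: lim_imp_Liminf[symmetric] tendsto_ennrealI)
  qed
  also have "\<dots> \<le> liminf (\<lambda>n. \<integral>\<^sup>+x. ennreal (f n x) \<partial>M)"
    by (rule nn_integral_liminf) simp
  also have "\<dots> \<le> liminf (\<lambda>n. B)"
    by (rule Liminf_mono) (use le in \<open>auto simp: eventually_sequentially\<close>)
  finally show ?thesis by (simp add: Liminf_const)
qed

abbreviation N2 :: "(real \<Rightarrow> complex) \<Rightarrow> ennreal" where
  "N2 f \<equiv> (\<integral>\<^sup>+x. ennreal ((cmod (f x))\<^sup>2) \<partial>lborel)"

lemma N2_reflect:
  assumes [measurable]: "f \<in> borel_measurable borel"
  shows "N2 (\<lambda>x. f (- x)) = N2 f"
  by (subst nn_integral_real_affine[of "\<lambda>x. ennreal ((cmod (f x))\<^sup>2)" "-1" 0]) auto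

lemma nn_integral_normal_density_shift:
  assumes "e > 0"
  shows "(\<integral>\<^sup>+y. ennreal (normal_density 0 e (x + y)) \<partial>lborel) = 1"
proof -
  have "(\<integral>\<^sup>+y. ennreal (normal_density 0 e y) \<partial>lborel) = 1"
    using assms by (subst nn_integral_eq_integral) auto
  then show ?thesis
    by (subst (asm) nn_integral_real_affine[of _ 1 x]) (auto simp: normal_density_def)
qed

lemma schur_bound:
  assumes [measurable]: "g \<in> borel_measurable borel" "h \<in> borel_measurable borel" and e: "e > 0"
  shows "(\<integral>\<^sup>+x. \<integral>\<^sup>+y. ennreal (cmod (g x) * cmod (h y) * normal_density 0 e (x + y)) \<partial>lborel \<partial>lborel)
    \<le> (N2 g + N2 h) / 2"
proof -
  let ?K = "\<lambda>x y. normal_density 0 e (x + y)"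
  have [measurable]: "(\<lambda>(x, y). ?K x y) \<in> borel_measurable (lborel \<Otimes>\<^sub>M lborel)"
    by (simp add: normal_density_def[abs_def])
  let ?a = "\<lambda>x y. ennreal ((cmod (g x))\<^sup>2 / 2) * ennreal (?K x y)"
  let ?b = "\<lambda>x y. ennreal ((cmod (h y))\<^sup>2 / 2) * ennreal (?K x y)"
  have "(\<integral>\<^sup>+x. \<integral>\<^sup>+y. ennreal (cmod (g x) * cmod (h y) * ?K x y) \<partial>lborel \<partial>lborel)
    \<le> (\<integral>\<^sup>+x. \<integral>\<^sup>+y. ?a x y + ?b x y \<partial>lborel \<partial>lborel)"
  proof (intro nn_integral_mono)
    fix x y
    have "cmod (g x) * cmod (h y) \<le> (cmod (g x))\<^sup>2 / 2 + (cmod (h y))\<^sup>2 / 2"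
      using sum_squares_bound[of "cmod (g x)" "cmod (h y)"] by simp
    then have "cmod (g x) * cmod (h y) * ?K x y \<le> ((cmod (g x))\<^sup>2 / 2 + (cmod (h y))\<^sup>2 / 2) * ?K x y"
      by (intro mult_right_mono) auto
    then show "ennreal (cmod (g x) * cmod (h y) * ?K x y) \<le> ?a x y + ?b x y"
      by (simp flip: ennreal_mult ennreal_plus add: distrib_right ennreal_leI)
  qed
  also have "\<dots> = (\<integral>\<^sup>+x. \<integral>\<^sup>+y. ?a x y \<partial>lborel \<partial>lborel) + (\<integral>\<^sup>+x. \<integral>\<^sup>+y. ?b x y \<partial>lborel \<partial>lborel)"
    by (simp add: nn_integral_add)
  also have "(\<integral>\<^sup>+x. \<integral>\<^sup>+y. ?b x y \<partial>lborel \<partial>lborel) = (\<integral>\<^sup>+y. \<integral>\<^sup>+x. ?b x y \<partial>lborel \<partial>lborel)"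
    by (rule lborel_pair.Fubini') simp
  also have "\<dots> = (\<integral>\<^sup>+y. ennreal ((cmod (h y))\<^sup>2 / 2) * (\<integral>\<^sup>+x. ennreal (normal_density 0 e (y + x)) \<partial>lborel) \<partial>lborel)"
    by (simp add: nn_integral_cmult add.commute)
  also have "(\<integral>\<^sup>+x. \<integral>\<^sup>+y. ?a x y \<partial>lborel \<partial>lborel) = (\<integral>\<^sup>+x. ennreal ((cmod (g x))\<^sup>2 / 2) * (\<integral>\<^sup>+y. ennreal (?K x y) \<partial>lborel) \<partial>lborel)"
    by (simp add: nn_integral_cmult)
  finally show ?thesis
    by (simp add: nn_integral_normal_density_shift[OF e] divide_ennreal[symmetric] nn_integral_divide
       add_divide_distrib_ennreal ennreal_power)
qed

lemma N2_fourier_le: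
  assumes g: "integrable lborel g"
  shows "N2 (fourier g) \<le> N2 g"
proof -
  have [measurable]: "g \<in> borel_measurable borel" using g by auto
  define h where "h x = cnj (g (- x))" for x
  have [measurable]: "h \<in> borel_measurable borel" unfolding h_def[abs_def]
    by (intro borel_measurable_continuous_on[OF continuous_on_cnj[OF continuous_on_id]]) measurable
  have h: "integrable lborel h"
    using lborel_integrable_real_affine[OF g, of "-1" 0] by (simp add: h_def[abs_def])
  have fh: "fourier h \<xi> = cnj (fourier g \<xi>)" for \<xi>
    unfolding h_def[abs_def] using fourier_uminus[of "\<lambda>x. cnj (g x)" \<xi>] by (simp add: fourier_cnj)
  have N2h: "N2 h = N2 g"
    using N2_reflect[of g] by (simp add: h_def)
  have gauss_bound: "(\<integral>\<^sup>+\<xi>. ennreal ((cmod (fourier g \<xi>))\<^sup>2 * gauss e \<xi>) \<partial>lborel) \<le> N2 g" if e: "e > 0" for e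
  proof -
    define \<phi> where "\<phi> \<xi> = fourier h \<xi> * complex_of_real (gauss e \<xi>)" for \<xi>
    have \<phi>: "integrable lborel \<phi>"
      unfolding \<phi>_def[abs_def] by (rule integrable_fourier_mult[OF h]) (use integrable_gauss[OF e] in simp)
    have [measurable]: "\<phi> \<in> borel_measurable borel" unfolding \<phi>_def by measurable
    have eq: "fourier g \<xi> * \<phi> \<xi> = complex_of_real ((cmod (fourier g \<xi>))\<^sup>2 * gauss e \<xi>)" for \<xi>
      by (simp add: \<phi>_def fh complex_norm_square[symmetric] flip: mult.assoc)
    have int: "integrable lborel (\<lambda>\<xi>. fourier g \<xi> * \<phi> \<xi>)"
      by (rule integrable_fourier_mult[OF g \<phi>])
    have "(\<integral>\<^sup>+\<xi>. ennreal ((cmod (fourier g \<xi>))\<^sup>2 * gauss e \<xi>) \<partial>lborel) = 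
      ennreal (LINT \<xi>|lborel. (cmod (fourier g \<xi>))\<^sup>2 * gauss e \<xi>)"
      using int unfolding eq complex_of_real_integrable_eq
      by (intro nn_integral_eq_integral) (auto simp: gauss_def)
    also have "(LINT \<xi>|lborel. (cmod (fourier g \<xi>))\<^sup>2 * gauss e \<xi>) = cmod (LINT \<xi>|lborel. fourier g \<xi> * \<phi> \<xi>)"
      unfolding eq integral_complex_of_real norm_of_real
      by (rule abs_of_nonneg[symmetric]) (auto intro!: integral_nonneg_AE simp: gauss_def)
    also have "(LINT \<xi>|lborel. fourier g \<xi> * \<phi> \<xi>) = (LINT x|lborel. g x * fourier \<phi> x)"
      by (rule fourier_mult_formula[OF g \<phi>])
    also have "ennreal (cmod (LINT x|lborel. g x * fourier \<phi> x)) \<le> (\<integral>\<^sup>+x. ennreal (cmod (g x * fourier \<phi> x)) \<partial>lborel)"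
      using integrable_fourier_mult[OF \<phi> g] by (intro integral_norm_bound_ennreal) (simp add: mult.commute)
    also have "\<dots> \<le> (\<integral>\<^sup>+x. \<integral>\<^sup>+y. ennreal (cmod (g x) * cmod (h y) * normal_density 0 e (x + y)) \<partial>lborel \<partial>lborel)"
    proof (rule nn_integral_mono)
      fix x
      let ?k = "\<lambda>y. h y * complex_of_real (normal_density 0 e (x + y))"
      have "integrable lborel ?k"
      proof (rule Bochner_Integration.integrable_bound[of _ "\<lambda>y. complex_of_real (normal_density 0 e 0) * h y"])
        show "AE y in lborel. cmod (h y * complex_of_real (normal_density 0 e (x + y))) \<le> cmod (complex_of_real (normal_density 0 e 0) * h y)"
        proof (rule AE_I2)
          fix y
          have "normal_density 0 e (x + y) \<le> normal_density 0 e 0"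
            by (simp add: normal_density_def divide_right_mono)
          then show "cmod (h y * complex_of_real (normal_density 0 e (x + y))) \<le> cmod (complex_of_real (normal_density 0 e 0) * h y)"
            by (simp add: norm_mult mult.commute mult_left_mono)
        qed
      qed (use h in auto)
      then have "ennreal (cmod (fourier \<phi> x)) \<le> (\<integral>\<^sup>+y. ennreal (cmod (?k y)) \<partial>lborel)"
        unfolding \<phi>_def[abs_def] fourier_fourier_gauss[OF e h] by (rule integral_norm_bound_ennreal)
      then have "ennreal (cmod (g x)) * ennreal (cmod (fourier \<phi> x)) \<le> ennreal (cmod (g x)) * (\<integral>\<^sup>+y. ennreal (cmod (?k y)) \<partial>lborel)"
        by (rule mult_left_mono) simp
      also have "\<dots> = (\<integral>\<^sup>+y. ennreal (cmod (g x)) * ennreal (cmod (?k y)) \<partial>lborel)"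
        by (rule nn_integral_cmult[symmetric]) simp
      finally show "ennreal (cmod (g x * fourier \<phi> x)) \<le> (\<integral>\<^sup>+y. ennreal (cmod (g x) * cmod (h y) * normal_density 0 e (x + y)) \<partial>lborel)"
        by (simp add: norm_mult ennreal_mult mult.assoc)
    qed
    also have "\<dots> \<le> (N2 g + N2 h) / 2" by (rule schur_bound[OF _ _ e]) auto
    also have "\<dots> = N2 g" 
      by (simp add: N2h mult_2[symmetric] mult.commute[of 2] ennreal_times_divide[symmetric])
    finally show ?thesis .
  qed
  show ?thesis
  proof (rule nn_integral_fatou_real)
    define e where "e n = 1 / real (Suc n)" for n
    show "AE \<xi> in lborel. (\<lambda>n. (cmod (fourier g \<xi>))\<^sup>2 * gauss (e n) \<xi>) \<longlonglongrightarrow> (cmod (fourier g \<xi>))\<^sup>2"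
    proof (rule AE_I2)
      fix \<xi>
      have "e \<longlonglongrightarrow> 0" unfolding e_def by (rule LIMSEQ_Suc[OF lim_1_over_n])
      then have "(\<lambda>n. (cmod (fourier g \<xi>))\<^sup>2 * gauss (e n) \<xi>) \<longlonglongrightarrow> (cmod (fourier g \<xi>))\<^sup>2 * gauss 0 \<xi>"
        unfolding gauss_def by (intro tendsto_intros) auto
      then show "(\<lambda>n. (cmod (fourier g \<xi>))\<^sup>2 * gauss (e n) \<xi>) \<longlonglongrightarrow> (cmod (fourier g \<xi>))\<^sup>2"
        by (simp add: gauss_def)
    qed
    show "(\<integral>\<^sup>+\<xi>. ennreal ((cmod (fourier g \<xi>))\<^sup>2 * gauss (e n) \<xi>) \<partial>lborel) \<le> N2 g" for n
      by (rule gauss_bound) (simp add: e_def)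
  qed auto
qed

lemma L2_measurable [measurable_dest]: "f \<in> L2 \<Longrightarrow> f \<in> borel_measurable borel"
  by (simp add: L2_def)

lemma L2_iff: "f \<in> L2 \<longleftrightarrow> f \<in> borel_measurable borel \<and> N2 f < \<infinity>"
  unfolding L2_def by (auto simp: integrable_iff_bounded)

lemma N2_eq_L2_norm: "f \<in> L2 \<Longrightarrow> N2 f = ennreal ((L2_norm f)\<^sup>2)"
  unfolding L2_norm_def by (subst nn_integral_eq_integral) (auto simp: L2_def)

lemma L2_norm_nonneg [simp]: "L2_norm f \<ge> 0"
  by (simp add: L2_norm_def)

lemma L2_norm_mono:
  assumes "f \<in> L2" "g \<in> L2" "N2 f \<le> N2 g"
  shows "L2_norm f \<le> L2_norm g"
  using assms by (simp add: N2_eq_L2_norm)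

lemma L2_bound:
  assumes "g \<in> L2" "f \<in> borel_measurable borel" "AE x in lborel. cmod (f x) \<le> c * cmod (g x)"
  shows "f \<in> L2"
proof -
  have "integrable lborel (\<lambda>x. c\<^sup>2 * (cmod (g x))\<^sup>2)" using assms by (auto simp: L2_def)
  then have "integrable lborel (\<lambda>x. (cmod (f x))\<^sup>2)"
  proof (rule Bochner_Integration.integrable_bound)
    show "AE x in lborel. norm ((cmod (f x))\<^sup>2) \<le> norm (c\<^sup>2 * (cmod (g x))\<^sup>2)"
      using assms(3) by eventually_elim (simp flip: power_mult_distrib add: power_mono)
  qed (use assms in auto)
  then show ?thesis using assms by (auto simp: L2_def)
qed

lemma L2_diff:
  assumes "f \<in> L2" "g \<in> L2"
  shows "(\<lambda>x. f x - g x) \<in> L2"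
proof -
  have [measurable]: "f \<in> borel_measurable borel" "g \<in> borel_measurable borel" using assms by auto
  have "integrable lborel (\<lambda>x. 2 * (cmod (f x))\<^sup>2 + 2 * (cmod (g x))\<^sup>2)" using assms by (auto simp: L2_def)
  then have "integrable lborel (\<lambda>x. (cmod (f x - g x))\<^sup>2)"
  proof (rule Bochner_Integration.integrable_bound)
    show "AE x in lborel. norm ((cmod (f x - g x))\<^sup>2) \<le> norm (2 * (cmod (f x))\<^sup>2 + 2 * (cmod (g x))\<^sup>2)"
    proof (rule AE_I2)
      fix x
      have "(cmod (f x - g x))\<^sup>2 \<le> (cmod (f x) + cmod (g x))\<^sup>2"
        by (intro power_mono norm_triangle_ineq4) auto
      also have "\<dots> \<le> 2 * (cmod (f x))\<^sup>2 + 2 * (cmod (g x))\<^sup>2"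
        using sum_squares_bound[of "cmod (f x)" "cmod (g x)"] by (simp add: power2_sum)
      finally show "norm ((cmod (f x - g x))\<^sup>2) \<le> norm (2 * (cmod (f x))\<^sup>2 + 2 * (cmod (g x))\<^sup>2)" by simp
    qed
  qed auto
  then show ?thesis by (auto simp: L2_def)
qed

lemma L2_mult_integrable:
  assumes "f \<in> L2" "g \<in> L2"
  shows "integrable lborel (\<lambda>x. f x * g x)"
proof -
  have [measurable]: "f \<in> borel_measurable borel" "g \<in> borel_measurable borel" using assms by auto
  have "integrable lborel (\<lambda>x. (cmod (f x))\<^sup>2 + (cmod (g x))\<^sup>2)" using assms by (auto simp: L2_def)
  then show ?thesis
  proof (rule Bochner_Integration.integrable_bound)
    show "AE x in lborel. norm (f x * g x) \<le> norm ((cmod (f x))\<^sup>2 + (cmod (g x))\<^sup>2)"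
    proof (rule AE_I2)
      fix x
      show "norm (f x * g x) \<le> norm ((cmod (f x))\<^sup>2 + (cmod (g x))\<^sup>2)"
        using sum_squares_bound[of "cmod (f x)" "cmod (g x)"] mult_nonneg_nonneg[of "cmod (f x)" "cmod (g x)"]
        by (simp add: norm_mult del: mult_nonneg_nonneg)
    qed
  qed auto
qed

lemma L2_Cauchy_Schwarz:
  assumes "f \<in> L2" "g \<in> L2"
  shows "cmod (LINT x|lborel. f x * g x) \<le> L2_norm f * L2_norm g"
proof -
  have [measurable]: "f \<in> borel_measurable borel" "g \<in> borel_measurable borel" using assms by auto
  have "ennreal (cmod (LINT x|lborel. f x * g x)) \<le> (\<integral>\<^sup>+x. ennreal (cmod (f x)) * ennreal (cmod (g x)) \<partial>lborel)"
    using integral_norm_bound_ennreal[OF L2_mult_integrable[OF assms]] by (simp add: norm_mult ennreal_mult)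
  then have "(ennreal (cmod (LINT x|lborel. f x * g x)))\<^sup>2 \<le> (\<integral>\<^sup>+x. ennreal (cmod (f x)) * ennreal (cmod (g x)) \<partial>lborel)\<^sup>2"
    by (intro power_mono) auto
  also have "\<dots> \<le> (\<integral>\<^sup>+x. (ennreal (cmod (f x)))\<^sup>2 \<partial>lborel) * (\<integral>\<^sup>+x. (ennreal (cmod (g x)))\<^sup>2 \<partial>lborel)"
    by (rule Cauchy_Schwarz_nn_integral) auto
  also have "\<dots> = N2 f * N2 g" by (simp add: ennreal_power)
  also have "\<dots> = ennreal ((L2_norm f * L2_norm g)\<^sup>2)"
    using assms by (simp add: N2_eq_L2_norm ennreal_mult power_mult_distrib)
  finally have "(cmod (LINT x|lborel. f x * g x))\<^sup>2 \<le> (L2_norm f * L2_norm g)\<^sup>2"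
    by (simp add: ennreal_power)
  then show ?thesis by (rule power2_le_imp_le) auto
qed

lemma tendsto_integral_L2:
  assumes "\<And>n. v n \<in> L2" "w \<in> L2" "\<phi> \<in> L2" and lim: "(\<lambda>n. L2_norm (\<lambda>x. v n x - w x)) \<longlonglongrightarrow> 0"
  shows "(\<lambda>n. LINT x|lborel. v n x * \<phi> x) \<longlonglongrightarrow> (LINT x|lborel. w x * \<phi> x)"
proof (rule LIM_zero_cancel, rule Lim_null_comparison)
  show "\<forall>\<^sub>F n in sequentially. norm ((LINT x|lborel. v n x * \<phi> x) - (LINT x|lborel. w x * \<phi> x)) \<le> L2_norm (\<lambda>x. v n x - w x) * L2_norm \<phi>"
  proof (rule always_eventually, rule allI)
    fix n
    have "(LINT x|lborel. v n x * \<phi> x) - (LINT x|lborel. w x * \<phi> x) = (LINT x|lborel. (v n x - w x) * \<phi> x)"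
      using assms by (simp add: left_diff_distrib L2_mult_integrable)
    then show "norm ((LINT x|lborel. v n x * \<phi> x) - (LINT x|lborel. w x * \<phi> x)) \<le> L2_norm (\<lambda>x. v n x - w x) * L2_norm \<phi>"
      using assms by (simp add: L2_Cauchy_Schwarz L2_diff)
  qed
  show "(\<lambda>n. L2_norm (\<lambda>x. v n x - w x) * L2_norm \<phi>) \<longlonglongrightarrow> 0"
    using tendsto_mult_right[OF lim, of "L2_norm \<phi>"] by simp
qed

lemma fourier_in_L2: "integrable lborel f \<Longrightarrow> f \<in> L2 \<Longrightarrow> fourier f \<in> L2"
  unfolding L2_iff using N2_fourier_le[of f] by (auto intro: le_less_trans)

lemma fourier_diff:
  assumes "integrable lborel f" "integrable lborel g"
  shows "fourier (\<lambda>x. f x - g x) \<xi> = fourier f \<xi> - fourier g \<xi>"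
  unfolding fourier_def using assms[THEN integrable_exp_mult, of \<xi>]
  by (simp add: right_diff_distrib diff_divide_distrib del: of_real_mult)

lemma truncation_L1:
  assumes "u \<in> L2"
  shows "integrable lborel (\<lambda>x. indicator {- real n..real n} x * u x)"
proof (rule L2_mult_integrable[OF _ assms])
  show "(indicator {- real n..real n} :: real \<Rightarrow> complex) \<in> L2"
    unfolding L2_def
  proof safe
    have "(\<lambda>x. (cmod (indicator {- real n..real n} x))\<^sup>2) = (indicator {- real n..real n} :: real \<Rightarrow> real)"
      by (auto simp: indicator_def)
    then show "integrable lborel (\<lambda>x. (cmod (indicator {- real n..real n} x))\<^sup>2)"
      by (simp add: integrable_indicator_iff)
  qed auto
qed

lemma truncation_tendsto:
  assumes "u \<in> L2"
  shows "(\<lambda>n. LINT x|lborel. (cmod (u x - indicator {- real n..real n} x * u x))\<^sup>2) \<longlonglongrightarrow> 0"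
proof -
  have [measurable]: "u \<in> borel_measurable borel" using assms by auto
  have "(\<lambda>n. LINT x|lborel. (cmod (u x - indicator {- real n..real n} x * u x))\<^sup>2) \<longlonglongrightarrow> (LINT x|(lborel :: real measure). 0)"
  proof (rule integral_dominated_convergence[where w="\<lambda>x. (cmod (u x))\<^sup>2"])
    show "AE x in lborel. (\<lambda>n. (cmod (u x - indicator {- real n..real n} x * u x))\<^sup>2) \<longlonglongrightarrow> 0"
    proof (rule AE_I2, rule tendsto_eventually)
      fix x
      have "x \<in> {- real n..real n}" if "n \<ge> nat \<lceil>\<bar>x\<bar>\<rceil>" for n
        using order_trans[OF real_nat_ceiling_ge[of "\<bar>x\<bar>"], of "real n"] that by (simp add: abs_le_iff)
      then have "(cmod (u x - indicator {- real n..real n} x * u x))\<^sup>2 = 0" if "n \<ge> nat \<lceil>\<bar>x\<bar>\<rceil>" for n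
        using that by (simp add: indicator_def)
      then show "\<forall>\<^sub>F n in sequentially. (cmod (u x - indicator {- real n..real n} x * u x))\<^sup>2 = 0"
        unfolding eventually_sequentially by blast
    qed
    show "AE x in lborel. norm ((cmod (u x - indicator {- real n..real n} x * u x))\<^sup>2) \<le> (cmod (u x))\<^sup>2" for n
      by (auto simp: indicator_def)
  qed (use assms in \<open>auto simp: L2_def\<close>)
  then show ?thesis by simp
qed

text \<open>Since test functions need only be in \<open>L\<^sup>1 \<inter> L\<^sup>2\<close> here, transforms of Schwartz functions are admissible
  without knowing that they are Schwartz functions.\<close>
lemma L2_fourier_exists:
  assumes u: "u \<in> L2"
  obtains v where "v \<in> L2" "N2 v \<le> N2 u"
    "\<And>\<phi>. integrable lborel \<phi> \<Longrightarrow> \<phi> \<in> L2 \<Longrightarrow> (LINT \<xi>|lborel. v \<xi> * \<phi> \<xi>) = (LINT x|lborel. u x * fourier \<phi> x)"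
proof -
  have [measurable]: "u \<in> borel_measurable borel" using u by auto
  have "\<exists>n::nat. (LINT x|lborel. (cmod (u x - indicator {- real n..real n} x * u x))\<^sup>2) < (1/4) ^ k" for k :: nat
    using order_tendstoD(2)[OF truncation_tendsto[OF u], of "(1/4)^k"] by (auto simp: eventually_sequentially)
  then obtain N :: "nat \<Rightarrow> nat" where N: "\<And>k. (LINT x|lborel. (cmod (u x - indicator {- real (N k)..real (N k)} x * u x))\<^sup>2) < (1/4) ^ k"
    by metis
  define U where "U k x = indicator {- real (N k)..real (N k)} x * u x" for k x
  have U1: "integrable lborel (U k)" for k unfolding U_def[abs_def] by (rule truncation_L1[OF u])
  have Ule: "cmod (U k x) \<le> cmod (u x)" for k x by (auto simp: U_def indicator_def)
  have [measurable]: "U k \<in> borel_measurable borel" for k using U1[of k] by auto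
  have U2: "U k \<in> L2" for k by (rule L2_bound[OF u, of _ 1]) (use Ule in auto)
  have dU: "N2 (\<lambda>x. u x - U k x) \<le> ennreal ((1/4) ^ k)" for k
    using N[of k] L2_diff[OF u U2[of k]] unfolding U_def[symmetric] 
    by (subst nn_integral_eq_integral) (auto simp: L2_def intro!: ennreal_leI)
  have dUU: "N2 (\<lambda>x. U n x - U m x) \<le> ennreal (4 * (1/4) ^ m)" if "n \<ge> m" for n m
  proof -
    have "N2 (\<lambda>x. U n x - U m x) \<le> (\<integral>\<^sup>+x. ennreal 2 * ennreal ((cmod (u x - U n x))\<^sup>2) + ennreal 2 * ennreal ((cmod (u x - U m x))\<^sup>2) \<partial>lborel)"
    proof (rule nn_integral_mono)
      fix x
      have "cmod (U n x - U m x) \<le> cmod (u x - U n x) + cmod (u x - U m x)"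
        by (metis (no_types) add.commute add_diff_cancel_left' diff_diff_eq2 norm_minus_commute norm_triangle_ineq4 diff_add_cancel)
      then have "(cmod (U n x - U m x))\<^sup>2 \<le> (cmod (u x - U n x) + cmod (u x - U m x))\<^sup>2"
        by (intro power_mono) auto
      also have "\<dots> \<le> 2 * (cmod (u x - U n x))\<^sup>2 + 2 * (cmod (u x - U m x))\<^sup>2"
        using sum_squares_bound[of "cmod (u x - U n x)" "cmod (u x - U m x)"] by (simp add: power2_sum)
      finally show "ennreal ((cmod (U n x - U m x))\<^sup>2) \<le> ennreal 2 * ennreal ((cmod (u x - U n x))\<^sup>2) + ennreal 2 * ennreal ((cmod (u x - U m x))\<^sup>2)"
        by (subst (1 2) ennreal_mult[symmetric]) (simp_all flip: ennreal_plus add: ennreal_leI)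
    qed
    also have "\<dots> = ennreal 2 * N2 (\<lambda>x. u x - U n x) + ennreal 2 * N2 (\<lambda>x. u x - U m x)"
      by (simp add: nn_integral_add nn_integral_cmult)
    also have "\<dots> \<le> ennreal 2 * ennreal ((1/4)^n) + ennreal 2 * ennreal ((1/4)^m)"
      by (intro add_mono mult_left_mono dU) auto
    also have "\<dots> \<le> ennreal (4 * (1/4) ^ m)"
      using power_decreasing[OF that, of "1/4::real"]
      by (subst (1 2) ennreal_mult[symmetric]) (auto simp flip: ennreal_plus intro!: ennreal_leI)
    finally show ?thesis .
  qed
  define V where "V k = fourier (U k)" for k
  have [measurable]: "V k \<in> borel_measurable borel" for k unfolding V_def by measurable
  have V2: "V k \<in> L2" for k unfolding V_def by (rule fourier_in_L2[OF U1 U2])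
  have dV: "N2 (\<lambda>x. V n x - V m x) \<le> ennreal (4 * (1/4) ^ m)" if "n \<ge> m" for n m
  proof -
    have "V n x - V m x = fourier (\<lambda>x. U n x - U m x) x" for x
      unfolding V_def by (rule fourier_diff[symmetric]) (auto intro: U1)
    then have "N2 (\<lambda>x. V n x - V m x) \<le> N2 (\<lambda>x. U n x - U m x)"
      using N2_fourier_le[of "\<lambda>x. U n x - U m x"] U1 by simp
    then show ?thesis using dUU[OF that] by (rule order_trans)
  qed
  have "(\<integral>\<^sup>+x. (\<Sum>k. ennreal (2 ^ k * (cmod (V (Suc k) x - V k x))\<^sup>2)) \<partial>lborel) = 
    (\<Sum>k. ennreal (2 ^ k) * N2 (\<lambda>x. V (Suc k) x - V k x))"
    by (subst nn_integral_suminf) (auto simp: ennreal_mult nn_integral_cmult)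
  also have "\<dots> \<le> (\<Sum>k. ennreal (4 * (1/2)^k))"
  proof (rule suminf_le)
    fix k
    have "ennreal (2 ^ k) * N2 (\<lambda>x. V (Suc k) x - V k x) \<le> ennreal (2 ^ k) * ennreal (4 * (1/4) ^ k)"
      by (intro mult_left_mono dV) auto
    also have "\<dots> = ennreal (4 * (1/2)^k)"
      by (subst ennreal_mult[symmetric]) (simp_all add: power_divide power_mult_distrib[symmetric] field_simps flip: power_mult_distrib)
    finally show "ennreal (2 ^ k) * N2 (\<lambda>x. V (Suc k) x - V k x) \<le> ennreal (4 * (1/2)^k)" .
  qed auto
  also have "\<dots> < \<infinity>"
    by (subst suminf_ennreal2) (auto intro!: summable_mult summable_geometric)
  finally have fin: "(\<integral>\<^sup>+x. (\<Sum>k. ennreal (2 ^ k * (cmod (V (Suc k) x - V k x))\<^sup>2)) \<partial>lborel) \<noteq> \<infinity>" by simp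
  have "AE x in lborel. (\<Sum>k. ennreal (2 ^ k * (cmod (V (Suc k) x - V k x))\<^sup>2)) \<noteq> \<infinity>"
    by (rule nn_integral_PInf_AE[OF _ fin]) measurable
  then have conv: "AE x in lborel. convergent (\<lambda>k. V k x)"
  proof eventually_elim
    fix x
    assume *: "(\<Sum>k. ennreal (2 ^ k * (cmod (V (Suc k) x - V k x))\<^sup>2)) \<noteq> \<infinity>"
    have "summable (\<lambda>k. 2 ^ k * (cmod (V (Suc k) x - V k x))\<^sup>2)"
      by (rule summable_suminf_not_top) (use * in auto)
    then have "summable (\<lambda>k. (1/2)^k + 2 ^ k * (cmod (V (Suc k) x - V k x))\<^sup>2)"
      by (intro summable_add summable_geometric) auto
    then have "summable (\<lambda>k. V (Suc k) x - V k x)"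
    proof (rule summable_comparison_test')
      fix k :: nat
      let ?d = "cmod (V (Suc k) x - V k x)"
      have "(1/2)^k * (1 - 2^k * ?d)\<^sup>2 \<ge> 0" by simp
      also have "(1/2)^k * (1 - 2^k * ?d)\<^sup>2 = (1/2)^k + 2^k * ?d\<^sup>2 - 2 * ?d"
        by (simp add: power2_eq_square field_simps power_divide)
      finally show "norm (V (Suc k) x - V k x) \<le> (1/2)^k + 2 ^ k * ?d\<^sup>2" by (smt (verit) norm_ge_zero)
    qed
    then have "convergent (\<lambda>n. \<Sum>k<n. V (Suc k) x - V k x)" 
      by (simp add: summable_iff_convergent)
    then have "convergent (\<lambda>n. V n x - V 0 x)"
      using sum_lessThan_telescope[of "\<lambda>k. V k x"] by simp
    then show "convergent (\<lambda>k. V k x)"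
      using convergent_add[OF _ convergent_const[of "V 0 x"], of "\<lambda>n. V n x - V 0 x"] by simp
  qed
  define v where "v x = lim (\<lambda>k. V k x)" for x
  have [measurable]: "v \<in> borel_measurable borel" unfolding v_def by measurable
  have lim: "AE x in lborel. (\<lambda>k. V k x) \<longlonglongrightarrow> v x"
    using conv by eventually_elim (simp add: v_def convergent_LIMSEQ_iff)
  have Nv: "N2 v \<le> N2 u"
  proof (rule nn_integral_fatou_real)
    show "AE x in lborel. (\<lambda>k. (cmod (V k x))\<^sup>2) \<longlonglongrightarrow> (cmod (v x))\<^sup>2"
      using lim by eventually_elim (intro tendsto_intros)
    show "N2 (V k) \<le> N2 u" for k
      unfolding V_def using N2_fourier_le[OF U1, of k] Ule
      by (elim order_trans) (auto intro!: nn_integral_mono ennreal_leI power_mono)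
  qed auto
  have v2: "v \<in> L2" using Nv u unfolding L2_iff by (auto intro: le_less_trans)
  have dvV: "N2 (\<lambda>x. V m x - v x) \<le> ennreal (4 * (1/4) ^ m)" for m
  proof (rule nn_integral_fatou_real)
    show "AE x in lborel. (\<lambda>n. (cmod (V n x - V m x))\<^sup>2) \<longlonglongrightarrow> (cmod (V m x - v x))\<^sup>2"
      using lim 
    proof eventually_elim
      fix x assume "(\<lambda>k. V k x) \<longlonglongrightarrow> v x"
      then have "(\<lambda>n. (cmod (V n x - V m x))\<^sup>2) \<longlonglongrightarrow> (cmod (v x - V m x))\<^sup>2" by (intro tendsto_intros)
      then show "(\<lambda>n. (cmod (V n x - V m x))\<^sup>2) \<longlonglongrightarrow> (cmod (V m x - v x))\<^sup>2" by (simp add: norm_minus_commute)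
    qed
    show "n \<ge> m \<Longrightarrow> N2 (\<lambda>x. V n x - V m x) \<le> ennreal (4 * (1/4) ^ m)" for n by (rule dV)
  qed auto
  have norm_lim: "(\<lambda>k. L2_norm (\<lambda>x. W k x - w x)) \<longlonglongrightarrow> 0"
    if "\<And>k. W k \<in> L2" "w \<in> L2" "\<And>k. N2 (\<lambda>x. W k x - w x) \<le> ennreal (4 * (1/4)^k)" for W w
  proof (rule Lim_null_comparison)
    show "\<forall>\<^sub>F k in sequentially. norm (L2_norm (\<lambda>x. W k x - w x)) \<le> 2 * (1/2)^k"
    proof (rule always_eventually, rule allI)
      fix k
      have "(L2_norm (\<lambda>x. W k x - w x))\<^sup>2 \<le> (2 * (1/2)^k)\<^sup>2"
        using that(3)[of k] N2_eq_L2_norm[OF L2_diff[OF that(1)[of k] that(2)]]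
        by (simp add: power_mult_distrib power2_eq_square flip: power_mult_distrib)
      from power2_le_imp_le[OF this] show "norm (L2_norm (\<lambda>x. W k x - w x)) \<le> 2 * (1/2)^k"
        by simp
    qed
    show "(\<lambda>k. 2 * (1 / 2) ^ k) \<longlonglongrightarrow> (0::real)"
      using tendsto_mult_right_zero[OF LIMSEQ_power_zero[of "1/2::real"], of 2] by simp
  qed
  show ?thesis
  proof (rule that[OF v2 Nv])
    fix \<phi> assume \<phi>: "integrable lborel \<phi>" "\<phi> \<in> L2"
    have "(\<lambda>k. LINT x|lborel. V k x * \<phi> x) \<longlonglongrightarrow> (LINT x|lborel. v x * \<phi> x)"
      by (intro tendsto_integral_L2 norm_lim V2 v2 \<phi> dvV)
    moreover have "(\<lambda>k. LINT x|lborel. U k x * fourier \<phi> x) \<longlonglongrightarrow> (LINT x|lborel. u x * fourier \<phi> x)"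
    proof (intro tendsto_integral_L2 norm_lim U2 u fourier_in_L2 \<phi>)
      fix k 
      have "N2 (\<lambda>x. U k x - u x) \<le> ennreal ((1/4) ^ k)"
        using dU[of k] by (simp add: norm_minus_commute)
      also have "\<dots> \<le> ennreal (4 * (1/4) ^ k)" by (intro ennreal_leI) simp
      finally show "N2 (\<lambda>x. U k x - u x) \<le> ennreal (4 * (1/4) ^ k)" .
    qed
    moreover have "(LINT x|lborel. V k x * \<phi> x) = (LINT x|lborel. U k x * fourier \<phi> x)" for k
      unfolding V_def by (rule fourier_mult_formula[OF U1 \<phi>(1)])
    ultimately show "(LINT \<xi>|lborel. v \<xi> * \<phi> \<xi>) = (LINT x|lborel. u x * fourier \<phi> x)"
      by (simp add: LIMSEQ_unique)
  qed
qed

section \<open>Schwartz functions\<close>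

lemma vderiv_0 [simp]: "vderiv 0 \<phi> = \<phi>"
  by (simp add: vderiv_def)

lemma vderiv_add: "vderiv n (vderiv m \<phi>) = vderiv (n + m) \<phi>"
  by (simp add: vderiv_def funpow_add)

lemma vderiv_Suc: "vderiv (Suc n) \<phi> = (\<lambda>x. vector_derivative (vderiv n \<phi>) (at x))"
  by (simp add: vderiv_def)

lemma schwartz_has_vector_derivative:
  "\<phi> \<in> schwartz \<Longrightarrow> (vderiv n \<phi> has_vector_derivative vderiv (Suc n) \<phi> x) (at x)"
  unfolding vderiv_Suc by (subst vector_derivative_works[symmetric]) (auto simp: schwartz_def)

lemma schwartz_vderiv: "\<phi> \<in> schwartz \<Longrightarrow> vderiv m \<phi> \<in> schwartz"
  by (auto simp: schwartz_def vderiv_add)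

lemma schwartz_continuous: 
  assumes "\<phi> \<in> schwartz"
  shows "continuous_on UNIV \<phi>"
proof (rule continuous_at_imp_continuous_on, rule ballI)
  fix x
  show "isCont \<phi> x"
    using has_vector_derivative_continuous[OF schwartz_has_vector_derivative[OF assms, of 0 x]] by simp
qed

lemma schwartz_measurable: "\<phi> \<in> schwartz \<Longrightarrow> \<phi> \<in> borel_measurable borel"
  by (rule borel_measurable_continuous_onI[OF schwartz_continuous])

lemma schwartz_decay:
  assumes "\<phi> \<in> schwartz"
  shows "\<exists>B. \<forall>x. cmod (\<phi> x) * (1 + x\<^sup>2) \<le> B"
proof -
  have "bounded (range (\<lambda>x. x ^ j *\<^sub>R \<phi> x))" for j
  proof -
    have "bounded (range (\<lambda>x. x ^ j *\<^sub>R vderiv 0 \<phi> x))"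
      using assms unfolding schwartz_def by blast
    then show ?thesis by simp
  qed
  then have "\<exists>b. \<forall>x. norm (x ^ j *\<^sub>R \<phi> x) \<le> b" for j
    unfolding bounded_iff by blast
  then obtain b where b: "\<And>j x. norm (x ^ j *\<^sub>R \<phi> x) \<le> b j"
    by metis
  have "cmod (\<phi> x) * (1 + x\<^sup>2) \<le> b 0 + b 2" for x
    using b[of x 0] b[of x 2] by (simp add: algebra_simps)
  then show ?thesis by blast
qed

lemma integrable_inverse_square: "integrable lborel (\<lambda>x::real. 1 / (1 + x\<^sup>2))"
  using integrable_inverse_1_plus_square
  by (simp add: set_integrable_def inverse_eq_divide einterval_def)

lemma decay_integrable:
  assumes [measurable]: "f \<in> borel_measurable borel" and B: "\<And>x. cmod (f x) * (1 + x\<^sup>2) \<le> B"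
  shows "integrable lborel f" "f \<in> L2" "cmod (f x) \<le> B"
proof -
  have B': "cmod (f x) \<le> B * (1 / (1 + x\<^sup>2))" for x
    using B[of x] by (simp add: pos_le_divide_eq add_pos_nonneg)
  show bdd: "cmod (f x) \<le> B" for x
    using B[of x] mult_left_mono[of 1 "1 + x\<^sup>2" "cmod (f x)"] by simp
  show int: "integrable lborel f"
  proof (rule Bochner_Integration.integrable_bound)
    show "integrable lborel (\<lambda>x. B * (1 / (1 + x\<^sup>2)))"
      by (intro integrable_mult_right integrable_inverse_square)
    show "AE x in lborel. norm (f x) \<le> norm (B * (1 / (1 + x\<^sup>2)))"
      using order_trans[OF B' abs_ge_self] by (simp only: real_norm_def) simp
  qed auto
  have "integrable lborel (\<lambda>x. (cmod (f x))\<^sup>2)"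
  proof (rule Bochner_Integration.integrable_bound)
    show "integrable lborel (\<lambda>x. B * cmod (f x))"
      using int by (intro integrable_mult_right integrable_norm)
    show "AE x in lborel. norm ((cmod (f x))\<^sup>2) \<le> norm (B * cmod (f x))"
      using bdd order_trans[OF norm_ge_zero bdd] by (auto simp: power2_eq_square abs_mult intro!: mult_right_mono)
  qed auto
  then show "f \<in> L2" by (simp add: L2_def)
qed

lemma
  assumes \<phi>: "\<phi> \<in> schwartz"
  shows schwartz_integrable: "integrable lborel \<phi>" and schwartz_L2: "\<phi> \<in> L2"
proof -
  obtain B where B: "\<And>x. cmod (\<phi> x) * (1 + x\<^sup>2) \<le> B" using schwartz_decay[OF \<phi>] by blast
  show "integrable lborel \<phi>" "\<phi> \<in> L2"
    by (rule decay_integrable[OF schwartz_measurable[OF \<phi>] B])+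
qed

lemma integral_derivative_eq_0:
  fixes F :: "real \<Rightarrow> complex"
  assumes F: "\<And>x. (F has_vector_derivative f x) (at x)" and cont: "continuous_on UNIV f"
    and f: "integrable lborel f"
    and lim: "(F \<longlongrightarrow> 0) at_top" "(F \<longlongrightarrow> 0) at_bot"
  shows "(LINT x|lborel. f x) = 0"
proof -
  have "(\<lambda>n. LINT x|lborel. indicator {- real n..real n} x *\<^sub>R f x) \<longlonglongrightarrow> (LINT x|lborel. f x)"
  proof (rule integral_dominated_convergence[where w="\<lambda>x. cmod (f x)"])
    show "AE x in lborel. (\<lambda>n. indicator {- real n..real n} x *\<^sub>R f x) \<longlonglongrightarrow> f x"
    proof (rule AE_I2, rule tendsto_eventually)
      fix x
      have "x \<in> {- real n..real n}" if "n \<ge> nat \<lceil>\<bar>x\<bar>\<rceil>" for n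
        using order_trans[OF real_nat_ceiling_ge[of "\<bar>x\<bar>"], of "real n"] that by (simp add: abs_le_iff)
      then have "indicator {- real n..real n} x *\<^sub>R f x = f x" if "n \<ge> nat \<lceil>\<bar>x\<bar>\<rceil>" for n
        using that by (simp add: indicator_def)
      then show "\<forall>\<^sub>F n in sequentially. indicator {- real n..real n} x *\<^sub>R f x = f x"
        unfolding eventually_sequentially by blast
    qed
    show "AE x in lborel. norm (indicator {- real n..real n} x *\<^sub>R f x) \<le> cmod (f x)" for n
      by (auto simp: indicator_def)
  qed (use f in auto)
  moreover have "(LINT x|lborel. indicator {- real n..real n} x *\<^sub>R f x) = F (real n) - F (- real n)" for n
    by (rule integral_FTC_Icc) (use F cont in \<open>auto intro: has_vector_derivative_at_within continuous_on_subset\<close>)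
  moreover have "(\<lambda>n. F (real n) - F (- real n)) \<longlonglongrightarrow> 0 - 0"
    by (intro tendsto_diff filterlim_compose[OF lim(1)] filterlim_compose[OF lim(2)] filterlim_real_sequentially
        filterlim_uminus_at_bot_at_top filterlim_compose[OF filterlim_uminus_at_bot_at_top])
  ultimately show ?thesis by (simp add: LIMSEQ_unique)
qed

lemma schwartz_tendsto_0:
  assumes "\<phi> \<in> schwartz"
  shows "(\<phi> \<longlongrightarrow> 0) at_top" "(\<phi> \<longlongrightarrow> 0) at_bot"
proof -
  obtain B where B: "\<And>x. cmod (\<phi> x) * (1 + x\<^sup>2) \<le> B" using schwartz_decay[OF assms] by blast
  have B': "norm (\<phi> x) \<le> B / (1 + x\<^sup>2)" for x
    using B[of x] by (simp add: pos_le_divide_eq add_pos_nonneg)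
  have "((\<lambda>x::real. B / (1 + x\<^sup>2)) \<longlongrightarrow> 0) at_top" "((\<lambda>x::real. B / (1 + x\<^sup>2)) \<longlongrightarrow> 0) at_bot"
    by real_asymp+
  from this[THEN Lim_null_comparison[OF always_eventually, rotated]]
  show "(\<phi> \<longlongrightarrow> 0) at_top" "(\<phi> \<longlongrightarrow> 0) at_bot"
    using B' by blast+
qed

lemma fourier_vderiv_1:
  assumes \<phi>: "\<phi> \<in> schwartz"
  shows "fourier (vderiv 1 \<phi>) \<xi> = \<i> * complex_of_real \<xi> * fourier \<phi> \<xi>"
proof -
  let ?e = "\<lambda>x. exp (- (\<i> * complex_of_real (\<xi> * x)))"
  let ?f = "\<lambda>x. ?e x * vderiv 1 \<phi> x - \<i> * complex_of_real \<xi> * (?e x * \<phi> x)"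
  note \<phi>' = schwartz_vderiv[OF \<phi>, of 1]
  have "(LINT x|lborel. ?f x) = 0"
  proof (rule integral_derivative_eq_0)
    fix x
    have "(vderiv 0 \<phi> has_vector_derivative vderiv 1 \<phi> x) (at x)"
      using schwartz_has_vector_derivative[OF \<phi>, of 0 x] by simp
    moreover have "((\<lambda>x. exp (- (\<i> * complex_of_real (\<xi> * x)))) has_vector_derivative (- (\<i> * complex_of_real \<xi>) * ?e x)) (at x)"
      by (rule has_vector_derivative_real_field[where f="\<lambda>z. exp (- (\<i> * (complex_of_real \<xi> * z)))", simplified of_real_mult[symmetric]])
         (auto intro!: derivative_eq_intros)
    ultimately show "((\<lambda>x. ?e x * \<phi> x) has_vector_derivative ?f x) (at x)"
      using has_vector_derivative_mult[of ?e "- (\<i> * complex_of_real \<xi>) * ?e x" x UNIV "vderiv 0 \<phi>" "vderiv 1 \<phi> x"]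
      by (simp add: mult.assoc del: of_real_mult)
  next
    show "continuous_on UNIV ?f"
      by (intro continuous_intros schwartz_continuous \<phi> \<phi>')
    show "integrable lborel ?f"
      by (intro Bochner_Integration.integrable_diff integrable_mult_right integrable_exp_mult schwartz_integrable \<phi> \<phi>')
    have "cmod (?e x * \<phi> x) \<le> cmod (\<phi> x)" for x by (simp add: norm_mult del: of_real_mult)
    then show "((\<lambda>x. ?e x * \<phi> x) \<longlongrightarrow> 0) at_top" "((\<lambda>x. ?e x * \<phi> x) \<longlongrightarrow> 0) at_bot"
      using schwartz_tendsto_0[OF \<phi>] by (auto intro!: Lim_null_comparison[where g="\<lambda>x. cmod (\<phi> x)"] tendsto_norm_zero)
  qed
  moreover have "(LINT x|lborel. ?f x) = (LINT x|lborel. ?e x * vderiv 1 \<phi> x) - (LINT x|lborel. \<i> * complex_of_real \<xi> * (?e x * \<phi> x))"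
    by (intro Bochner_Integration.integral_diff integrable_mult_right integrable_exp_mult schwartz_integrable \<phi> \<phi>')
  ultimately have "(LINT x|lborel. ?e x * vderiv 1 \<phi> x) = \<i> * complex_of_real \<xi> * (LINT x|lborel. ?e x * \<phi> x)"
    by (simp only: integral_mult_right_zero) simp
  then show ?thesis by (simp add: fourier_def)
qed

lemma fourier_vderiv:
  assumes \<phi>: "\<phi> \<in> schwartz"
  shows "fourier (vderiv n \<phi>) \<xi> = (\<i> * complex_of_real \<xi>) ^ n * fourier \<phi> \<xi>"
proof (induction n)
  case (Suc n)
  have "fourier (vderiv (Suc n) \<phi>) \<xi> = fourier (vderiv 1 (vderiv n \<phi>)) \<xi>"
    by (simp add: vderiv_add)
  also have "\<dots> = \<i> * complex_of_real \<xi> * fourier (vderiv n \<phi>) \<xi>"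
    by (rule fourier_vderiv_1[OF schwartz_vderiv[OF \<phi>]])
  finally show ?case using Suc by simp
qed simp

lemma inv_fourier_vderiv:
  assumes \<phi>: "\<phi> \<in> schwartz"
  shows "inv_fourier (vderiv n \<phi>) x = (- \<i> * complex_of_real x) ^ n * inv_fourier \<phi> x"
  by (simp add: inv_fourier_eq fourier_vderiv[OF \<phi>])

lemma fourier_schwartz_decay:
  assumes \<phi>: "\<phi> \<in> schwartz"
  shows "\<exists>B. \<forall>\<xi>. cmod (fourier \<phi> \<xi>) * (1 + \<xi>\<^sup>2) \<le> B"
proof (intro exI allI)
  fix \<xi>
  let ?B = "\<lambda>f. 1 / sqrt (2 * pi) * (LINT x|lborel. cmod (f x))"
  have "cmod (fourier \<phi> \<xi>) \<le> ?B \<phi>" 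
    by (intro norm_fourier_le schwartz_integrable \<phi>)
  moreover have "cmod (fourier (vderiv 2 \<phi>) \<xi>) \<le> ?B (vderiv 2 \<phi>)" 
    by (intro norm_fourier_le schwartz_integrable schwartz_vderiv \<phi>)
  moreover have "cmod (fourier (vderiv 2 \<phi>) \<xi>) = \<xi>\<^sup>2 * cmod (fourier \<phi> \<xi>)"
    by (simp add: fourier_vderiv[OF \<phi>] norm_mult norm_power)
  ultimately show "cmod (fourier \<phi> \<xi>) * (1 + \<xi>\<^sup>2) \<le> ?B \<phi> + ?B (vderiv 2 \<phi>)"
    by (simp add: algebra_simps)
qed

lemma fourier_schwartz:
  assumes \<phi>: "\<phi> \<in> schwartz"
  shows "integrable lborel (fourier \<phi>)" "fourier \<phi> \<in> L2"
proof -
  obtain B where B: "\<And>\<xi>. cmod (fourier \<phi> \<xi>) * (1 + \<xi>\<^sup>2) \<le> B" using fourier_schwartz_decay[OF \<phi>] by blast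
  have "fourier \<phi> \<in> borel_measurable borel" using schwartz_measurable[OF \<phi>] by measurable
  from decay_integrable[OF this B] show "integrable lborel (fourier \<phi>)" "fourier \<phi> \<in> L2" by auto
qed

lemma inv_fourier_schwartz:
  assumes \<phi>: "\<phi> \<in> schwartz"
  shows "integrable lborel (inv_fourier \<phi>)" "inv_fourier \<phi> \<in> L2"
proof -
  obtain B where B: "\<And>\<xi>. cmod (fourier \<phi> \<xi>) * (1 + \<xi>\<^sup>2) \<le> B" using fourier_schwartz_decay[OF \<phi>] by blast
  have [measurable]: "fourier \<phi> \<in> borel_measurable borel" using schwartz_measurable[OF \<phi>] by measurable
  have "inv_fourier \<phi> \<in> borel_measurable borel" unfolding inv_fourier_eq[abs_def] by measurable
  moreover have "cmod (inv_fourier \<phi> x) * (1 + x\<^sup>2) \<le> B" for x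
    using B[of "- x"] by (simp add: inv_fourier_eq)
  ultimately show "integrable lborel (inv_fourier \<phi>)" "inv_fourier \<phi> \<in> L2" 
    using decay_integrable by blast+
qed

lemma schwartz_inversion:
  assumes \<phi>: "\<phi> \<in> schwartz"
  shows "inv_fourier (fourier \<phi>) = \<phi>" "fourier (inv_fourier \<phi>) = \<phi>"
proof -
  obtain B where B: "\<And>x. cmod (\<phi> x) * (1 + x\<^sup>2) \<le> B" using schwartz_decay[OF \<phi>] by blast
  have *: "fourier (fourier \<phi>) x = \<phi> (- x)" for x
    by (rule fourier_inversion[OF schwartz_integrable[OF \<phi>] fourier_schwartz(1)[OF \<phi>] schwartz_continuous[OF \<phi>]])
      (rule decay_integrable(3)[OF schwartz_measurable[OF \<phi>] B])
  show "inv_fourier (fourier \<phi>) = \<phi>" "fourier (inv_fourier \<phi>) = \<phi>"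
    by (auto simp: fun_eq_iff inv_fourier_eq[abs_def] fourier_uminus *)
qed

lemma power_div_fact_le_exp:
  assumes "(x::real) \<ge> 0"
  shows "x ^ k / fact k \<le> exp x"
proof -
  have "(\<Sum>n\<in>{k}. x ^ n /\<^sub>R fact n) \<le> (\<Sum>n. x ^ n /\<^sub>R fact n)"
    by (rule sum_le_suminf) (use assms summable_exp_generic[of x] in auto)
  then show ?thesis by (simp add: exp_def divide_inverse mult.commute)
qed

lemma power_gauss_le: "\<bar>x\<bar> ^ k * exp (- x\<^sup>2 / 2) \<le> 1 + 2 ^ k * fact k" for x :: real
proof -
  have "(x\<^sup>2 / 2) ^ k / fact k \<le> exp (x\<^sup>2 / 2)" by (rule power_div_fact_le_exp) simp
  then have "x ^ (2 * k) \<le> 2 ^ k * fact k * exp (x\<^sup>2 / 2)" 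
    by (simp only: power_mult power_divide) (simp add: pos_divide_le_eq ac_simps power_even_eq)
  moreover have "\<bar>x\<bar> ^ k \<le> 1 + x ^ (2 * k)"
  proof (cases "\<bar>x\<bar> \<le> 1")
    case True
    then show ?thesis using power_le_one[of "\<bar>x\<bar>" k] by (simp add: power_mult add_increasing2)
  next
    case False
    then have "\<bar>x\<bar> ^ k \<le> \<bar>x\<bar> ^ (2 * k)" by (intro power_increasing) auto
    then show ?thesis by (simp add: power_mult)
  qed
  ultimately have "\<bar>x\<bar> ^ k \<le> 1 + 2 ^ k * fact k * exp (x\<^sup>2 / 2)" by linarith
  also have "\<dots> \<le> (1 + 2 ^ k * fact k) * exp (x\<^sup>2 / 2)" by (simp add: algebra_simps)
  finally show ?thesis by (simp add: exp_minus field_simps)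
qed

lemma bounded_poly_gauss:
  fixes p :: "complex poly"
  shows "bounded (range (\<lambda>x::real. poly p (complex_of_real x) * complex_of_real (exp (- x\<^sup>2 / 2))))"
proof (rule boundedI)
  fix z assume "z \<in> range (\<lambda>x::real. poly p (complex_of_real x) * complex_of_real (exp (- x\<^sup>2 / 2)))"
  then obtain x :: real where z: "z = poly p (complex_of_real x) * complex_of_real (exp (- x\<^sup>2 / 2))" by auto
  have "cmod z = cmod (poly p (complex_of_real x)) * exp (- x\<^sup>2 / 2)"
    by (simp add: z norm_mult)
  also have "\<dots> \<le> (\<Sum>i\<le>degree p. cmod (coeff p i) * \<bar>x\<bar> ^ i) * exp (- x\<^sup>2 / 2)"
    unfolding poly_altdef
    by (intro mult_right_mono order_trans[OF norm_sum]) (auto simp: norm_mult norm_power)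
  also have "\<dots> = (\<Sum>i\<le>degree p. cmod (coeff p i) * (\<bar>x\<bar> ^ i * exp (- x\<^sup>2 / 2)))"
    by (simp add: sum_distrib_right mult.assoc)
  also have "\<dots> \<le> (\<Sum>i\<le>degree p. cmod (coeff p i) * (1 + 2 ^ i * fact i))"
    by (intro sum_mono mult_left_mono power_gauss_le) auto
  finally show "norm z \<le> (\<Sum>i\<le>degree p. cmod (coeff p i) * (1 + 2 ^ i * fact i))" .
qed

definition mgauss :: "real \<Rightarrow> real \<Rightarrow> complex" where
  "mgauss \<xi> x = exp (- (\<i> * complex_of_real (\<xi> * x))) * complex_of_real (exp (- x\<^sup>2 / 2))"

lemma mgauss_has_vector_derivative:
  "((\<lambda>x. poly p (complex_of_real x) * mgauss \<xi> x) has_vector_derivative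
    poly (pderiv p + [:- (\<i> * complex_of_real \<xi>), -1:] * p) (complex_of_real x) * mgauss \<xi> x) (at x)"
proof -
  have mg: "mgauss \<xi> x = exp (- (\<i> * complex_of_real \<xi> * complex_of_real x) - (complex_of_real x)\<^sup>2 / 2)" for x
    unfolding mgauss_def exp_of_real[symmetric] mult_exp_exp by (simp add: algebra_simps)
  have "((\<lambda>z. poly p z * exp (- (\<i> * complex_of_real \<xi> * z) - z\<^sup>2 / 2)) has_field_derivative
    poly (pderiv p + [:- (\<i> * complex_of_real \<xi>), -1:] * p) z * exp (- (\<i> * complex_of_real \<xi> * z) - z\<^sup>2 / 2)) (at z)" for z
    by (rule derivative_eq_intros poly_DERIV refl | simp)+ (simp add: algebra_simps)
  from has_vector_derivative_real_field[OF this, of x UNIV] show ?thesis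
    by (simp only: mg)
qed

lemma mgauss_schwartz: "mgauss \<xi> \<in> schwartz"
proof -
  have "\<exists>p. vderiv n (mgauss \<xi>) = (\<lambda>x. poly p (complex_of_real x) * mgauss \<xi> x)" for n
  proof (induction n)
    case 0
    show ?case by (rule exI[of _ "[:1:]"]) simp
  next
    case (Suc n)
    then obtain p where p: "vderiv n (mgauss \<xi>) = (\<lambda>x. poly p (complex_of_real x) * mgauss \<xi> x)" ..
    show ?case unfolding vderiv_Suc p
      using vector_derivative_at[OF mgauss_has_vector_derivative[of p \<xi>]] by blast
  qed
  then obtain P where P: "\<And>n. vderiv n (mgauss \<xi>) = (\<lambda>x. poly (P n) (complex_of_real x) * mgauss \<xi> x)"
    by metis
  show ?thesis unfolding schwartz_def
  proof (intro CollectI allI conjI)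
    fix n :: nat and x :: real
    show "vderiv n (mgauss \<xi>) differentiable at x"
      unfolding P using mgauss_has_vector_derivative differentiableI_vector by blast
    fix j :: nat
    have "norm (x ^ j *\<^sub>R vderiv n (mgauss \<xi>) x) = 
      norm (poly (monom 1 j * P n) (complex_of_real x) * complex_of_real (exp (- x\<^sup>2 / 2)))" for x
      by (simp add: P mgauss_def norm_mult norm_power power_abs poly_monom del: of_real_mult)
    then show "bounded (range (\<lambda>x. x ^ j *\<^sub>R vderiv n (mgauss \<xi>) x))"
      using bounded_poly_gauss[of "monom 1 j * P n"] unfolding bounded_iff by simp
  qed
qed

lemma real_distribution_density:
  assumes h: "integrable lborel h" "\<And>x. h x \<ge> 0" and c: "(LINT x|lborel. h x) = c" "c > 0"
  shows "real_distribution (density lborel (\<lambda>x. ennreal (h x / c)))"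
    "char (density lborel (\<lambda>x. ennreal (h x / c))) t = (LINT x|lborel. exp (\<i> * complex_of_real (t * x)) * complex_of_real (h x)) / complex_of_real c"
proof -
  have [measurable]: "h \<in> borel_measurable borel" using h by auto
  have "(\<integral>\<^sup>+x. ennreal (h x / c) \<partial>lborel) = 1"
    using h c by (subst nn_integral_eq_integral) auto
  then show "real_distribution (density lborel (\<lambda>x. ennreal (h x / c)))"
    by (auto simp: real_distribution_def real_distribution_axioms_def emeasure_density intro!: prob_spaceI)
  show "char (density lborel (\<lambda>x. ennreal (h x / c))) t = (LINT x|lborel. exp (\<i> * complex_of_real (t * x)) * complex_of_real (h x)) / complex_of_real c"
    unfolding char_def using h c
    by (subst integral_density) (auto simp: scaleR_conv_of_real mult.commute simp flip: integral_divide_zero)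
qed

lemma fourier_real_eq_0_imp_AE:
  fixes h :: "real \<Rightarrow> real"
  assumes h: "integrable lborel h" and ft: "\<And>\<xi>. fourier (\<lambda>x. complex_of_real (h x)) \<xi> = 0"
  shows "AE x in lborel. h x = 0"
proof -
  let ?E = "\<lambda>t x. exp (\<i> * complex_of_real (t * x))"
  define p where "p x = max 0 (h x)" for x
  define q where "q x = max 0 (- h x)" for x
  have hpq: "h x = p x - q x" for x by (simp add: p_def q_def)
  have p: "integrable lborel p" "\<And>x. p x \<ge> 0" and q: "integrable lborel q" "\<And>x. q x \<ge> 0"
    unfolding p_def[abs_def] q_def[abs_def] using h by (auto intro!: integrable_max)
  have int: "integrable lborel (\<lambda>x. ?E t x * complex_of_real (f x))" if "integrable lborel f" for f t
    using integrable_exp_mult[of "\<lambda>x. complex_of_real (f x)" "- t"] that by simp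
  have eq: "(LINT x|lborel. ?E t x * complex_of_real (p x)) = (LINT x|lborel. ?E t x * complex_of_real (q x))" for t
  proof -
    have "(LINT x|lborel. ?E t x * complex_of_real (h x)) = 0"
      using ft[of "- t"] by (simp add: fourier_def)
    then show ?thesis
      unfolding hpq of_real_diff right_diff_distrib using int[OF p(1), of t] int[OF q(1), of t]
      by (subst (asm) Bochner_Integration.integral_diff) auto
  qed
  define c where "c = (LINT x|lborel. p x)"
  have c': "(LINT x|lborel. q x) = c"
    using eq[of 0] by (simp add: c_def)
  have "c \<ge> 0" unfolding c_def using p by (intro integral_nonneg_AE) auto
  show ?thesis
  proof (cases "c = 0")
    case True
    have "AE x in lborel. p x = 0" "AE x in lborel. q x = 0"
      using integral_nonneg_eq_0_iff_AE[of lborel p] integral_nonneg_eq_0_iff_AE[of lborel q] p q c' True 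
      by (auto simp: c_def)
    then show ?thesis by eventually_elim (simp add: hpq)
  next
    case False
    with \<open>c \<ge> 0\<close> have c: "c > 0" by simp
    have [measurable]: "p \<in> borel_measurable borel" "q \<in> borel_measurable borel" using p q by auto
    have "density lborel (\<lambda>x. ennreal (p x / c)) = density lborel (\<lambda>x. ennreal (q x / c))"
    proof (rule Levy_uniqueness)
      show "char (density lborel (\<lambda>x. ennreal (p x / c))) = char (density lborel (\<lambda>x. ennreal (q x / c)))"
        by (rule ext, subst (1 2) real_distribution_density(2)) (use p q c c_def c' eq in auto)
    qed (auto intro!: real_distribution_density p q c c' simp: c_def[symmetric])
    then have "AE x in lborel. ennreal (p x / c) = ennreal (q x / c)"
      by (subst (asm) sigma_finite_measure.density_unique_iff[OF sigma_finite_lborel]) auto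
    then show ?thesis
      using c p(2) q(2) by (auto elim!: eventually_mono simp: hpq)
  qed
qed

lemma fourier_eq_0_imp_AE:
  assumes w: "integrable lborel w" and ft: "\<And>\<xi>. fourier w \<xi> = 0"
  shows "AE x in lborel. w x = 0"
proof -
  have ft': "fourier (\<lambda>x. cnj (w x)) \<xi> = 0" for \<xi> by (simp add: fourier_cnj ft)
  have cw: "integrable lborel (\<lambda>x. cnj (w x))" using w by simp
  note i = integrable_exp_mult[OF w] integrable_exp_mult[OF cw]
  have lin: "fourier (\<lambda>x. a * w x + b * cnj (w x)) \<xi> = 0" for a b \<xi>
  proof -
    have "(LINT x|lborel. exp (- (\<i> * complex_of_real (\<xi> * x))) * (a * w x + b * cnj (w x))) = 
      (LINT x|lborel. a * (exp (- (\<i> * complex_of_real (\<xi> * x))) * w x) + b * (exp (- (\<i> * complex_of_real (\<xi> * x))) * cnj (w x)))"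
      by (intro Bochner_Integration.integral_cong) (auto simp: algebra_simps)
    also have "\<dots> = a * (LINT x|lborel. (exp (- (\<i> * complex_of_real (\<xi> * x))) * w x)) + b * (LINT x|lborel. (exp (- (\<i> * complex_of_real (\<xi> * x))) * cnj (w x)))"
      by (subst Bochner_Integration.integral_add) (auto simp only: integral_mult_right_zero intro!: integrable_mult_right i)
    finally show ?thesis using ft[of \<xi>] ft'[of \<xi>] by (simp add: fourier_def del: of_real_mult)
  qed
  have "AE x in lborel. Re (w x) = 0"
  proof (rule fourier_real_eq_0_imp_AE)
    have "complex_of_real (Re (w x)) = 1/2 * w x + 1/2 * cnj (w x)" for x
      by (auto simp: complex_eq_iff)
    then show "fourier (\<lambda>x. complex_of_real (Re (w x))) \<xi> = 0" for \<xi> by (simp only: lin)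
  qed (use w in auto)
  moreover have "AE x in lborel. Im (w x) = 0"
  proof (rule fourier_real_eq_0_imp_AE)
    have "complex_of_real (Im (w x)) = (- \<i> / 2) * w x + (\<i> / 2) * cnj (w x)" for x
      by (auto simp: complex_eq_iff)
    then show "fourier (\<lambda>x. complex_of_real (Im (w x))) \<xi> = 0" for \<xi> by (simp only: lin)
  qed (use w in auto)
  ultimately show ?thesis by eventually_elim (simp add: complex_eq_iff)
qed

lemma schwartz_dual_unique:
  assumes v: "v \<in> L2" and zero: "\<And>\<phi>. \<phi> \<in> schwartz \<Longrightarrow> (LINT x|lborel. v x * \<phi> x) = 0"
  shows "AE x in lborel. v x = 0"
proof -
  have "AE x in lborel. v x * mgauss 0 x = 0"
  proof (rule fourier_eq_0_imp_AE)
    show "integrable lborel (\<lambda>x. v x * mgauss 0 x)"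
      by (rule L2_mult_integrable[OF v schwartz_L2[OF mgauss_schwartz]])
    have "exp (- (\<i> * complex_of_real (\<xi> * x))) * (v x * mgauss 0 x) = v x * mgauss \<xi> x" for \<xi> x
      by (simp add: mgauss_def)
    then show "fourier (\<lambda>x. v x * mgauss 0 x) \<xi> = 0" for \<xi>
      unfolding fourier_def using zero[OF mgauss_schwartz] by (simp only:) simp
  qed
  then show ?thesis by eventually_elim (auto simp: mgauss_def)
qed

lemma schwartz_dual_eq:
  assumes v: "v \<in> L2" "w \<in> L2" 
    and eq: "\<And>\<phi>. \<phi> \<in> schwartz \<Longrightarrow> (LINT x|lborel. v x * \<phi> x) = (LINT x|lborel. w x * \<phi> x)"
  shows "AE x in lborel. v x = w x"
proof -
  have "AE x in lborel. v x - w x = 0"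
  proof (rule schwartz_dual_unique[OF L2_diff[OF v]])
    fix \<phi> assume \<phi>: "\<phi> \<in> schwartz"
    show "(LINT x|lborel. (v x - w x) * \<phi> x) = 0"
      using eq[OF \<phi>] by (simp add: left_diff_distrib L2_mult_integrable v schwartz_L2[OF \<phi>])
  qed
  then show ?thesis by eventually_elim simp
qed

section \<open>Transforms of weak derivatives and Sobolev norms\<close>

lemma integral_reflect: "(LINT x|lborel. f (- x)) = (LINT x|lborel. f x)" for f :: "real \<Rightarrow> complex"
  using lborel_integral_real_affine[of "-1" f 0] by simp

lemma integrable_reflect: "integrable lborel f \<Longrightarrow> integrable lborel (\<lambda>x. f (- x))" for f :: "real \<Rightarrow> complex"
  using lborel_integrable_real_affine[of f "-1" 0] by simp

lemma L2_reflect: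
  assumes "f \<in> L2"
  shows "(\<lambda>x. f (- x)) \<in> L2"
proof -
  have [measurable]: "f \<in> borel_measurable borel" using assms by auto
  have "(\<lambda>x. f (- x)) \<in> borel_measurable borel" by measurable
  then show ?thesis using assms N2_reflect[of f] by (simp add: L2_iff)
qed

lemma L2_inv_fourier_exists:
  assumes v: "v \<in> L2"
  obtains u where "u \<in> L2" "N2 u \<le> N2 v"
    "\<And>\<phi>. integrable lborel \<phi> \<Longrightarrow> \<phi> \<in> L2 \<Longrightarrow> (LINT x|lborel. u x * \<phi> x) = (LINT \<xi>|lborel. v \<xi> * inv_fourier \<phi> \<xi>)"
proof -
  obtain w where w: "w \<in> L2" "N2 w \<le> N2 v"
    "\<And>\<phi>. integrable lborel \<phi> \<Longrightarrow> \<phi> \<in> L2 \<Longrightarrow> (LINT \<xi>|lborel. w \<xi> * \<phi> \<xi>) = (LINT x|lborel. v x * fourier \<phi> x)"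
    using L2_fourier_exists[OF v] by blast
  show ?thesis
  proof
    show "(\<lambda>x. w (- x)) \<in> L2" by (rule L2_reflect[OF w(1)])
    show "N2 (\<lambda>x. w (- x)) \<le> N2 v" using w by (subst N2_reflect) auto
    fix \<phi> assume "integrable lborel \<phi>" "\<phi> \<in> L2"
    then have "(LINT x|lborel. w x * \<phi> (- x)) = (LINT x|lborel. v x * fourier (\<lambda>x. \<phi> (- x)) x)"
      by (intro w(3) integrable_reflect L2_reflect)
    also have "(LINT x|lborel. w x * \<phi> (- x)) = (LINT x|lborel. w (- x) * \<phi> x)"
      using integral_reflect[of "\<lambda>x. w x * \<phi> (- x)"] by simp
    finally show "(LINT x|lborel. w (- x) * \<phi> x) = (LINT \<xi>|lborel. v \<xi> * inv_fourier \<phi> \<xi>)"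
      by (simp add: inv_fourier_eq fourier_uminus)
  qed
qed

lemma integral_cong_AE_L2:
  assumes "v \<in> L2" "w \<in> L2" "\<phi> \<in> borel_measurable borel" "AE x in lborel. v x = w x"
  shows "(LINT x|lborel. v x * \<phi> x) = (LINT x|lborel. w x * \<phi> x)"
  using assms by (intro integral_cong_AE) (auto elim!: eventually_mono)

lemma is_fourier_L2_D: "is_fourier_L2 u v \<Longrightarrow> u \<in> L2" "is_fourier_L2 u v \<Longrightarrow> v \<in> L2"
  by (simp_all only: is_fourier_L2_def)

lemma is_fourier_L2_unique:
  assumes "is_fourier_L2 u v" "is_fourier_L2 u v'"
  shows "AE \<xi> in lborel. v \<xi> = v' \<xi>"
proof (rule schwartz_dual_eq)
  fix \<phi> assume "\<phi> \<in> schwartz"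
  then show "(LINT x|lborel. v x * \<phi> x) = (LINT x|lborel. v' x * \<phi> x)"
    using assms unfolding is_fourier_L2_def by metis
qed (use assms in \<open>auto dest: is_fourier_L2_D\<close>)

lemma is_fourier_L2_cong:
  assumes uv: "is_fourier_L2 u v" and "u' \<in> L2" "v' \<in> L2" "AE x in lborel. u x = u' x" "AE x in lborel. v x = v' x"
  shows "is_fourier_L2 u' v'"
  unfolding is_fourier_L2_def
proof (intro conjI ballI assms)
  fix \<phi> assume \<phi>: "\<phi> \<in> schwartz"
  have "(LINT \<xi>|lborel. v \<xi> * \<phi> \<xi>) = (LINT \<xi>|lborel. v' \<xi> * \<phi> \<xi>)"
    using assms schwartz_measurable[OF \<phi>] by (intro integral_cong_AE_L2) (auto dest: is_fourier_L2_D)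
  moreover have "(LINT \<xi>|lborel. u \<xi> * fourier \<phi> \<xi>) = (LINT \<xi>|lborel. u' \<xi> * fourier \<phi> \<xi>)"
    using assms schwartz_measurable[OF \<phi>] by (intro integral_cong_AE_L2) (auto dest: is_fourier_L2_D)
  ultimately show "(LINT \<xi>|lborel. v' \<xi> * \<phi> \<xi>) = (LINT x|lborel. u' x * fourier \<phi> x)"
    using uv \<phi> by (simp add: is_fourier_L2_def)
qed

lemma is_fourier_L2_exists:
  assumes u: "u \<in> L2"
  obtains v where "is_fourier_L2 u v" "N2 v \<le> N2 u"
    "\<And>\<phi>. integrable lborel \<phi> \<Longrightarrow> \<phi> \<in> L2 \<Longrightarrow> (LINT \<xi>|lborel. v \<xi> * \<phi> \<xi>) = (LINT x|lborel. u x * fourier \<phi> x)"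
proof -
  obtain v where v: "v \<in> L2" "N2 v \<le> N2 u"
    "\<And>\<phi>. integrable lborel \<phi> \<Longrightarrow> \<phi> \<in> L2 \<Longrightarrow> (LINT \<xi>|lborel. v \<xi> * \<phi> \<xi>) = (LINT x|lborel. u x * fourier \<phi> x)"
    using L2_fourier_exists[OF u] by blast
  then have "is_fourier_L2 u v"
    using u by (auto simp: is_fourier_L2_def schwartz_integrable schwartz_L2)
  with v that show ?thesis by blast
qed

lemma fourier_L2: "u \<in> L2 \<Longrightarrow> is_fourier_L2 u (fourier_L2 u)"
  unfolding fourier_L2_def
  by (rule is_fourier_L2_exists, assumption) (rule someI[where P="is_fourier_L2 u"])

lemma is_fourier_L2_dual:
  assumes uv: "is_fourier_L2 u v" and \<phi>: "integrable lborel \<phi>" "\<phi> \<in> L2"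
  shows "(LINT \<xi>|lborel. v \<xi> * \<phi> \<xi>) = (LINT x|lborel. u x * fourier \<phi> x)"
proof -
  have u: "u \<in> L2" and v: "v \<in> L2" using uv by (auto dest: is_fourier_L2_D)
  obtain v' where v': "is_fourier_L2 u v'"
    "\<And>\<phi>. integrable lborel \<phi> \<Longrightarrow> \<phi> \<in> L2 \<Longrightarrow> (LINT \<xi>|lborel. v' \<xi> * \<phi> \<xi>) = (LINT x|lborel. u x * fourier \<phi> x)"
    using is_fourier_L2_exists[OF u] by blast
  have "v' \<in> L2" using v' by (auto dest: is_fourier_L2_D)
  then have "(LINT \<xi>|lborel. v \<xi> * \<phi> \<xi>) = (LINT \<xi>|lborel. v' \<xi> * \<phi> \<xi>)"
    using \<phi> by (intro integral_cong_AE_L2 is_fourier_L2_unique[OF uv v'(1)] v) auto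
  then show ?thesis using v'(2)[OF \<phi>] by simp
qed

lemma N2_cong_AE: "AE x in lborel. f x = g x \<Longrightarrow> N2 f = N2 g"
  by (intro nn_integral_cong_AE) (auto elim!: eventually_mono)

lemma L2_norm_cong_N2: "N2 f = N2 g \<Longrightarrow> f \<in> L2 \<Longrightarrow> g \<in> L2 \<Longrightarrow> L2_norm f = L2_norm g"
  by (intro antisym L2_norm_mono) auto

lemma is_fourier_L2_norm:
  assumes uv: "is_fourier_L2 u v"
  shows "L2_norm u = L2_norm v"
proof -
  have u: "u \<in> L2" and v: "v \<in> L2" using uv by (auto dest: is_fourier_L2_D)
  obtain v' where v': "is_fourier_L2 u v'" "N2 v' \<le> N2 u"
    using is_fourier_L2_exists[OF u] by blast
  have le: "N2 v \<le> N2 u"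
    using N2_cong_AE[OF is_fourier_L2_unique[OF uv v'(1)]] v'(2) by simp
  obtain w where w: "w \<in> L2" "N2 w \<le> N2 v" 
    "\<And>\<phi>. integrable lborel \<phi> \<Longrightarrow> \<phi> \<in> L2 \<Longrightarrow> (LINT x|lborel. w x * \<phi> x) = (LINT \<xi>|lborel. v \<xi> * inv_fourier \<phi> \<xi>)"
    using L2_inv_fourier_exists[OF v] by blast
  have "AE x in lborel. u x = w x"
  proof (rule schwartz_dual_eq[OF u w(1)])
    fix \<phi> assume \<phi>: "\<phi> \<in> schwartz"
    have "(LINT x|lborel. v x * inv_fourier \<phi> x) = (LINT x|lborel. u x * fourier (inv_fourier \<phi>) x)"
      by (rule is_fourier_L2_dual[OF uv inv_fourier_schwartz[OF \<phi>]])
    then show "(LINT x|lborel. u x * \<phi> x) = (LINT x|lborel. w x * \<phi> x)"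
      using \<phi> by (simp add: schwartz_inversion w(3) schwartz_integrable schwartz_L2)
  qed
  from N2_cong_AE[OF this] have "N2 u \<le> N2 v" using w(2) by simp
  with le show ?thesis by (intro L2_norm_cong_N2 u v) auto
qed

lemma is_fourier_L2_inverse:
  assumes v: "v \<in> L2"
  obtains u where "is_fourier_L2 u v"
proof -
  obtain u where u: "u \<in> L2"
    "\<And>\<phi>. integrable lborel \<phi> \<Longrightarrow> \<phi> \<in> L2 \<Longrightarrow> (LINT x|lborel. u x * \<phi> x) = (LINT \<xi>|lborel. v \<xi> * inv_fourier \<phi> \<xi>)"
    using L2_inv_fourier_exists[OF v] by blast
  have "is_fourier_L2 u v"
    unfolding is_fourier_L2_def
  proof (intro conjI ballI u v)
    fix \<phi> assume \<phi>: "\<phi> \<in> schwartz"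
    show "(LINT \<xi>|lborel. v \<xi> * \<phi> \<xi>) = (LINT x|lborel. u x * fourier \<phi> x)"
      by (simp add: u(2) fourier_schwartz[OF \<phi>] schwartz_inversion[OF \<phi>])
  qed
  then show ?thesis by (rule that)
qed

lemma is_fourier_L2_fourier:
  assumes "integrable lborel f" "f \<in> L2"
  shows "is_fourier_L2 f (fourier f)"
  using assms by (auto simp: is_fourier_L2_def fourier_in_L2 intro!: fourier_mult_formula schwartz_integrable)

lemma is_fourier_L2_inv_fourier:
  assumes g: "integrable lborel g" "g \<in> L2"
  shows "is_fourier_L2 (inv_fourier g) g"
  unfolding is_fourier_L2_def
proof (intro conjI ballI g)
  show "inv_fourier g \<in> L2"
    unfolding inv_fourier_eq[abs_def] by (intro L2_reflect fourier_in_L2 g)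
  fix \<phi> assume \<phi>: "\<phi> \<in> schwartz"
  have "(LINT \<xi>|lborel. g \<xi> * \<phi> \<xi>) = (LINT \<xi>|lborel. g \<xi> * fourier (\<lambda>x. fourier \<phi> (- x)) \<xi>)"
    using schwartz_inversion(1)[OF \<phi>] by (simp add: fun_eq_iff inv_fourier_eq fourier_uminus)
  also have "\<dots> = (LINT x|lborel. fourier g x * fourier \<phi> (- x))"
    by (intro fourier_mult_formula[symmetric] g integrable_reflect fourier_schwartz \<phi>)
  also have "\<dots> = (LINT x|lborel. inv_fourier g x * fourier \<phi> x)"
    using integral_reflect[of "\<lambda>x. fourier g x * fourier \<phi> (- x)"] by (simp add: inv_fourier_eq)
  finally show "(LINT \<xi>|lborel. g \<xi> * \<phi> \<xi>) = (LINT x|lborel. inv_fourier g x * fourier \<phi> x)" .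
qed

lemma is_weak_derivI_fourier:
  assumes u: "is_fourier_L2 u g" and v: "is_fourier_L2 v (\<lambda>\<xi>. (\<i> * complex_of_real \<xi>) ^ n * g \<xi>)"
  shows "is_weak_deriv n u v"
  unfolding is_weak_deriv_def
proof (intro conjI ballI)
  show "u \<in> L2" "v \<in> L2" using u v by (auto dest: is_fourier_L2_D)
  fix \<phi> assume \<phi>: "\<phi> \<in> schwartz"
  note \<phi>' = schwartz_vderiv[OF \<phi>, of n]
  have "(LINT x|lborel. v x * \<phi> x) = (LINT x|lborel. v x * fourier (inv_fourier \<phi>) x)"
    by (simp add: schwartz_inversion[OF \<phi>])
  also have "\<dots> = (LINT \<xi>|lborel. (\<i> * complex_of_real \<xi>) ^ n * g \<xi> * inv_fourier \<phi> \<xi>)"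
    by (rule is_fourier_L2_dual[OF v inv_fourier_schwartz[OF \<phi>], symmetric])
  also have "\<dots> = (LINT \<xi>|lborel. (- 1) ^ n * (g \<xi> * inv_fourier (vderiv n \<phi>) \<xi>))"
  proof (rule Bochner_Integration.integral_cong[OF refl])
    fix \<xi>
    have "(- 1) ^ n * (- \<i> * complex_of_real \<xi>) ^ n = (\<i> * complex_of_real \<xi>) ^ n"
      by (simp flip: power_mult_distrib)
    from this[symmetric] show "(\<i> * complex_of_real \<xi>) ^ n * g \<xi> * inv_fourier \<phi> \<xi> = (- 1) ^ n * (g \<xi> * inv_fourier (vderiv n \<phi>) \<xi>)"
      unfolding inv_fourier_vderiv[OF \<phi>] by (simp only: ac_simps)
  qed
  also have "\<dots> = (- 1) ^ n * (LINT \<xi>|lborel. g \<xi> * inv_fourier (vderiv n \<phi>) \<xi>)"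
    by (rule integral_mult_right_zero)
  also have "(LINT \<xi>|lborel. g \<xi> * inv_fourier (vderiv n \<phi>) \<xi>) = (LINT x|lborel. u x * vderiv n \<phi> x)"
    using is_fourier_L2_dual[OF u inv_fourier_schwartz[OF \<phi>']] by (simp add: schwartz_inversion[OF \<phi>'])
  finally show "(LINT x|lborel. v x * \<phi> x) = (- 1) ^ n * (LINT x|lborel. u x * vderiv n \<phi> x)" .
qed

lemma is_weak_deriv_unique:
  assumes "is_weak_deriv n u v" "is_weak_deriv n u v'"
  shows "AE x in lborel. v x = v' x"
proof (rule schwartz_dual_eq)
  fix \<phi> assume "\<phi> \<in> schwartz"
  then show "(LINT x|lborel. v x * \<phi> x) = (LINT x|lborel. v' x * \<phi> x)"
    using assms unfolding is_weak_deriv_def by metis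
qed (use assms in \<open>simp_all only: is_weak_deriv_def\<close>)

lemma is_fourier_L2_weak_deriv:
  assumes u: "is_fourier_L2 u g" and g: "(\<lambda>\<xi>. (\<i> * complex_of_real \<xi>) ^ n * g \<xi>) \<in> L2"
  shows "is_fourier_L2 (weak_deriv n u) (\<lambda>\<xi>. (\<i> * complex_of_real \<xi>) ^ n * g \<xi>)"
proof -
  obtain v where v: "is_fourier_L2 v (\<lambda>\<xi>. (\<i> * complex_of_real \<xi>) ^ n * g \<xi>)"
    using is_fourier_L2_inverse[OF g] .
  have wd: "is_weak_deriv n u v" by (rule is_weak_derivI_fourier[OF u v])
  then have wd': "is_weak_deriv n u (weak_deriv n u)"
    unfolding weak_deriv_def by (rule someI[where P="is_weak_deriv n u"])
  then have wdL: "weak_deriv n u \<in> L2" by (simp only: is_weak_deriv_def)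
  show ?thesis
    by (rule is_fourier_L2_cong[OF v wdL g is_weak_deriv_unique[OF wd wd']]) simp
qed

lemma L2_cong_AE:
  assumes "f \<in> L2" "g \<in> borel_measurable borel" "AE x in lborel. f x = g x"
  shows "g \<in> L2"
  by (rule L2_bound[OF assms(1,2), of 1], rule eventually_mono[OF assms(3)]) simp

lemma AE_fourier_L2:
  assumes "is_fourier_L2 u g"
  shows "AE \<xi> in lborel. fourier_L2 u \<xi> = g \<xi>"
  using is_fourier_L2_unique[OF fourier_L2[OF is_fourier_L2_D(1)[OF assms]] assms] .

lemma sobolev_iff:
  assumes u: "is_fourier_L2 u g"
  shows "u \<in> sobolev s \<longleftrightarrow> (\<lambda>\<xi>. complex_of_real ((1 + \<xi>\<^sup>2) powr (s / 2)) * g \<xi>) \<in> L2"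
proof -
  have uL: "u \<in> L2" "g \<in> L2" "fourier_L2 u \<in> L2" 
    using is_fourier_L2_D[OF u] is_fourier_L2_D(2)[OF fourier_L2[OF is_fourier_L2_D(1)[OF u]]] by auto
  then have [measurable]: "g \<in> borel_measurable borel" "fourier_L2 u \<in> borel_measurable borel" by auto
  have eq: "AE \<xi> in lborel. complex_of_real ((1 + \<xi>\<^sup>2) powr (s / 2)) * fourier_L2 u \<xi> = complex_of_real ((1 + \<xi>\<^sup>2) powr (s / 2)) * g \<xi>"
    by (rule eventually_mono[OF AE_fourier_L2[OF u]]) simp
  have eq': "AE \<xi> in lborel. complex_of_real ((1 + \<xi>\<^sup>2) powr (s / 2)) * g \<xi> = complex_of_real ((1 + \<xi>\<^sup>2) powr (s / 2)) * fourier_L2 u \<xi>"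
    using eq by (rule eventually_mono) (erule sym)
  show ?thesis
  proof
    assume "u \<in> sobolev s"
    then show "(\<lambda>\<xi>. complex_of_real ((1 + \<xi>\<^sup>2) powr (s / 2)) * g \<xi>) \<in> L2"
      unfolding sobolev_def by (intro L2_cong_AE[OF _ _ eq]) auto
  next
    assume "(\<lambda>\<xi>. complex_of_real ((1 + \<xi>\<^sup>2) powr (s / 2)) * g \<xi>) \<in> L2"
    then have "(\<lambda>\<xi>. complex_of_real ((1 + \<xi>\<^sup>2) powr (s / 2)) * fourier_L2 u \<xi>) \<in> L2"
      by (rule L2_cong_AE[OF _ _ eq']) measurable
    then show "u \<in> sobolev s" using uL by (simp add: sobolev_def)
  qed
qed

lemma sobolev_norm_eq:
  assumes u: "is_fourier_L2 u g"
  shows "sobolev_norm s u = L2_norm (\<lambda>\<xi>. complex_of_real ((1 + \<xi>\<^sup>2) powr (s / 2)) * g \<xi>)"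
proof -
  have "fourier_L2 u \<in> L2" "g \<in> L2"
    using is_fourier_L2_D[OF u] is_fourier_L2_D(2)[OF fourier_L2[OF is_fourier_L2_D(1)[OF u]]] by auto
  then have [measurable]: "g \<in> borel_measurable borel" "fourier_L2 u \<in> borel_measurable borel" by auto
  show ?thesis
    unfolding sobolev_norm_def L2_norm_def
    by (rule arg_cong[where f=sqrt], rule integral_cong_AE, measurable, rule eventually_mono[OF AE_fourier_L2[OF u]]) simp
qed

section \<open>Lyapunov estimate for the symbol\<close>

definition weighted_sq :: "real \<Rightarrow> complex^3 \<Rightarrow> real" where
  "weighted_sq \<xi> w = (1 + \<xi>\<^sup>2) * (cmod (w $ 1))\<^sup>2 + (cmod (w $ 2))\<^sup>2 + (cmod (w $ 3))\<^sup>2"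

lemma weighted_product_bound:
  fixes x y p :: real
  assumes "p > 0" 
  shows "x * y \<le> p * x\<^sup>2 / 4 + y\<^sup>2 / p"
proof -
  have "0 \<le> (p * x / 2 - y)\<^sup>2 / p" using assms by simp
  also have "\<dots> = p * x\<^sup>2 / 4 + y\<^sup>2 / p - x * y"
    using assms by (simp add: power2_eq_square field_simps)
  finally show ?thesis by simp
qed

lemma abs_det_le: "\<bar>a * d - b * c\<bar> \<le> ((a\<^sup>2 + b\<^sup>2) + (c\<^sup>2 + d\<^sup>2)) / 2" for a b c d :: real
proof -
  have "0 \<le> (a - d)\<^sup>2 + (b + c)\<^sup>2" "0 \<le> (a + d)\<^sup>2 + (b - c)\<^sup>2" by simp_all
  then have "2 * (a * d - b * c) \<le> (a\<^sup>2 + b\<^sup>2) + (c\<^sup>2 + d\<^sup>2)" "2 * - (a * d - b * c) \<le> (a\<^sup>2 + b\<^sup>2) + (c\<^sup>2 + d\<^sup>2)"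
    by (simp_all add: power2_eq_square algebra_simps)
  then show ?thesis unfolding abs_le_iff by simp
qed

lemma gronwall_decay:
  fixes L :: "real \<Rightarrow> real"
  assumes d: "\<And>t. (L has_real_derivative L' t) (at t)" and le: "\<And>t. L' t \<le> - c * L t" and t: "t \<ge> 0"
  shows "L t \<le> exp (- c * t) * L 0"
proof -
  have "L t * exp (c * t) \<le> L 0 * exp (c * 0)"
  proof (rule DERIV_nonpos_imp_nonincreasing[OF t], intro exI conjI)
    fix x
    show "((\<lambda>t. L t * exp (c * t)) has_real_derivative (L' x + c * L x) * exp (c * x)) (at x)"
      by (auto intro!: derivative_eq_intros d simp: algebra_simps)
    show "(L' x + c * L x) * exp (c * x) \<le> 0"
      using le[of x] by (intro mult_nonpos_nonneg) auto
  qed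
  then show ?thesis by (simp add: exp_minus field_simps)
qed

lemma dissipative_decay:
  fixes \<rho> u k m n h g q0 :: real
  assumes pos: "\<rho> > 0" "k > 0" "m > 0" "n > 0" "h > 0" "g > 0" "q0 > 0"
  obtains K c where "K > 0" "c > 0"
    "\<And>\<xi> w t. (\<And>t. ((\<lambda>t. w t $ 1) has_vector_derivative
          - (\<i> * of_real (\<xi> * u) * w t $ 1 + \<i> * of_real (\<xi> * \<rho>) * w t $ 2)) (at t)) \<Longrightarrow>
      (\<And>t. ((\<lambda>t. w t $ 2) has_vector_derivative
          - (\<i> * of_real (\<xi> * (q0 + k * \<xi>\<^sup>2)) * w t $ 1 + (\<i> * of_real (\<xi> * u) + of_real (\<xi>\<^sup>2 * m)) * w t $ 2 + \<i> * of_real (\<xi> * h) * w t $ 3)) (at t)) \<Longrightarrow>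
      (\<And>t. ((\<lambda>t. w t $ 3) has_vector_derivative
          - (\<i> * of_real (\<xi> * g) * w t $ 2 + (\<i> * of_real (\<xi> * u) + of_real (\<xi>\<^sup>2 * n)) * w t $ 3)) (at t)) \<Longrightarrow>
      t \<ge> 0 \<Longrightarrow> weighted_sq \<xi> (w t) \<le> K * exp (- c * (\<xi>\<^sup>2 / (1 + \<xi>\<^sup>2)) * t) * weighted_sq \<xi> (w 0)"
proof -
  define \<gamma> where "\<gamma> = h / g"
  define \<delta> where "\<delta> = Min {m / (\<rho> + m\<^sup>2 / k), \<gamma> * n * q0 / h\<^sup>2, 1, q0 / \<rho>}"
  define \<kappa> where "\<kappa> = Min {m, n, \<delta> * \<rho> / 2}"
  have \<gamma>: "\<gamma> > 0" using pos by (simp add: \<gamma>_def)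
  have \<rho>m: "\<rho> + m\<^sup>2 / k > 0" using pos by (simp add: add_pos_nonneg)
  have \<delta>: "\<delta> > 0" using pos \<gamma> \<rho>m unfolding \<delta>_def by (subst Min_gr_iff) auto
  have \<delta>_le: "\<delta> \<le> m / (\<rho> + m\<^sup>2 / k)" "\<delta> \<le> \<gamma> * n * q0 / h\<^sup>2" "\<delta> \<le> 1" "\<delta> \<le> q0 / \<rho>"
    unfolding \<delta>_def by (rule Min_le; simp)+
  have \<delta>1: "\<delta> * (\<rho> + m\<^sup>2 / k) \<le> m" and \<delta>2: "\<delta> * (h\<^sup>2 / q0) \<le> \<gamma> * n" 
    using \<delta>_le(1,2) pos \<rho>m by (simp_all add: pos_le_divide_eq pos_divide_le_eq)
  have \<kappa>: "\<kappa> > 0" using pos \<delta> unfolding \<kappa>_def by (subst Min_gr_iff) auto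
  have \<kappa>_le: "\<kappa> \<le> m" "\<kappa> \<le> n" "\<kappa> \<le> \<delta> * \<rho> / 2"
    unfolding \<kappa>_def by (rule Min_le; simp)+
  define C1 where "C1 = Max {q0 / \<rho>, k / \<rho>, 1, \<gamma>}"
  define C2 where "C2 = Min {q0 / \<rho>, k / \<rho>, 1, \<gamma>}"
  have C1: "q0 / \<rho> \<le> C1" "k / \<rho> \<le> C1" "1 \<le> C1" "\<gamma> \<le> C1" unfolding C1_def by (rule Max_ge; simp)+
  have C2: "C2 \<le> q0 / \<rho>" "C2 \<le> k / \<rho>" "C2 \<le> 1" "C2 \<le> \<gamma>" unfolding C2_def by (rule Min_le; simp)+
  have C2_pos: "C2 > 0" using pos \<gamma> unfolding C2_def by (subst Min_gr_iff) auto
  show ?thesis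
  proof
    show "3 * C1 / C2 > 0" using C1 C2_pos by simp
    show "2 * \<kappa> / 3 > 0" using \<kappa> by simp
    fix \<xi> and w :: "real \<Rightarrow> complex^3" and t :: real
    assume w1: "\<And>t. ((\<lambda>t. w t $ 1) has_vector_derivative
          - (\<i> * of_real (\<xi> * u) * w t $ 1 + \<i> * of_real (\<xi> * \<rho>) * w t $ 2)) (at t)"
      and w2: "\<And>t. ((\<lambda>t. w t $ 2) has_vector_derivative
          - (\<i> * of_real (\<xi> * (q0 + k * \<xi>\<^sup>2)) * w t $ 1 + (\<i> * of_real (\<xi> * u) + of_real (\<xi>\<^sup>2 * m)) * w t $ 2 + \<i> * of_real (\<xi> * h) * w t $ 3)) (at t)"
      and w3: "\<And>t. ((\<lambda>t. w t $ 3) has_vector_derivative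
          - (\<i> * of_real (\<xi> * g) * w t $ 2 + (\<i> * of_real (\<xi> * u) + of_real (\<xi>\<^sup>2 * n)) * w t $ 3)) (at t)"
      and t: "t \<ge> 0"
    define q where "q = q0 + k * \<xi>\<^sup>2"
    define \<sigma> where "\<sigma> = \<xi> / (1 + \<xi>\<^sup>2)"
    define \<tau> where "\<tau> = \<xi>\<^sup>2 / (1 + \<xi>\<^sup>2)"
    have one: "1 + \<xi>\<^sup>2 > 0" by (simp add: add_pos_nonneg)
    have q: "q \<ge> q0" "q \<ge> k * \<xi>\<^sup>2" "q > 0" using pos by (auto simp: q_def add_pos_nonneg)
    have \<tau>: "0 \<le> \<tau>" "\<tau> \<le> \<xi>\<^sup>2" "\<sigma> * \<xi> = \<tau>"
      using one divide_left_mono[of 1 "1 + \<xi>\<^sup>2" "\<xi>\<^sup>2"] by (simp_all add: \<tau>_def \<sigma>_def power2_eq_square)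
    have \<sigma>: "\<bar>\<sigma>\<bar> \<le> 1 / 2"
    proof -
      have "0 \<le> (\<xi> - 1)\<^sup>2" "0 \<le> (\<xi> + 1)\<^sup>2" by simp_all
      then have "2 * \<bar>\<xi>\<bar> \<le> 1 + \<xi>\<^sup>2" by (auto simp: power2_eq_square algebra_simps abs_if)
      then show ?thesis using one by (simp add: \<sigma>_def abs_divide pos_divide_le_eq)
    qed
    define a where "a t = Re (w t $ 1)" for t
    define b where "b t = Im (w t $ 1)" for t
    define c where "c t = Re (w t $ 2)" for t
    define d where "d t = Im (w t $ 2)" for t
    define e where "e t = Re (w t $ 3)" for t
    define f where "f t = Im (w t $ 3)" for t
    have ReD: "((\<lambda>t. Re (y t)) has_real_derivative Re y') (at t)" and ImD: "((\<lambda>t. Im (y t)) has_real_derivative Im y') (at t)"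
      if "(y has_vector_derivative y') (at t)" for y :: "real \<Rightarrow> complex" and y' t
      using bounded_linear.has_vector_derivative[OF bounded_linear_Re that] bounded_linear.has_vector_derivative[OF bounded_linear_Im that]
      by (simp_all add: has_real_derivative_iff_has_vector_derivative)
    have da: "(a has_real_derivative \<xi> * u * b t + \<xi> * \<rho> * d t) (at t)" for t
      using ReD[OF w1[of t]] by (simp add: a_def[abs_def] b_def[abs_def] c_def[abs_def] d_def[abs_def])
    have db: "(b has_real_derivative - \<xi> * u * a t - \<xi> * \<rho> * c t) (at t)" for t
      using ImD[OF w1[of t]] by (simp add: a_def[abs_def] b_def[abs_def] c_def[abs_def] d_def[abs_def])
    have dc: "(c has_real_derivative \<xi> * q * b t + \<xi> * u * d t + \<xi> * h * f t - \<xi>\<^sup>2 * m * c t) (at t)" for t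
      using ReD[OF w2[of t]] unfolding q_def[symmetric] by (simp add: a_def[abs_def] b_def[abs_def] c_def[abs_def] d_def[abs_def] e_def[abs_def] f_def[abs_def] algebra_simps)
    have dd: "(d has_real_derivative - \<xi> * q * a t - \<xi> * u * c t - \<xi> * h * e t - \<xi>\<^sup>2 * m * d t) (at t)" for t
      using ImD[OF w2[of t]] unfolding q_def[symmetric] by (simp add: a_def[abs_def] b_def[abs_def] c_def[abs_def] d_def[abs_def] e_def[abs_def] f_def[abs_def] algebra_simps)
    have de: "(e has_real_derivative \<xi> * g * d t + \<xi> * u * f t - \<xi>\<^sup>2 * n * e t) (at t)" for t
      using ReD[OF w3[of t]] by (simp add: a_def[abs_def] b_def[abs_def] c_def[abs_def] d_def[abs_def] e_def[abs_def] f_def[abs_def] algebra_simps)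
    have df: "(f has_real_derivative - \<xi> * g * c t - \<xi> * u * e t - \<xi>\<^sup>2 * n * f t) (at t)" for t
      using ImD[OF w3[of t]] by (simp add: a_def[abs_def] b_def[abs_def] c_def[abs_def] d_def[abs_def] e_def[abs_def] f_def[abs_def] algebra_simps)
    define X where "X t = (a t)\<^sup>2 + (b t)\<^sup>2" for t
    define Y where "Y t = (c t)\<^sup>2 + (d t)\<^sup>2" for t
    define Z where "Z t = (e t)\<^sup>2 + (f t)\<^sup>2" for t
    define G where "G t = a t * d t - b t * c t" for t
    define En where "En t = q / \<rho> * X t + Y t + \<gamma> * Z t" for t
    \<comment> \<open>The energy \<open>En\<close> dissipates no density; the derivative of \<open>G = Im (cnj w\<^sub>1 * w\<^sub>2)\<close>
      supplies the missing term \<open>- \<xi> * q * X\<close>.\<close>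
    define L where "L t = En t + \<delta> * \<sigma> * G t" for t
    define L' where "L' t = - 2 * \<xi>\<^sup>2 * m * Y t - 2 * \<gamma> * n * \<xi>\<^sup>2 * Z t
       + \<delta> * \<sigma> * (\<xi> * \<rho> * Y t - \<xi> * q * X t - \<xi> * h * (a t * e t + b t * f t) - \<xi>\<^sup>2 * m * G t)" for t
    have nonneg: "X t \<ge> 0" "Y t \<ge> 0" "Z t \<ge> 0" for t by (simp_all add: X_def Y_def Z_def)
    have dL: "(L has_real_derivative L' t) (at t)" for t
    proof -
      have "(L has_real_derivative
          q / \<rho> * (2 * a t * (\<xi> * u * b t + \<xi> * \<rho> * d t) + 2 * b t * (- \<xi> * u * a t - \<xi> * \<rho> * c t))
        + (2 * c t * (\<xi> * q * b t + \<xi> * u * d t + \<xi> * h * f t - \<xi>\<^sup>2 * m * c t) + 2 * d t * (- \<xi> * q * a t - \<xi> * u * c t - \<xi> * h * e t - \<xi>\<^sup>2 * m * d t))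
        + \<gamma> * (2 * e t * (\<xi> * g * d t + \<xi> * u * f t - \<xi>\<^sup>2 * n * e t) + 2 * f t * (- \<xi> * g * c t - \<xi> * u * e t - \<xi>\<^sup>2 * n * f t))
        + \<delta> * \<sigma> * ((\<xi> * u * b t + \<xi> * \<rho> * d t) * d t + a t * (- \<xi> * q * a t - \<xi> * u * c t - \<xi> * h * e t - \<xi>\<^sup>2 * m * d t)
           - ((- \<xi> * u * a t - \<xi> * \<rho> * c t) * c t + b t * (\<xi> * q * b t + \<xi> * u * d t + \<xi> * h * f t - \<xi>\<^sup>2 * m * c t)))) (at t)"
        unfolding L_def[abs_def] En_def X_def Y_def Z_def G_def
        by (rule derivative_eq_intros da db dc dd de df refl | simp)+
           (simp add: algebra_simps add_divide_distrib diff_divide_distrib)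
      also have "q / \<rho> * (2 * a t * (\<xi> * u * b t + \<xi> * \<rho> * d t) + 2 * b t * (- \<xi> * u * a t - \<xi> * \<rho> * c t)) 
         = 2 * q * \<xi> * (a t * d t - b t * c t)"
        using pos by (simp add: field_simps)
      also have "\<gamma> * (2 * e t * (\<xi> * g * d t + \<xi> * u * f t - \<xi>\<^sup>2 * n * e t) + 2 * f t * (- \<xi> * g * c t - \<xi> * u * e t - \<xi>\<^sup>2 * n * f t))
         = 2 * h * \<xi> * (d t * e t - c t * f t) - 2 * \<gamma> * n * \<xi>\<^sup>2 * Z t"
        using pos by (simp add: \<gamma>_def Z_def field_simps power2_eq_square)
      finally show ?thesis
        by (rule DERIV_cong) (simp add: L'_def X_def Y_def Z_def G_def algebra_simps power2_eq_square)
    qed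
    have cross: "\<bar>a t * e t + b t * f t\<bar> \<le> q * X t / (4 * h) + h / q0 * Z t" for t
    proof -
      have *: "\<bar>x * y\<bar> \<le> q / h * x\<^sup>2 / 4 + h / q0 * y\<^sup>2" for x y
      proof -
        have "\<bar>x\<bar> * \<bar>y\<bar> \<le> (q / h) * \<bar>x\<bar>\<^sup>2 / 4 + \<bar>y\<bar>\<^sup>2 / (q / h)"
          by (rule weighted_product_bound) (use q pos in simp)
        also have "\<bar>y\<bar>\<^sup>2 / (q / h) \<le> h / q0 * y\<^sup>2"
        proof -
          have "h / q \<le> h / q0" using q pos by (intro divide_left_mono) auto
          then have "h / q * y\<^sup>2 \<le> h / q0 * y\<^sup>2" by (rule mult_right_mono) simp
          then show ?thesis by (simp add: ac_simps)
        qed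
        finally show ?thesis by (simp add: abs_mult)
      qed
      have "\<bar>a t * e t + b t * f t\<bar> \<le> \<bar>a t * e t\<bar> + \<bar>b t * f t\<bar>" by (rule abs_triangle_ineq)
      also have "\<dots> \<le> (q / h * (a t)\<^sup>2 / 4 + h / q0 * (e t)\<^sup>2) + (q / h * (b t)\<^sup>2 / 4 + h / q0 * (f t)\<^sup>2)"
        by (intro add_mono *)
      finally show ?thesis by (simp add: X_def Z_def algebra_simps add_divide_distrib)
    qed
    have Gbound: "\<bar>\<xi> * m * G t\<bar> \<le> q * X t / 4 + m\<^sup>2 / k * Y t" for t
    proof -
      have *: "\<bar>\<xi> * m * (x * y)\<bar> \<le> k * \<xi>\<^sup>2 * x\<^sup>2 / 4 + m\<^sup>2 / k * y\<^sup>2" for x y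
      proof -
        have "\<bar>\<xi> * x\<bar> * \<bar>m * y\<bar> \<le> k * \<bar>\<xi> * x\<bar>\<^sup>2 / 4 + \<bar>m * y\<bar>\<^sup>2 / k"
          by (rule weighted_product_bound) (use pos in simp)
        then show ?thesis by (simp add: abs_mult power_mult_distrib ac_simps)
      qed
      have "\<bar>\<xi> * m * G t\<bar> \<le> \<bar>\<xi> * m * (a t * d t)\<bar> + \<bar>\<xi> * m * (b t * c t)\<bar>"
        unfolding G_def right_diff_distrib by (rule abs_triangle_ineq4)
      also have "\<dots> \<le> (k * \<xi>\<^sup>2 * (a t)\<^sup>2 / 4 + m\<^sup>2 / k * (d t)\<^sup>2) + (k * \<xi>\<^sup>2 * (b t)\<^sup>2 / 4 + m\<^sup>2 / k * (c t)\<^sup>2)"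
        by (intro add_mono *)
      also have "\<dots> = k * \<xi>\<^sup>2 * X t / 4 + m\<^sup>2 / k * Y t" by (simp add: X_def Y_def algebra_simps add_divide_distrib)
      also have "\<dots> \<le> q * X t / 4 + m\<^sup>2 / k * Y t" using mult_right_mono[OF q(2) nonneg(1)[of t]] by simp
      finally show ?thesis .
    qed
    have dissip: "L' t \<le> - (\<tau> * \<kappa>) * En t" for t
    proof -
      have "\<delta> * \<sigma> * (\<xi> * \<rho> * Y t - \<xi> * q * X t - \<xi> * h * (a t * e t + b t * f t) - \<xi>\<^sup>2 * m * G t)
        = \<delta> * \<tau> * (\<rho> * Y t - q * X t - h * (a t * e t + b t * f t) - \<xi> * m * G t)"
        unfolding \<tau>(3)[symmetric] by (simp add: algebra_simps power2_eq_square)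
      also have "\<dots> \<le> \<delta> * \<tau> * (\<rho> * Y t - q * X t + h * (q * X t / (4 * h) + h / q0 * Z t) + (q * X t / 4 + m\<^sup>2 / k * Y t))"
      proof (intro mult_left_mono)
        have "- (h * (a t * e t + b t * f t)) \<le> h * (q * X t / (4 * h) + h / q0 * Z t)"
        proof -
          have "- (a t * e t + b t * f t) \<le> q * X t / (4 * h) + h / q0 * Z t" using cross[of t] unfolding abs_le_iff by simp
          then show ?thesis using pos mult_left_mono[of "- (a t * e t + b t * f t)" _ h] by (simp only: mult_minus_right)
        qed
        then show "\<rho> * Y t - q * X t - h * (a t * e t + b t * f t) - \<xi> * m * G t
          \<le> \<rho> * Y t - q * X t + h * (q * X t / (4 * h) + h / q0 * Z t) + (q * X t / 4 + m\<^sup>2 / k * Y t)"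
          using Gbound[of t] by linarith
      qed (use \<delta> \<tau> in auto)
      also have "\<dots> = \<tau> * (\<delta> * (\<rho> + m\<^sup>2 / k) * Y t + \<delta> * (h\<^sup>2 / q0) * Z t - \<delta> * q * X t / 2)"
        using pos by (simp add: field_simps power2_eq_square)
      also have "\<dots> \<le> \<tau> * (m * Y t + \<gamma> * n * Z t - \<delta> * q * X t / 2)"
        using mult_right_mono[OF \<delta>1 nonneg(2)[of t]] mult_right_mono[OF \<delta>2 nonneg(3)[of t]]
        by (intro mult_left_mono \<tau>) auto
      finally have 1: "L' t \<le> - 2 * \<xi>\<^sup>2 * m * Y t - 2 * \<gamma> * n * \<xi>\<^sup>2 * Z t + \<tau> * (m * Y t + \<gamma> * n * Z t - \<delta> * q * X t / 2)"
        by (simp add: L'_def)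
      have 2: "2 * \<tau> * (m * Y t) \<le> 2 * \<xi>\<^sup>2 * (m * Y t)" "2 * \<tau> * (\<gamma> * n * Z t) \<le> 2 * \<xi>\<^sup>2 * (\<gamma> * n * Z t)"
        using \<tau> pos \<gamma> nonneg[of t] by (auto intro!: mult_right_mono)
      have 3: "\<kappa> * Y t \<le> m * Y t" by (rule mult_right_mono[OF \<kappa>_le(1) nonneg(2)])
      have 4: "\<kappa> * (\<gamma> * Z t) \<le> \<gamma> * n * Z t"
        using mult_right_mono[OF \<kappa>_le(2), of "\<gamma> * Z t"] \<gamma> nonneg(3)[of t] by (simp add: ac_simps)
      have 5: "\<kappa> * (q / \<rho> * X t) \<le> \<delta> * q * X t / 2"
        using mult_right_mono[OF \<kappa>_le(3), of "q / \<rho> * X t"] pos q nonneg(1)[of t] by simp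
      have "\<kappa> * En t \<le> m * Y t + \<gamma> * n * Z t + \<delta> * q * X t / 2"
        unfolding En_def distrib_left using 3 4 5 by linarith
      then have "\<tau> * (\<kappa> * En t) \<le> \<tau> * (m * Y t + \<gamma> * n * Z t + \<delta> * q * X t / 2)"
        by (rule mult_left_mono[OF _ \<tau>(1)])
      then show ?thesis using 1 2 by (simp add: algebra_simps)
    qed
    have equiv: "\<bar>\<delta> * \<sigma> * G t\<bar> \<le> En t / 2" for t
    proof -
      have "\<bar>\<delta> * \<sigma> * G t\<bar> = (\<delta> * \<bar>\<sigma>\<bar>) * \<bar>G t\<bar>" using \<delta> by (simp add: abs_mult)
      also have "\<dots> \<le> (\<delta> * (1/2)) * ((X t + Y t) / 2)"
        using \<sigma> \<delta> abs_det_le[of "a t" "d t" "b t" "c t"]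
        by (intro mult_mono mult_left_mono) (auto simp: G_def X_def Y_def)
      also have "\<dots> = (\<delta> * X t + \<delta> * Y t) / 4" by (simp add: algebra_simps)
      also have "\<dots> \<le> (q / \<rho> * X t + 1 * Y t) / 4"
      proof -
        have "q0 / \<rho> \<le> q / \<rho>" using q pos by (intro divide_right_mono) auto
        then have "\<delta> * X t \<le> q / \<rho> * X t" using \<delta>_le(4) nonneg by (intro mult_right_mono) auto
        moreover have "\<delta> * Y t \<le> 1 * Y t" using \<delta>_le(3) nonneg by (intro mult_right_mono) auto
        ultimately show ?thesis by (intro divide_right_mono add_mono) auto
      qed
      also have "\<dots> \<le> En t / 2" 
      proof -
        have *: "(x + 1 * y) / 4 \<le> (x + y + z) / 2" if "x \<ge> 0" "y \<ge> 0" "z \<ge> 0" for x y z :: real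
          using that by simp
        show ?thesis unfolding En_def using nonneg[of t] q pos \<gamma> by (intro * mult_nonneg_nonneg) auto
      qed
      finally show ?thesis .
    qed
    have "L' t \<le> - (2 * \<kappa> / 3 * \<tau>) * L t" for t
    proof -
      have "L t \<le> 3 / 2 * En t" using equiv[of t] by (simp add: L_def abs_le_iff)
      then have "(2 * \<kappa> / 3 * \<tau>) * L t \<le> (2 * \<kappa> / 3 * \<tau>) * (3 / 2 * En t)"
        using \<kappa> \<tau> by (intro mult_left_mono) auto
      then show ?thesis using dissip[of t] by (simp add: ac_simps)
    qed
    from gronwall_decay[OF dL this t] have "L t \<le> exp (- (2 * \<kappa> / 3 * \<tau>) * t) * L 0" .
    moreover have "L 0 \<le> 3 / 2 * En 0" using equiv[of 0] by (simp add: L_def abs_le_iff)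
    then have "exp (- (2 * \<kappa> / 3 * \<tau>) * t) * L 0 \<le> exp (- (2 * \<kappa> / 3 * \<tau>) * t) * (3 / 2 * En 0)"
      by (rule mult_left_mono) simp
    moreover have "En t \<le> 2 * L t" using equiv[of t] by (simp add: L_def abs_le_iff)
    ultimately have decay: "En t \<le> 3 * exp (- (2 * \<kappa> / 3 * \<tau>) * t) * En 0" by linarith
    have W: "weighted_sq \<xi> (w t) = (1 + \<xi>\<^sup>2) * X t + Y t + Z t" for t
      by (simp add: weighted_sq_def cmod_power2 X_def Y_def Z_def a_def[abs_def] b_def[abs_def] c_def[abs_def] d_def[abs_def] e_def[abs_def] f_def[abs_def])
    have up: "En t \<le> C1 * weighted_sq \<xi> (w t)" for t
    proof -
      have "q / \<rho> = q0 / \<rho> + k / \<rho> * \<xi>\<^sup>2" by (simp add: q_def add_divide_distrib)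
      also have "\<dots> \<le> C1 + C1 * \<xi>\<^sup>2" using C1 by (intro add_mono mult_right_mono) auto
      finally have "q / \<rho> * X t \<le> (C1 + C1 * \<xi>\<^sup>2) * X t" by (rule mult_right_mono[OF _ nonneg(1)])
      moreover have "1 * Y t \<le> C1 * Y t" "\<gamma> * Z t \<le> C1 * Z t"
        by (rule mult_right_mono[OF C1(3) nonneg(2)], rule mult_right_mono[OF C1(4) nonneg(3)])
      ultimately show ?thesis by (simp add: En_def W algebra_simps)
    qed
    have low: "C2 * weighted_sq \<xi> (w t) \<le> En t" for t
    proof -
      have "C2 + C2 * \<xi>\<^sup>2 \<le> q0 / \<rho> + k / \<rho> * \<xi>\<^sup>2" using C2 by (intro add_mono mult_right_mono) auto
      also have "\<dots> = q / \<rho>" by (simp add: q_def add_divide_distrib)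
      finally have "(C2 + C2 * \<xi>\<^sup>2) * X t \<le> q / \<rho> * X t" by (rule mult_right_mono[OF _ nonneg(1)])
      moreover have "C2 * Y t \<le> 1 * Y t" "C2 * Z t \<le> \<gamma> * Z t"
        by (rule mult_right_mono[OF C2(3) nonneg(2)], rule mult_right_mono[OF C2(4) nonneg(3)])
      ultimately show ?thesis by (simp add: En_def W algebra_simps)
    qed
    have "C2 * weighted_sq \<xi> (w t) \<le> 3 * exp (- (2 * \<kappa> / 3 * \<tau>) * t) * (C1 * weighted_sq \<xi> (w 0))"
      by (rule order_trans[OF low order_trans[OF decay mult_left_mono[OF up]]]) simp
    then show "weighted_sq \<xi> (w t) \<le> 3 * C1 / C2 * exp (- (2 * \<kappa> / 3) * (\<xi>\<^sup>2 / (1 + \<xi>\<^sup>2)) * t) * weighted_sq \<xi> (w 0)"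
      using C2_pos by (simp add: \<tau>_def[symmetric] field_simps)
  qed
qed

abbreviation mpow :: "complex^3^3 \<Rightarrow> nat \<Rightarrow> complex^3^3" where
  "mpow A n \<equiv> ((\<lambda>X. A ** X) ^^ n) (mat 1)"

lemma mpow_Suc_component: "mpow A (Suc n) $ i $ j = (\<Sum>k\<in>UNIV. A $ i $ k * mpow A n $ k $ j)"
  by (simp add: matrix_matrix_mult_def)

lemma mpow_scale: "mpow (- (t *\<^sub>R A)) n $ i $ j = of_real (- t) ^ n * mpow A n $ i $ j"
proof (induction n arbitrary: i j)
  case (Suc n)
  have "(- (t *\<^sub>R A)) $ i $ k = - of_real t * A $ i $ k" for k
    by (simp only: vector_scaleR_component vector_uminus_component) (simp add: scaleR_conv_of_real)
  then show ?case unfolding mpow_Suc_component Suc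
    by (simp add: sum_distrib_left ac_simps)
qed simp

lemma mpow_bound: "cmod (mpow A n $ i $ j) \<le> (\<Sum>i\<in>UNIV. \<Sum>k\<in>UNIV. cmod (A $ i $ k)) ^ n"
proof (induction n arbitrary: i j)
  case 0
  show ?case by (simp add: mat_def)
next
  case (Suc n)
  let ?K = "\<Sum>i\<in>UNIV. \<Sum>k\<in>UNIV. cmod (A $ i $ k)"
  have "cmod (mpow A (Suc n) $ i $ j) \<le> (\<Sum>k\<in>UNIV. cmod (A $ i $ k) * cmod (mpow A n $ k $ j))"
    unfolding mpow_Suc_component by (rule order_trans[OF norm_sum]) (simp add: norm_mult)
  also have "\<dots> \<le> (\<Sum>k\<in>UNIV. cmod (A $ i $ k) * ?K ^ n)"
    by (intro sum_mono mult_left_mono Suc) auto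
  also have "\<dots> = (\<Sum>k\<in>UNIV. cmod (A $ i $ k)) * ?K ^ n" by (simp add: sum_distrib_right)
  also have "\<dots> \<le> ?K * ?K ^ n"
    by (intro mult_right_mono member_le_sum[of i UNIV "\<lambda>i. \<Sum>k\<in>UNIV. cmod (A $ i $ k)"] zero_le_power sum_nonneg) auto
  finally show ?case by simp
qed

lemma summable_mpow: "summable (\<lambda>n. mpow A n $ i $ j / fact n * z ^ n)"
proof (rule summable_comparison_test')
  let ?K = "\<Sum>i\<in>UNIV. \<Sum>k\<in>UNIV. cmod (A $ i $ k)"
  show "summable (\<lambda>n. (?K * cmod z) ^ n /\<^sub>R fact n)" by (rule summable_exp_generic)
  fix n :: nat
  have "cmod (mpow A n $ i $ j) * cmod z ^ n / fact n \<le> ?K ^ n * cmod z ^ n / fact n"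
    by (intro divide_right_mono mult_right_mono mpow_bound) auto
  then show "norm (mpow A n $ i $ j / fact n * z ^ n) \<le> (?K * cmod z) ^ n /\<^sub>R fact n"
    by (simp add: norm_mult norm_divide norm_power norm_inverse power_mult_distrib divide_inverse ac_simps)
qed

lemma mat_exp_component: "mat_exp A $ i $ j = (\<Sum>n. mpow A n $ i $ j / fact n)"
proof -
  have "(\<lambda>n. mpow A n /\<^sub>R fact n) sums (\<chi> i j. \<Sum>n. mpow A n $ i $ j / fact n)"
    unfolding sums_def
  proof (intro vec_tendstoI)
    fix i j
    have "(\<lambda>n. mpow A n $ i $ j / fact n) sums (\<Sum>n. mpow A n $ i $ j / fact n)"
      using summable_mpow[of A i j 1] by (simp add: summable_sums)
    moreover have "(\<Sum>n<N. mpow A n /\<^sub>R fact n) $ i $ j = (\<Sum>n<N. mpow A n $ i $ j / fact n)" for N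
      by (simp only: sum_component vector_scaleR_component) (simp add: scaleR_conv_of_real divide_inverse mult.commute)
    ultimately show "(\<lambda>N. (\<Sum>n<N. mpow A n /\<^sub>R fact n) $ i $ j) \<longlonglongrightarrow> (\<chi> i j. \<Sum>n. mpow A n $ i $ j / fact n) $ i $ j"
      unfolding sums_def by simp
  qed
  then show ?thesis unfolding mat_exp_def by (simp add: sums_unique[symmetric])
qed

lemma mat_exp_scale: "mat_exp (- (t *\<^sub>R A)) $ i $ j = (\<Sum>n. mpow A n $ i $ j / fact n * of_real (- t) ^ n)"
  unfolding mat_exp_component mpow_scale by (simp add: ac_simps)

lemma mat_exp_0: "mat_exp (- (0 *\<^sub>R A)) = mat 1"
proof -
  have "mat_exp (- (0 *\<^sub>R A)) $ i $ j = mat 1 $ i $ j" for i j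
    unfolding mat_exp_scale using powser_zero[of "\<lambda>n. mpow A n $ i $ j / fact n"] by simp
  then show ?thesis by (simp add: vec_eq_iff)
qed

lemma mat_exp_derivative:
  "((\<lambda>t. mat_exp (- (t *\<^sub>R A)) $ i $ j) has_vector_derivative - ((A ** mat_exp (- (t *\<^sub>R A))) $ i $ j)) (at t)"
proof -
  let ?c = "\<lambda>n. mpow A n $ i $ j / fact n"
  let ?S = "\<lambda>z. \<Sum>n. ?c n * z ^ n"
  have diffs: "diffs ?c n = (\<Sum>k\<in>UNIV. A $ i $ k * (mpow A n $ k $ j / fact n))" for n
  proof -
    have "diffs ?c n = mpow A (Suc n) $ i $ j / fact n"
      using of_nat_eq_0_iff[of "Suc n", where ?'a=complex]
      unfolding diffs_def fact_Suc by (simp add: divide_simps del: funpow.simps of_nat_Suc)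
    then show ?thesis unfolding mpow_Suc_component by (simp add: sum_divide_distrib)
  qed
  have "(?S has_field_derivative (\<Sum>n. diffs ?c n * z ^ n)) (at z)" for z
    by (rule termdiffs_strong_converges_everywhere) (rule summable_mpow)
  from this[of "of_real (- t)"] have "((\<lambda>t. ?S (- t)) has_field_derivative - (\<Sum>n. diffs ?c n * of_real (- t) ^ n)) (at (of_real t))"
    using DERIV_chain2[of ?S _ uminus "of_real t" "-1" UNIV] by (auto intro!: derivative_eq_intros simp: DERIV_minus)
  then have 1: "((\<lambda>t. ?S (- of_real t)) has_vector_derivative - (\<Sum>n. diffs ?c n * of_real (- t) ^ n)) (at t)"
    by (rule has_vector_derivative_real_field)
  have "(\<Sum>n. diffs ?c n * of_real (- t) ^ n) = (\<Sum>k\<in>UNIV. A $ i $ k * (\<Sum>n. mpow A n $ k $ j / fact n * of_real (- t) ^ n))"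
  proof -
    have "(\<lambda>n. \<Sum>k\<in>UNIV. A $ i $ k * (mpow A n $ k $ j / fact n * of_real (- t) ^ n)) sums
       (\<Sum>k\<in>UNIV. A $ i $ k * (\<Sum>n. mpow A n $ k $ j / fact n * of_real (- t) ^ n))"
      by (intro sums_sum sums_mult summable_sums summable_mpow)
    then show ?thesis unfolding diffs by (simp add: sums_unique[symmetric] sum_distrib_right mult.assoc)
  qed
  then show ?thesis using 1 by (simp add: mat_exp_scale matrix_matrix_mult_def)
qed

lemma mat_exp_vector_derivative:
  "((\<lambda>t. (mat_exp (- (t *\<^sub>R A)) *v v) $ i) has_vector_derivative - ((A *v (mat_exp (- (t *\<^sub>R A)) *v v)) $ i)) (at t)"
proof -
  have "((\<lambda>t. \<Sum>j\<in>UNIV. mat_exp (- (t *\<^sub>R A)) $ i $ j * v $ j) has_vector_derivative (\<Sum>j\<in>UNIV. - ((A ** mat_exp (- (t *\<^sub>R A))) $ i $ j) * v $ j)) (at t)"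
    by (intro has_vector_derivative_sum has_vector_derivative_mult_left mat_exp_derivative)
  then show ?thesis
    unfolding matrix_vector_mul_assoc by (simp add: matrix_vector_mult_def sum_negf)
qed

lemma mat_exp_measurable:
  assumes "\<And>i j. (\<lambda>\<xi>. A \<xi> $ i $ j) \<in> borel_measurable borel"
  shows "(\<lambda>\<xi>. mat_exp (A \<xi>) $ i $ j) \<in> borel_measurable borel"
proof -
  have "(\<lambda>\<xi>. mpow (A \<xi>) n $ i $ j) \<in> borel_measurable borel" for n i j
  proof (induction n arbitrary: i j)
    case (Suc n)
    then show ?case unfolding mpow_Suc_component using assms by measurable
  qed simp
  then show ?thesis unfolding mat_exp_component by measurable
qed

lemma matrix_inv_eqI:
  fixes A D :: "'a::semiring_1^'n^'n"
  assumes "A ** D = mat 1" "D ** A = mat 1"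
  shows "matrix_inv A = D"
proof -
  have "A ** matrix_inv A = mat 1 \<and> matrix_inv A ** A = mat 1"
    unfolding matrix_inv_def by (rule someI[of _ D]) (use assms in simp)
  then show ?thesis using assms by (metis matrix_mul_assoc matrix_mul_lid matrix_mul_rid)
qed

lemma matrix_inv_A0:
  assumes "\<rho> > 0" "\<theta> > 0" "p\<^sub>\<rho> > 0" "e\<^sub>\<theta> > 0"
  shows "matrix_inv (A0_mat \<rho> \<theta> p\<^sub>\<rho> e\<^sub>\<theta>) = vector [vector [\<theta> * \<rho> / p\<^sub>\<rho>, 0, 0], vector [0, \<theta> / \<rho>, 0], vector [0, 0, \<theta>\<^sup>2 / (e\<^sub>\<theta> * \<rho>)]]"
    (is "_ = ?D")
proof (rule matrix_inv_eqI)
  show "A0_mat \<rho> \<theta> p\<^sub>\<rho> e\<^sub>\<theta> ** ?D = mat 1" "?D ** A0_mat \<rho> \<theta> p\<^sub>\<rho> e\<^sub>\<theta> = mat 1"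
    using assms by (simp_all add: A0_mat_def matrix_matrix_mult_def vec_eq_iff forall_3 sum_3 mat_def power2_eq_square)
qed

lemma M_symbol_mult:
  fixes w :: "complex^3" and \<rho> u \<theta> p\<^sub>\<rho> p\<^sub>\<theta> e\<^sub>\<theta> \<mu> \<alpha> k \<xi> :: real
  assumes "\<rho> > 0" "\<theta> > 0" "p\<^sub>\<rho> > 0" "e\<^sub>\<theta> > 0"
  defines "M \<equiv> M_symbol (A0_mat \<rho> \<theta> p\<^sub>\<rho> e\<^sub>\<theta>) (A1_mat \<rho> u \<theta> p\<^sub>\<rho> p\<^sub>\<theta> e\<^sub>\<theta>) (B_mat \<theta> \<mu> \<alpha>) (C_mat \<rho> \<theta> k) \<xi>"
  shows "(M *v w) $ 1 = \<i> * of_real (\<xi> * u) * w $ 1 + \<i> * of_real (\<xi> * \<rho>) * w $ 2"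
    "(M *v w) $ 2 = \<i> * of_real (\<xi> * (p\<^sub>\<rho> / \<rho> + k * \<xi>\<^sup>2)) * w $ 1 + (\<i> * of_real (\<xi> * u) + of_real (\<xi>\<^sup>2 * (\<mu> / \<rho>))) * w $ 2 + \<i> * of_real (\<xi> * (p\<^sub>\<theta> / \<rho>)) * w $ 3"
    "(M *v w) $ 3 = \<i> * of_real (\<xi> * (p\<^sub>\<theta> * \<theta> / (e\<^sub>\<theta> * \<rho>))) * w $ 2 + (\<i> * of_real (\<xi> * u) + of_real (\<xi>\<^sup>2 * (\<alpha> / (e\<^sub>\<theta> * \<rho>)))) * w $ 3"
  using assms unfolding M_def M_symbol_def matrix_inv_A0[OF assms(1-4)] cmat_def
  by (simp_all add: A1_mat_def B_mat_def C_mat_def matrix_matrix_mult_def matrix_vector_mult_def sum_3 power2_eq_square field_simps)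

lemma M_symbol_measurable:
  "(\<lambda>\<xi>. M_symbol A0 A1 B C \<xi> $ i $ j) \<in> borel_measurable borel"
  unfolding M_symbol_def matrix_matrix_mult_def by simp measurable

section \<open>Decay of the semigroup\<close>

lemma symbol_decay:
  fixes \<rho> u \<theta> p\<^sub>\<rho> p\<^sub>\<theta> e\<^sub>\<theta> \<mu> \<alpha> k :: real
  assumes "\<rho> > 0" "\<theta> > 0" "p\<^sub>\<rho> > 0" "p\<^sub>\<theta> > 0" "e\<^sub>\<theta> > 0" "\<mu> > 0" "\<alpha> > 0" "k > 0"
  defines "M \<equiv> M_symbol (A0_mat \<rho> \<theta> p\<^sub>\<rho> e\<^sub>\<theta>) (A1_mat \<rho> u \<theta> p\<^sub>\<rho> p\<^sub>\<theta> e\<^sub>\<theta>) (B_mat \<theta> \<mu> \<alpha>) (C_mat \<rho> \<theta> k)"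
  obtains K c where "K > 0" "c > 0"
    "\<And>\<xi> v t. t \<ge> 0 \<Longrightarrow> weighted_sq \<xi> (mat_exp (- (t *\<^sub>R M \<xi>)) *v v) \<le> K * exp (- c * (\<xi>\<^sup>2 / (1 + \<xi>\<^sup>2)) * t) * weighted_sq \<xi> v"
proof -
  have pos: "\<mu> / \<rho> > 0" "\<alpha> / (e\<^sub>\<theta> * \<rho>) > 0" "p\<^sub>\<theta> / \<rho> > 0" "p\<^sub>\<theta> * \<theta> / (e\<^sub>\<theta> * \<rho>) > 0" "p\<^sub>\<rho> / \<rho> > 0"
    using assms by simp_all
  note Mw = M_symbol_mult[OF assms(1,2,3,5), of u p\<^sub>\<theta> \<mu> \<alpha> k, folded M_def]
  show ?thesis
  proof (rule dissipative_decay[OF assms(1,8) pos, of u thesis])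
    fix K c :: real
    assume "K > 0" "c > 0" and decay: "\<And>\<xi> w t.
           (\<And>t. ((\<lambda>t. w t $ 1) has_vector_derivative - (\<i> * complex_of_real (\<xi> * u) * w t $ 1 + \<i> * complex_of_real (\<xi> * \<rho>) * w t $ 2)) (at t)) \<Longrightarrow>
           (\<And>t. ((\<lambda>t. w t $ 2) has_vector_derivative
                  - (\<i> * complex_of_real (\<xi> * (p\<^sub>\<rho> / \<rho> + k * \<xi>\<^sup>2)) * w t $ 1 + (\<i> * complex_of_real (\<xi> * u) + complex_of_real (\<xi>\<^sup>2 * (\<mu> / \<rho>))) * w t $ 2 +
                     \<i> * complex_of_real (\<xi> * (p\<^sub>\<theta> / \<rho>)) * w t $ 3)) (at t)) \<Longrightarrow>
           (\<And>t. ((\<lambda>t. w t $ 3) has_vector_derivative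
                  - (\<i> * complex_of_real (\<xi> * (p\<^sub>\<theta> * \<theta> / (e\<^sub>\<theta> * \<rho>))) * w t $ 2 +
                     (\<i> * complex_of_real (\<xi> * u) + complex_of_real (\<xi>\<^sup>2 * (\<alpha> / (e\<^sub>\<theta> * \<rho>)))) * w t $ 3)) (at t)) \<Longrightarrow>
           t \<ge> 0 \<Longrightarrow> weighted_sq \<xi> (w t) \<le> K * exp (- c * (\<xi>\<^sup>2 / (1 + \<xi>\<^sup>2)) * t) * weighted_sq \<xi> (w 0)"
    show thesis
    proof (rule that[OF \<open>K > 0\<close> \<open>c > 0\<close>])
      fix \<xi> t :: real and v :: "complex^3"
      assume t: "t \<ge> 0"
      let ?w = "\<lambda>t. mat_exp (- (t *\<^sub>R M \<xi>)) *v v"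
      have "weighted_sq \<xi> (?w t) \<le> K * exp (- c * (\<xi>\<^sup>2 / (1 + \<xi>\<^sup>2)) * t) * weighted_sq \<xi> (?w 0)"
        by (rule decay[OF _ _ _ t]; unfold Mw(1)[symmetric] Mw(2)[symmetric] Mw(3)[symmetric]; rule mat_exp_vector_derivative)
      then show "weighted_sq \<xi> (?w t) \<le> K * exp (- c * (\<xi>\<^sup>2 / (1 + \<xi>\<^sup>2)) * t) * weighted_sq \<xi> v"
        by (simp only: mat_exp_0 matrix_vector_mul_lid)
    qed
  qed
qed

lemma weighted_sq_nonneg: "weighted_sq \<xi> w \<ge> 0"
  by (simp add: weighted_sq_def)

lemma component_le_weighted_sq: "(cmod (w $ j))\<^sup>2 \<le> weighted_sq \<xi> w"
proof -
  have "(cmod (w $ 1))\<^sup>2 \<le> (1 + \<xi>\<^sup>2) * (cmod (w $ 1))\<^sup>2"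
    by (simp add: distrib_right)
  moreover have "0 \<le> (1 + \<xi>\<^sup>2) * (cmod (w $ 1))\<^sup>2" "0 \<le> (cmod (w $ 2))\<^sup>2" "0 \<le> (cmod (w $ 3))\<^sup>2" by simp_all
  moreover have "j = 1 \<or> j = 2 \<or> j = 3" by (rule exhaust_3)
  ultimately show ?thesis unfolding weighted_sq_def by (elim disjE; hypsubst; linarith)
qed

lemma integrable_add_iff_nonneg:
  fixes f g :: "'a \<Rightarrow> real"
  assumes "f \<in> borel_measurable M" "g \<in> borel_measurable M" "\<And>x. f x \<ge> 0" "\<And>x. g x \<ge> 0"
  shows "integrable M (\<lambda>x. f x + g x) \<longleftrightarrow> integrable M f \<and> integrable M g"
proof safe
  assume *: "integrable M (\<lambda>x. f x + g x)"
  show "integrable M f" "integrable M g"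
    by (rule Bochner_Integration.integrable_bound[OF *]; use assms in \<open>auto simp: abs_of_nonneg add_nonneg_nonneg\<close>)+
qed auto

lemma state_space_iff:
  fixes f g :: "real \<Rightarrow> complex^3"
  assumes fg: "\<And>j. is_fourier_L2 (\<lambda>x. f x $ j) (\<lambda>\<xi>. g \<xi> $ j)"
  shows "f \<in> state_space s \<longleftrightarrow> integrable lborel (\<lambda>\<xi>. (1 + \<xi>\<^sup>2) powr s * weighted_sq \<xi> (g \<xi>))"
proof -
  have [measurable]: "(\<lambda>\<xi>. g \<xi> $ j) \<in> borel_measurable borel" for j
    using is_fourier_L2_D(2)[OF fg[of j]] by auto
  have one: "1 + \<xi>\<^sup>2 > 0" for \<xi> :: real by (simp add: add_pos_nonneg)
  have iff: "(\<lambda>x. f x $ j) \<in> sobolev r \<longleftrightarrow> integrable lborel (\<lambda>\<xi>. (1 + \<xi>\<^sup>2) powr r * (cmod (g \<xi> $ j))\<^sup>2)" for j r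
  proof -
    have "(cmod (complex_of_real ((1 + \<xi>\<^sup>2) powr (r / 2)) * g \<xi> $ j))\<^sup>2 = (1 + \<xi>\<^sup>2) powr r * (cmod (g \<xi> $ j))\<^sup>2" for \<xi>
      by (simp add: norm_mult power_mult_distrib power2_eq_square flip: powr_add)
    then show ?thesis unfolding sobolev_iff[OF fg] L2_def by simp
  qed
  have W: "(1 + \<xi>\<^sup>2) powr s * weighted_sq \<xi> (g \<xi>) =
     (1 + \<xi>\<^sup>2) powr (s + 1) * (cmod (g \<xi> $ 1))\<^sup>2 + ((1 + \<xi>\<^sup>2) powr s * (cmod (g \<xi> $ 2))\<^sup>2 + (1 + \<xi>\<^sup>2) powr s * (cmod (g \<xi> $ 3))\<^sup>2)" for \<xi>
    using one[of \<xi>] by (simp add: weighted_sq_def powr_add algebra_simps)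
  show ?thesis
    unfolding state_space_def W mem_Collect_eq iff
    by (simp add: integrable_add_iff_nonneg)
qed

lemma power_le_powr_weight:
  assumes "real l \<le> s"
  shows "\<xi> ^ (2 * l) \<le> (1 + \<xi>\<^sup>2) powr s"
proof -
  have one: "1 + \<xi>\<^sup>2 \<ge> 1" by simp
  have "\<xi> ^ (2 * l) \<le> (1 + \<xi>\<^sup>2) ^ l" unfolding power_mult by (rule power_mono) auto
  also have "\<dots> = (1 + \<xi>\<^sup>2) powr real l" using one by (intro powr_realpow[symmetric]) linarith
  also have "\<dots> \<le> (1 + \<xi>\<^sup>2) powr s" using assms one by (rule powr_mono)
  finally show ?thesis .
qed

lemma deriv_norm_eq:
  fixes f g :: "real \<Rightarrow> complex^3"
  assumes fg: "\<And>j. is_fourier_L2 (\<lambda>x. f x $ j) (\<lambda>\<xi>. g \<xi> $ j)"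
    and f: "f \<in> state_space s" and l: "real l \<le> s"
  shows "integrable lborel (\<lambda>\<xi>. \<xi> ^ (2 * l) * weighted_sq \<xi> (g \<xi>))"
    "deriv_norm l f = sqrt (LINT \<xi>|lborel. \<xi> ^ (2 * l) * weighted_sq \<xi> (g \<xi>))"
proof -
  have [measurable]: "(\<lambda>\<xi>. g \<xi> $ j) \<in> borel_measurable borel" for j
    using is_fourier_L2_D(2)[OF fg[of j]] by auto
  have [measurable]: "(\<lambda>\<xi>. weighted_sq \<xi> (g \<xi>)) \<in> borel_measurable borel"
    unfolding weighted_sq_def by measurable
  have le: "\<xi> ^ (2 * l) * weighted_sq \<xi> (g \<xi>) \<le> (1 + \<xi>\<^sup>2) powr s * weighted_sq \<xi> (g \<xi>)" for \<xi>
    by (intro mult_right_mono power_le_powr_weight[OF l] weighted_sq_nonneg)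
  have nn: "0 \<le> \<xi> ^ (2 * l) * weighted_sq \<xi> (g \<xi>)" for \<xi>
    by (intro mult_nonneg_nonneg weighted_sq_nonneg) simp
  show int: "integrable lborel (\<lambda>\<xi>. \<xi> ^ (2 * l) * weighted_sq \<xi> (g \<xi>))"
  proof (rule Bochner_Integration.integrable_bound)
    show "integrable lborel (\<lambda>\<xi>. (1 + \<xi>\<^sup>2) powr s * weighted_sq \<xi> (g \<xi>))"
      using f unfolding state_space_iff[OF fg] .
    show "AE \<xi> in lborel. norm (\<xi> ^ (2 * l) * weighted_sq \<xi> (g \<xi>)) \<le> norm ((1 + \<xi>\<^sup>2) powr s * weighted_sq \<xi> (g \<xi>))"
      unfolding real_norm_def abs_of_nonneg[OF nn] abs_of_nonneg[OF order_trans[OF nn le]] by (simp add: le)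
  qed measurable
  let ?t1 = "\<lambda>\<xi>. (1 + \<xi>\<^sup>2) * \<xi> ^ (2 * l) * (cmod (g \<xi> $ 1))\<^sup>2"
  let ?t = "\<lambda>j \<xi>. \<xi> ^ (2 * l) * (cmod (g \<xi> $ j))\<^sup>2"
  have W: "\<xi> ^ (2 * l) * weighted_sq \<xi> (g \<xi>) = ?t1 \<xi> + (?t 2 \<xi> + ?t 3 \<xi>)" for \<xi>
    by (simp add: weighted_sq_def algebra_simps)
  have t: "integrable lborel ?t1" "integrable lborel (?t 2)" "integrable lborel (?t 3)"
    using int unfolding W
    by (simp_all add: integrable_add_iff_nonneg)
  have "?t j \<xi> \<le> \<xi> ^ (2 * l) * weighted_sq \<xi> (g \<xi>)" for j \<xi>
    by (intro mult_left_mono component_le_weighted_sq) simp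
  then have tj: "integrable lborel (?t j)" for j
    by (intro Bochner_Integration.integrable_bound[OF int]) (auto simp: abs_mult weighted_sq_nonneg)
  have nrm: "(cmod ((\<i> * complex_of_real \<xi>) ^ l * z))\<^sup>2 = \<xi> ^ (2 * l) * (cmod z)\<^sup>2" for \<xi> z
    by (simp add: norm_mult norm_power power_mult_distrib power_even_eq flip: power_abs)
  have L2: "(\<lambda>\<xi>. (\<i> * complex_of_real \<xi>) ^ l * g \<xi> $ j) \<in> L2" for j
    using tj[of j] by (simp only: L2_def mem_Collect_eq nrm) measurable
  note wd = is_fourier_L2_weak_deriv[OF fg L2]
  have "(L2_norm (weak_deriv l (\<lambda>x. f x $ j)))\<^sup>2 = (LINT \<xi>|lborel. ?t j \<xi>)" for j
    unfolding is_fourier_L2_norm[OF wd] unfolding L2_norm_def nrm by (simp add: integral_nonneg_AE)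
  moreover have "(sobolev_norm 1 (weak_deriv l (\<lambda>x. f x $ 1)))\<^sup>2 = (LINT \<xi>|lborel. ?t1 \<xi>)"
  proof -
    have "(cmod (complex_of_real ((1 + \<xi>\<^sup>2) powr (1 / 2)) * ((\<i> * complex_of_real \<xi>) ^ l * g \<xi> $ 1)))\<^sup>2 = ?t1 \<xi>" for \<xi>
    proof -
      have "(cmod (complex_of_real ((1 + \<xi>\<^sup>2) powr (1 / 2)) * z))\<^sup>2 = (1 + \<xi>\<^sup>2) * (cmod z)\<^sup>2" for z
        by (simp add: norm_mult power_mult_distrib powr_half_sqrt)
      then show ?thesis unfolding nrm by (simp add: nrm)
    qed
    then show ?thesis
      unfolding sobolev_norm_eq[OF wd] L2_norm_def by (simp add: integral_nonneg_AE)
  qed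
  ultimately show "deriv_norm l f = sqrt (LINT \<xi>|lborel. \<xi> ^ (2 * l) * weighted_sq \<xi> (g \<xi>))"
    unfolding deriv_norm_def W using t by simp
qed

lemma integrable_power_gauss:
  assumes "a > 0"
  shows "integrable lborel (\<lambda>\<xi>::real. \<xi> ^ (2 * l) * exp (- a * \<xi>\<^sup>2))"
proof -
  define \<sigma> where "\<sigma> = sqrt (1 / (2 * a))"
  have \<sigma>: "\<sigma> > 0" "\<sigma>\<^sup>2 = 1 / (2 * a)" using assms by (auto simp: \<sigma>_def)
  have "integrable lborel (\<lambda>\<xi>. sqrt (2 * pi * \<sigma>\<^sup>2) * (normal_density 0 \<sigma> \<xi> * (\<xi> - 0) ^ (2 * l)))"
    by (intro integrable_mult_right integrable_normal_moment \<sigma>)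
  also have "(\<lambda>\<xi>. sqrt (2 * pi * \<sigma>\<^sup>2) * (normal_density 0 \<sigma> \<xi> * (\<xi> - 0) ^ (2 * l))) = (\<lambda>\<xi>. \<xi> ^ (2 * l) * exp (- a * \<xi>\<^sup>2))"
    using assms \<sigma>(1) by (auto simp: normal_density_def \<sigma>(2) fun_eq_iff)
  finally show ?thesis .
qed

lemma integral_power_gauss_scale:
  assumes a: "a > 0" and T: "T > 0"
  shows "(LINT \<xi>|lborel. \<xi> ^ (2 * l) * exp (- a * T * \<xi>\<^sup>2)) = T powr (- (real l + 1 / 2)) * (LINT \<xi>|lborel. \<xi> ^ (2 * l) * exp (- a * \<xi>\<^sup>2))"
proof -
  let ?r = "1 / sqrt T"
  have "(LINT \<xi>|lborel. \<xi> ^ (2 * l) * exp (- a * T * \<xi>\<^sup>2)) = ?r * (LINT y|lborel. (?r * y) ^ (2 * l) * exp (- a * T * (?r * y)\<^sup>2))"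
    using T by (subst lborel_integral_real_affine[of ?r _ 0]) auto
  also have "(LINT y|lborel. (?r * y) ^ (2 * l) * exp (- a * T * (?r * y)\<^sup>2)) = (LINT y|lborel. ?r ^ (2 * l) * (y ^ (2 * l) * exp (- a * y\<^sup>2)))"
    using T by (intro Bochner_Integration.integral_cong) (auto simp: power_mult_distrib power_divide)
  also have "\<dots> = ?r ^ (2 * l) * (LINT y|lborel. y ^ (2 * l) * exp (- a * y\<^sup>2))" by simp
  also have "?r * (?r ^ (2 * l) * (LINT y|lborel. y ^ (2 * l) * exp (- a * y\<^sup>2))) = (?r * ?r ^ (2 * l)) * (LINT y|lborel. y ^ (2 * l) * exp (- a * y\<^sup>2))" by simp
  also have "?r * ?r ^ (2 * l) = T powr (- (real l + 1 / 2))"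
  proof -
    have "?r * ?r ^ (2 * l) = inverse (T powr (1 / 2) * T powr (real l))"
      using T by (simp add: powr_half_sqrt powr_realpow power_divide power_mult inverse_eq_divide)
    also have "\<dots> = T powr (- (real l + 1 / 2))" unfolding powr_add[symmetric] powr_minus by (simp add: add.commute)
    finally show ?thesis .
  qed
  finally show ?thesis .
qed

lemma fourier_component_bound:
  fixes f :: "real \<Rightarrow> complex^3"
  assumes f: "integrable lborel f"
  shows "integrable lborel (\<lambda>x. f x $ j)" "cmod (fourier (\<lambda>x. f x $ j) \<xi>) \<le> (LINT x|lborel. norm (f x))"
proof -
  show i: "integrable lborel (\<lambda>x. f x $ j)"
    by (rule integrable_bounded_linear[OF bounded_linear_vec_nth f])
  have "cmod (fourier (\<lambda>x. f x $ j) \<xi>) \<le> 1 / sqrt (2 * pi) * (LINT x|lborel. cmod (f x $ j))"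
    by (rule norm_fourier_le[OF i])
  also have "\<dots> \<le> 1 * (LINT x|lborel. norm (f x))"
  proof (rule mult_mono)
    have "1 \<le> sqrt (2 * pi)" using pi_ge_two by (intro real_le_rsqrt) simp
    then show "1 / sqrt (2 * pi) \<le> 1" by simp
    show "(LINT x|lborel. cmod (f x $ j)) \<le> (LINT x|lborel. norm (f x))"
      using i f by (intro integral_mono integrable_norm Finite_Cartesian_Product.norm_nth_le)
  qed (auto intro: integral_nonneg_AE)
  finally show "cmod (fourier (\<lambda>x. f x $ j) \<xi>) \<le> (LINT x|lborel. norm (f x))" by simp
qed

lemma frequency_split:
  fixes c t \<xi> W B :: real
  assumes c: "c > 0" and t: "t \<ge> 0" and W: "W \<ge> 0" "\<bar>\<xi>\<bar> \<le> 1 \<Longrightarrow> W \<le> B" and B: "B \<ge> 0"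
  shows "exp (- c * (\<xi>\<^sup>2 / (1 + \<xi>\<^sup>2)) * t) * W \<le> exp (- (c / 2) * t) * W + B * (exp (c / 2) * exp (- (c / 2) * (1 + t) * \<xi>\<^sup>2))"
proof -
  have one: "1 + \<xi>\<^sup>2 > 0" by (simp add: add_pos_nonneg)
  define z where "z = \<xi>\<^sup>2 / (1 + \<xi>\<^sup>2)"
  show ?thesis
  proof (cases "\<bar>\<xi>\<bar> \<le> 1")
    case True
    then have \<xi>: "\<xi>\<^sup>2 \<le> 1" by (simp add: abs_square_le_1)
    have "\<xi>\<^sup>2 / 2 \<le> \<xi>\<^sup>2 / (1 + \<xi>\<^sup>2)" using \<xi> by (intro divide_left_mono) (auto simp: add_pos_nonneg)
    then have "c * t * (\<xi>\<^sup>2 / 2) \<le> c * t * z" using c t unfolding z_def by (intro mult_left_mono) auto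
    moreover have "c * \<xi>\<^sup>2 \<le> c * 1" using c \<xi> by (intro mult_left_mono) auto
    ultimately have "- c * (\<xi>\<^sup>2 / (1 + \<xi>\<^sup>2)) * t \<le> c / 2 + - (c / 2) * (1 + t) * \<xi>\<^sup>2"
      unfolding z_def[symmetric] by (simp add: algebra_simps)
    then have "exp (- c * (\<xi>\<^sup>2 / (1 + \<xi>\<^sup>2)) * t) \<le> exp (c / 2) * exp (- (c / 2) * (1 + t) * \<xi>\<^sup>2)"
      by (simp add: mult_exp_exp)
    then have "exp (- c * (\<xi>\<^sup>2 / (1 + \<xi>\<^sup>2)) * t) * W \<le> exp (c / 2) * exp (- (c / 2) * (1 + t) * \<xi>\<^sup>2) * B"
      using W True by (intro mult_mono) auto
    then show ?thesis using W by (simp add: ac_simps add_increasing)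
  next
    case False
    then have "\<xi>\<^sup>2 \<ge> 1" using power_mono[of 1 "\<bar>\<xi>\<bar>" 2] by simp
    then have "1 / 2 \<le> \<xi>\<^sup>2 / (1 + \<xi>\<^sup>2)" using one by (simp add: field_simps)
    then have "c * t * (1 / 2) \<le> c * t * (\<xi>\<^sup>2 / (1 + \<xi>\<^sup>2))" using c t by (intro mult_left_mono) auto
    then have "exp (- c * (\<xi>\<^sup>2 / (1 + \<xi>\<^sup>2)) * t) \<le> exp (- (c / 2) * t)" by (simp add: algebra_simps)
    then have "exp (- c * (\<xi>\<^sup>2 / (1 + \<xi>\<^sup>2)) * t) * W \<le> exp (- (c / 2) * t) * W" using W by (intro mult_right_mono) auto
    then show ?thesis using B by (simp add: add_increasing2)
  qed
qed

lemma weighted_transform_integrable: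
  assumes [measurable]: "\<And>j. (\<lambda>\<xi>. g \<xi> $ j) \<in> borel_measurable borel"
    and int: "integrable lborel (\<lambda>\<xi>. (1 + \<xi>\<^sup>2) powr s * weighted_sq \<xi> (g \<xi>))" and s: "s \<ge> 1"
  shows "integrable lborel (\<lambda>\<xi>. g \<xi> $ j)" "(\<lambda>\<xi>. g \<xi> $ j) \<in> L2"
proof -
  have le: "(1 + \<xi>\<^sup>2) * (cmod (g \<xi> $ j))\<^sup>2 \<le> (1 + \<xi>\<^sup>2) powr s * weighted_sq \<xi> (g \<xi>)" for \<xi>
  proof (rule mult_mono)
    show "1 + \<xi>\<^sup>2 \<le> (1 + \<xi>\<^sup>2) powr s"
      using powr_mono[of 1 s "1 + \<xi>\<^sup>2"] s by (simp add: add_pos_nonneg)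
  qed (auto intro: component_le_weighted_sq)
  have "integrable lborel (\<lambda>\<xi>. (cmod (g \<xi> $ j))\<^sup>2)"
  proof (rule Bochner_Integration.integrable_bound[OF int])
    have "(cmod (g \<xi> $ j))\<^sup>2 \<le> (1 + \<xi>\<^sup>2) * (cmod (g \<xi> $ j))\<^sup>2" for \<xi> by (simp add: distrib_right)
    from order_trans[OF this le] show "AE \<xi> in lborel. norm ((cmod (g \<xi> $ j))\<^sup>2) \<le> norm ((1 + \<xi>\<^sup>2) powr s * weighted_sq \<xi> (g \<xi>))"
      by (auto simp: abs_mult weighted_sq_nonneg)
  qed measurable
  then show "(\<lambda>\<xi>. g \<xi> $ j) \<in> L2" by (simp add: L2_def)
  show "integrable lborel (\<lambda>\<xi>. g \<xi> $ j)"
  proof (rule Bochner_Integration.integrable_bound[OF Bochner_Integration.integrable_add[OF integrable_inverse_square int]])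
    have "cmod (g \<xi> $ j) \<le> 1 / (1 + \<xi>\<^sup>2) + (1 + \<xi>\<^sup>2) * (cmod (g \<xi> $ j))\<^sup>2" for \<xi>
    proof -
      have one: "1 + \<xi>\<^sup>2 > 0" by (simp add: add_pos_nonneg)
      have "1 * cmod (g \<xi> $ j) \<le> (1 + \<xi>\<^sup>2) * (cmod (g \<xi> $ j))\<^sup>2 / 4 + 1\<^sup>2 / (1 + \<xi>\<^sup>2)"
        using weighted_product_bound[OF one, of "cmod (g \<xi> $ j)" 1] by simp
      also have "\<dots> \<le> 1 / (1 + \<xi>\<^sup>2) + (1 + \<xi>\<^sup>2) * (cmod (g \<xi> $ j))\<^sup>2" using one by simp
      finally show ?thesis by simp
    qed
    from order_trans[OF this add_left_mono[OF le]]
    show "AE \<xi> in lborel. norm (g \<xi> $ j) \<le> norm (1 / (1 + \<xi>\<^sup>2) + (1 + \<xi>\<^sup>2) powr s * weighted_sq \<xi> (g \<xi>))"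
      by (auto intro: order_trans[OF _ abs_ge_self])
  qed measurable
qed

theorem corollary4p18:
  fixes \<rho> u \<theta> p\<^sub>\<rho> p\<^sub>\<theta> e\<^sub>\<theta> \<mu> \<alpha> k s :: real
  assumes "\<rho> > 0" "\<theta> > 0" "p\<^sub>\<rho> > 0" "p\<^sub>\<theta> > 0" "e\<^sub>\<theta> > 0" "\<mu> > 0" "\<alpha> > 0" "k > 0"
    and "s \<ge> 3"
  defines "S \<equiv> semigroup_op (A0_mat \<rho> \<theta> p\<^sub>\<rho> e\<^sub>\<theta>) (A1_mat \<rho> u \<theta> p\<^sub>\<rho> p\<^sub>\<theta> e\<^sub>\<theta>) (B_mat \<theta> \<mu> \<alpha>) (C_mat \<rho> \<theta> k)"
  shows "\<exists>C>0. \<exists>c\<^sub>1>0. \<forall>f l t. f \<in> state_space s \<and> integrable lborel f \<and> real l \<le> s \<and> t \<ge> 0 \<longrightarrow>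
           S t f \<in> state_space s \<and>
           deriv_norm l (S t f) \<le> C * exp (- c\<^sub>1 * t) * deriv_norm l f +
             C * (1 + t) powr (- (real l / 2 + 1 / 4)) * (LINT x|lborel. norm (f x))"
proof -
  define M where "M = M_symbol (A0_mat \<rho> \<theta> p\<^sub>\<rho> e\<^sub>\<theta>) (A1_mat \<rho> u \<theta> p\<^sub>\<rho> p\<^sub>\<theta> e\<^sub>\<theta>) (B_mat \<theta> \<mu> \<alpha>) (C_mat \<rho> \<theta> k)"
  obtain K c where K: "K > 0" and c: "c > 0" and
    decay: "\<And>\<xi> v t. t \<ge> 0 \<Longrightarrow> weighted_sq \<xi> (mat_exp (- (t *\<^sub>R M \<xi>)) *v v) \<le> K * exp (- c * (\<xi>\<^sup>2 / (1 + \<xi>\<^sup>2)) * t) * weighted_sq \<xi> v"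
    using symbol_decay[OF assms(1-8), of u] unfolding M_def by blast
  define J where "J l = (LINT \<xi>|lborel. \<xi> ^ (2 * l) * exp (- (c / 2) * \<xi>\<^sup>2))" for l :: nat
  define D where "D l = sqrt (4 * K * exp (c / 2) * J l)" for l
  \<comment> \<open>A sum over all admissible orders, since \<open>C\<close> must not depend on \<open>l\<close>.\<close>
  define C where "C = sqrt K + (\<Sum>l\<le>nat \<lfloor>s\<rfloor>. D l)"
  have J: "J l \<ge> 0" for l unfolding J_def by (intro integral_nonneg_AE) auto
  have D: "D l \<ge> 0" for l using J K by (simp add: D_def)
  have C: "C > 0" "sqrt K \<le> C" using K D by (auto simp: C_def intro!: add_pos_nonneg sum_nonneg)
  have C_D: "D l \<le> C" if "real l \<le> s" for l
  proof -
    have "l \<le> nat \<lfloor>s\<rfloor>" using that by linarith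
    then have "D l \<le> (\<Sum>l\<le>nat \<lfloor>s\<rfloor>. D l)" using D by (intro member_le_sum) auto
    then show ?thesis using K by (simp add: C_def add_increasing)
  qed
  have "S t f \<in> state_space s \<and>
           deriv_norm l (S t f) \<le> C * exp (- (c / 4) * t) * deriv_norm l f +
             C * (1 + t) powr (- (real l / 2 + 1 / 4)) * (LINT x|lborel. norm (f x))"
    if f: "f \<in> state_space s" "integrable lborel f" and l: "real l \<le> s" and t: "t \<ge> 0" for f l t
  proof -
    define F where "F \<xi> = (\<chi> j. fourier (\<lambda>y. f y $ j) \<xi>)" for \<xi>
    define G where "G \<xi> = mat_exp (- (t *\<^sub>R M \<xi>)) *v F \<xi>" for \<xi>
    define N where "N = (LINT x|lborel. norm (f x))"
    have N: "N \<ge> 0" unfolding N_def by (intro integral_nonneg_AE) auto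
    have fj: "integrable lborel (\<lambda>x. f x $ j)" for j by (rule fourier_component_bound[OF f(2)])
    then have [measurable]: "(\<lambda>x. f x $ j) \<in> borel_measurable borel" for j using borel_measurable_integrable by force
    have Fj: "(\<lambda>\<xi>. F \<xi> $ j) = fourier (\<lambda>x. f x $ j)" for j by (simp add: F_def fun_eq_iff)
    have [measurable]: "(\<lambda>\<xi>. F \<xi> $ j) \<in> borel_measurable borel" for j unfolding Fj by measurable
    have "(\<lambda>x. f x $ j) \<in> L2" for j
      using f(1) exhaust_3[of j] by (auto simp: state_space_def sobolev_def)
    then have fF: "is_fourier_L2 (\<lambda>x. f x $ j) (\<lambda>\<xi>. F \<xi> $ j)" for j
      unfolding Fj by (intro is_fourier_L2_fourier fj)
    have [measurable]: "(\<lambda>\<xi>. G \<xi> $ j) \<in> borel_measurable borel" for j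
    proof -
      have [measurable]: "(\<lambda>\<xi>. mat_exp (- (t *\<^sub>R M \<xi>)) $ i $ j) \<in> borel_measurable borel" for i j
        by (rule mat_exp_measurable) (simp add: M_def borel_measurable_uminus borel_measurable_scaleR M_symbol_measurable)
      show ?thesis unfolding G_def matrix_vector_mult_def by simp
    qed
    have W_meas [measurable]: "(\<lambda>\<xi>. weighted_sq \<xi> (G \<xi>)) \<in> borel_measurable borel" "(\<lambda>\<xi>. weighted_sq \<xi> (F \<xi>)) \<in> borel_measurable borel"
      unfolding weighted_sq_def by measurable
    have GK: "weighted_sq \<xi> (G \<xi>) \<le> K * weighted_sq \<xi> (F \<xi>)" for \<xi>
    proof -
      have "weighted_sq \<xi> (G \<xi>) \<le> K * exp (- c * (\<xi>\<^sup>2 / (1 + \<xi>\<^sup>2)) * t) * weighted_sq \<xi> (F \<xi>)"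
        unfolding G_def by (rule decay[OF t])
      also have "\<dots> \<le> K * 1 * weighted_sq \<xi> (F \<xi>)"
        using K c t by (intro mult_right_mono mult_left_mono) (auto simp: weighted_sq_nonneg)
      finally show ?thesis by simp
    qed
    have intF: "integrable lborel (\<lambda>\<xi>. (1 + \<xi>\<^sup>2) powr s * weighted_sq \<xi> (F \<xi>))"
      using f(1) unfolding state_space_iff[OF fF] .
    have intG: "integrable lborel (\<lambda>\<xi>. (1 + \<xi>\<^sup>2) powr s * weighted_sq \<xi> (G \<xi>))"
    proof (rule Bochner_Integration.integrable_bound[OF integrable_mult_right[OF intF, of K]])
      have "(1 + \<xi>\<^sup>2) powr s * weighted_sq \<xi> (G \<xi>) \<le> K * ((1 + \<xi>\<^sup>2) powr s * weighted_sq \<xi> (F \<xi>))" for \<xi>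
        using mult_left_mono[OF GK[of \<xi>], of "(1 + \<xi>\<^sup>2) powr s"] by (simp add: ac_simps)
      then show "AE \<xi> in lborel. norm ((1 + \<xi>\<^sup>2) powr s * weighted_sq \<xi> (G \<xi>)) \<le> norm (K * ((1 + \<xi>\<^sup>2) powr s * weighted_sq \<xi> (F \<xi>)))"
        using K by (auto simp: abs_mult weighted_sq_nonneg)
    qed measurable
    have SG: "is_fourier_L2 (\<lambda>x. S t f x $ j) (\<lambda>\<xi>. G \<xi> $ j)" for j
    proof -
      have eq: "(\<lambda>x. S t f x $ j) = inv_fourier (\<lambda>\<xi>. G \<xi> $ j)"
        by (simp add: S_def semigroup_op_def G_def F_def M_def fun_eq_iff)
      have s1: "s \<ge> 1" using assms(9) by simp
      have m: "(\<lambda>\<xi>. G \<xi> $ j) \<in> borel_measurable borel" for j by measurable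
      show ?thesis
        unfolding eq by (rule is_fourier_L2_inv_fourier) (rule weighted_transform_integrable[OF m intG s1])+
    qed
    have S: "S t f \<in> state_space s" unfolding state_space_iff[OF SG] by (rule intG)
    note dS = deriv_norm_eq[OF SG S l] and df = deriv_norm_eq[OF fF f(1) l]
    let ?A = "\<lambda>\<xi>. K * exp (- (c / 2) * t) * (\<xi> ^ (2 * l) * weighted_sq \<xi> (F \<xi>))"
    let ?B = "\<lambda>\<xi>. (4 * K * N\<^sup>2 * exp (c / 2)) * (\<xi> ^ (2 * l) * exp (- (c / 2) * (1 + t) * \<xi>\<^sup>2))"
    have F_le: "weighted_sq \<xi> (F \<xi>) \<le> 4 * N\<^sup>2" if "\<bar>\<xi>\<bar> \<le> 1" for \<xi>
    proof -
      have "(cmod (F \<xi> $ j))\<^sup>2 \<le> N\<^sup>2" for j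
        unfolding N_def F_def using fourier_component_bound(2)[OF f(2), of j \<xi>] by (intro power_mono) auto
      from this[of 1] this[of 2] this[of 3] have "2 * (cmod (F \<xi> $ 1))\<^sup>2 + (cmod (F \<xi> $ 2))\<^sup>2 + (cmod (F \<xi> $ 3))\<^sup>2 \<le> 4 * N\<^sup>2"
        by linarith
      moreover have "1 + \<xi>\<^sup>2 \<le> 2" using that by (simp add: abs_square_le_1)
      then have "(1 + \<xi>\<^sup>2) * (cmod (F \<xi> $ 1))\<^sup>2 \<le> 2 * (cmod (F \<xi> $ 1))\<^sup>2" by (rule mult_right_mono) simp
      ultimately show ?thesis unfolding weighted_sq_def by linarith
    qed
    have pointwise: "\<xi> ^ (2 * l) * weighted_sq \<xi> (G \<xi>) \<le> ?A \<xi> + ?B \<xi>" for \<xi>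
    proof -
      have "weighted_sq \<xi> (G \<xi>) \<le> K * (exp (- c * (\<xi>\<^sup>2 / (1 + \<xi>\<^sup>2)) * t) * weighted_sq \<xi> (F \<xi>))"
        using decay[OF t, of \<xi> "F \<xi>"] by (simp add: G_def mult.assoc)
      also have "\<dots> \<le> K * (exp (- (c / 2) * t) * weighted_sq \<xi> (F \<xi>) + 4 * N\<^sup>2 * (exp (c / 2) * exp (- (c / 2) * (1 + t) * \<xi>\<^sup>2)))"
        using K by (intro mult_left_mono frequency_split c t weighted_sq_nonneg F_le) auto
      finally have "\<xi> ^ (2 * l) * weighted_sq \<xi> (G \<xi>) \<le> \<xi> ^ (2 * l) * \<dots>"
        by (rule mult_left_mono) simp
      then show ?thesis by (simp add: algebra_simps)
    qed
    have intB: "integrable lborel (\<lambda>\<xi>. \<xi> ^ (2 * l) * exp (- (c / 2) * (1 + t) * \<xi>\<^sup>2))"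
      using integrable_power_gauss[of "c / 2 * (1 + t)" l] c t by simp
    have "(LINT \<xi>|lborel. \<xi> ^ (2 * l) * weighted_sq \<xi> (G \<xi>)) \<le> (LINT \<xi>|lborel. ?A \<xi> + ?B \<xi>)"
      by (intro integral_mono dS Bochner_Integration.integrable_add integrable_mult_right df intB pointwise)
    also have "\<dots> = (LINT \<xi>|lborel. ?A \<xi>) + (LINT \<xi>|lborel. ?B \<xi>)"
      by (intro Bochner_Integration.integral_add integrable_mult_right df intB)
    also have "\<dots> = K * exp (- (c / 2) * t) * (deriv_norm l f)\<^sup>2 + (4 * K * N\<^sup>2 * exp (c / 2)) * ((1 + t) powr (- (real l + 1 / 2)) * J l)"
    proof -
      have "(LINT \<xi>|lborel. \<xi> ^ (2 * l) * weighted_sq \<xi> (F \<xi>)) = (deriv_norm l f)\<^sup>2"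
        unfolding df(2) by (intro real_sqrt_pow2[symmetric] integral_nonneg_AE) (auto simp: weighted_sq_nonneg)
      moreover have "(LINT \<xi>|lborel. \<xi> ^ (2 * l) * exp (- (c / 2) * (1 + t) * \<xi>\<^sup>2)) = (1 + t) powr (- (real l + 1 / 2)) * J l"
        unfolding J_def using c t by (intro integral_power_gauss_scale) auto
      ultimately show ?thesis by (simp only: integral_mult_right_zero)
    qed
    also have "\<dots> = (sqrt K * exp (- (c / 4) * t) * deriv_norm l f)\<^sup>2 + (D l * (1 + t) powr (- (real l / 2 + 1 / 4)) * N)\<^sup>2"
    proof -
      have 1: "(exp (- (c / 4) * t))\<^sup>2 = exp (- (c / 2) * t)"
        unfolding power2_eq_square mult_exp_exp by simp
      have 2: "((1 + t) powr (- (real l / 2 + 1 / 4)))\<^sup>2 = (1 + t) powr (- (real l + 1 / 2))"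
        unfolding power2_eq_square powr_add[symmetric] by simp
      have 3: "(D l)\<^sup>2 = 4 * K * exp (c / 2) * J l" "(sqrt K)\<^sup>2 = K" using K J by (simp_all add: D_def)
      show ?thesis unfolding power_mult_distrib 1 2 3 by simp
    qed
    finally have "deriv_norm l (S t f) \<le> sqrt \<dots>" unfolding dS(2) by (rule real_sqrt_le_mono)
    also have "\<dots> \<le> sqrt K * exp (- (c / 4) * t) * deriv_norm l f + D l * (1 + t) powr (- (real l / 2 + 1 / 4)) * N"
      using K D N by (intro sqrt_sum_squares_le_sum) (auto simp: deriv_norm_def)
    also have "\<dots> \<le> C * exp (- (c / 4) * t) * deriv_norm l f + C * (1 + t) powr (- (real l / 2 + 1 / 4)) * N"
      using C(2) C_D[OF l] N by (intro add_mono mult_right_mono) (auto simp: deriv_norm_def)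
    finally show ?thesis using S unfolding N_def by blast
  qed
  then show ?thesis using C(1) c by (intro exI[of _ C] conjI exI[of _ "c / 4"]) auto
qed

end
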